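(* (i) There exists a finitely generated subgroup $G_1$ of $\prod_{r=1}^\infty UT_r(\mathbb{Z})$ that is not equationally Noetherian, where $UT_r(\mathbb{Z}) \leq GL_r(\mathbb{Z})$ is the subgroup of upper unitriangular matrices. In particular, $G_1$ is residually torsion-free nilpotent, and so residually a finite $p$-group for any fixed prime $p$. (ii) Let $G$ be a non-trivial finitely generated abelian group and let $H$ be a finitely generated group that has an infinite locally finite subgroup. Then the group $G_2 = G \wr H$ is not equationally Noetherian. In particular, if $H$ is cyclic subgroup separable and conjugacy separable, then $G_2$ is (not equationally Noetherian and) cyclic subgroup separable and conjugacy separable.
   Context: For $n \geq 1$ let $F_n$ be the free group with free basis $X_1,\ldots,X_n$. For a group $G$, $s \in F_n$ and $(g_1,\ldots,g_n) \in G^n$, $s(g_1,\ldots,g_n) \in G$ is the image of $s$ under the homomorphism $F_n \to G$, $X_i \mapsto g_i$. For $S \subseteq F_n$ put $V_G(S) = \{ (g_1,\ldots,g_n) \in G^n \mid s(g_1,\ldots,g_n) = 1 \text{ for all } s \in S \}$. A group $G$ is equationally Noetherian if for every $n \geq 1$ and every $S \subseteq F_n$ there is a finite subset $S_0 \subseteq S$ with $V_G(S_0) = V_G(S)$. For a family (or property) $\mathcal{F}$ of groups, $G$ is residually $\mathcal{F}$ if for every $1 \neq g \in G$ there is a homomorphism $\varphi: G \to Q$ with $Q \in \mathcal{F}$ and $\varphi(g) \neq 1$. A subset $A \subseteq G$ is separable in $G$ if for every $g \in G \setminus A$ there is a homomorphism $\varphi: G \to Q$ with $Q$ finite and $\varphi(g)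 \notin \varphi(A)$. A group is conjugacy separable (respectively cyclic subgroup separable) if each of its conjugacy classes (respectively cyclic subgroups) is separable in it. $G \wr H$ denotes the regular restricted wreath product $\left(\bigoplus_{h \in H} G\right) \rtimes H$. A group is locally finite if all its finitely generated subgroups are finite. *)

theory Defs
  imports
    "HOL-Algebra.Algebra"
    "HOL-Computational_Algebra.Primes"
    "Jordan_Normal_Form.Determinant"
begin

section \<open>Free groups and equations over groups\<close>

text \<open>The letter \<open>(i, True)\<close> stands for \<open>X\<^sub>i\<close> and \<open>(i, False)\<close> for its inverse. The elements of
  the free group are the reduced words, multiplied by concatenation followed by cancellation.\<close>

type_synonym letter = "nat \<times> bool"

definition cancels :: "letter \<Rightarrow> letter \<Rightarrow> bool"
  where "cancels a b \<longleftrightarrow> fst a = fst b \<and> snd a \<noteq> snd b"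

definition reduced :: "letter list \<Rightarrow> bool"
  where "reduced = successively (\<lambda>a b. \<not> cancels a b)"

fun cons_red :: "letter \<Rightarrow> letter list \<Rightarrow> letter list"
  where
    "cons_red a [] = [a]"
  | "cons_red a (b # w) = (if cancels a b then w else a # b # w)"

definition free_group :: "nat \<Rightarrow> letter list monoid"
  where "free_group n =
    \<lparr>carrier = {w. set w \<subseteq> {1..n} \<times> UNIV \<and> reduced w},
     monoid.mult = foldr cons_red,
     one = []\<rparr>"

definition word_eval :: "('a, 'm) monoid_scheme \<Rightarrow> (nat \<Rightarrow> 'a) \<Rightarrow> letter list \<Rightarrow> 'a"
  where "word_eval G g w =
    foldr (\<lambda>(i, b) x. (if b then g i else inv\<^bsub>G\<^esub> g i) \<otimes>\<^bsub>G\<^esub> x) w \<one>\<^bsub>G\<^esub>"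

definition solution_set :: "('a, 'm) monoid_scheme \<Rightarrow> nat \<Rightarrow> letter list set \<Rightarrow> (nat \<Rightarrow> 'a) set"
  where "solution_set G n S =
    {g \<in> {1..n} \<rightarrow>\<^sub>E carrier G. \<forall>s\<in>S. word_eval G g s = \<one>\<^bsub>G\<^esub>}"

definition equationally_noetherian :: "('a, 'm) monoid_scheme \<Rightarrow> bool"
  where "equationally_noetherian G \<longleftrightarrow>
    (\<forall>n\<ge>1. \<forall>S \<subseteq> carrier (free_group n).
       \<exists>S\<^sub>0 \<subseteq> S. finite S\<^sub>0 \<and> solution_set G n S\<^sub>0 = solution_set G n S)"

text \<open>The next lemmas justify the two encodings: \<open>free_group n\<close> is a group, and \<open>word_eval G g\<close> is
  the unique homomorphism to \<open>G\<close> that maps \<open>X\<^sub>i\<close> to \<open>g i\<close>.\<close>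

lemma reduced_Cons: "reduced (a # w) \<longleftrightarrow> (w = [] \<or> \<not> cancels a (hd w)) \<and> reduced w"
  by (cases w) (auto simp: reduced_def)

lemma reduced_Nil [simp]: "reduced []"
  by (simp add: reduced_def)

lemma reduced_cons_red: "reduced w \<Longrightarrow> reduced (cons_red a w)"
  by (cases w) (auto simp: reduced_Cons)

lemma set_cons_red: "set (cons_red a w) \<subseteq> insert a (set w)"
  by (cases w) auto

lemma reduced_foldr_cons_red: "reduced v \<Longrightarrow> reduced (foldr cons_red u v)"
  by (induction u) (auto intro: reduced_cons_red)

lemma set_foldr_cons_red: "set (foldr cons_red u v) \<subseteq> set u \<union> set v"
  by (induction u) (use set_cons_red in fastforce)+

lemma foldr_cons_red_Nil: "reduced u \<Longrightarrow> foldr cons_red u [] = u"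
proof (induction u)
  case (Cons a u)
  then show ?case by (cases u) (auto simp: reduced_Cons)
qed simp

lemma cons_red_cancel:
  assumes "cancels a b" "reduced w"
  shows "cons_red a (cons_red b w) = w"
proof (cases w)
  case (Cons c v)
  show ?thesis
  proof (cases "cancels b c")
    case True
    then have "a = c" using assms by (auto simp: cancels_def prod_eq_iff)
    then show ?thesis using Cons True assms by (cases v) (auto simp: reduced_Cons)
  qed (use Cons assms in auto)
qed (use assms in auto)

lemma foldr_cons_red_cons_red:
  "reduced w \<Longrightarrow> foldr cons_red (cons_red a v) w = cons_red a (foldr cons_red v w)"
  by (cases v) (auto simp: cons_red_cancel reduced_foldr_cons_red)

lemma foldr_cons_red_assoc:
  "reduced w \<Longrightarrow>
    foldr cons_red (foldr cons_red u v) w = foldr cons_red u (foldr cons_red v w)"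
  by (induction u) (auto simp: foldr_cons_red_cons_red)

definition inv_letter :: "letter \<Rightarrow> letter"
  where "inv_letter a = (fst a, \<not> snd a)"

lemma foldr_cons_red_inv:
  assumes "reduced v"
  shows "foldr cons_red (rev (map inv_letter u)) (foldr cons_red u v) = v"
  using assms
proof (induction u arbitrary: v)
  case (Cons a u)
  have "cancels (inv_letter a) a" by (auto simp: cancels_def inv_letter_def)
  then show ?case using Cons by (simp add: cons_red_cancel reduced_foldr_cons_red)
qed simp

lemma reduced_rev_inv: "reduced u \<Longrightarrow> reduced (rev (map inv_letter u))"
  unfolding reduced_def successively_rev successively_map
  by (erule successively_mono) (auto simp: cancels_def inv_letter_def)

lemma group_free_group: "group (free_group n)"
proof (rule groupI)
  fix x assume x: "x \<in> carrier (free_group n)"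
  let ?y = "rev (map inv_letter x)"
  have "?y \<in> carrier (free_group n)"
    using x by (auto simp: free_group_def reduced_rev_inv inv_letter_def)
  moreover have "foldr cons_red ?y x = []"
    using foldr_cons_red_inv[of "[]" x] x by (simp add: foldr_cons_red_Nil free_group_def)
  ultimately show "\<exists>y\<in>carrier (free_group n). y \<otimes>\<^bsub>free_group n\<^esub> x = \<one>\<^bsub>free_group n\<^esub>"
    by (intro bexI[of _ ?y]) (simp_all add: free_group_def)
next
  fix x y assume "x \<in> carrier (free_group n)" "y \<in> carrier (free_group n)"
  then show "x \<otimes>\<^bsub>free_group n\<^esub> y \<in> carrier (free_group n)"
    using set_foldr_cons_red[of x y] by (auto simp: free_group_def reduced_foldr_cons_red)
qed (auto simp: free_group_def foldr_cons_red_assoc)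

lemma word_eval_Cons:
  "word_eval G g ((i, b) # w) = (if b then g i else inv\<^bsub>G\<^esub> g i) \<otimes>\<^bsub>G\<^esub> word_eval G g w"
  by (simp add: word_eval_def)

lemma word_eval_Nil [simp]: "word_eval G g [] = \<one>\<^bsub>G\<^esub>"
  by (simp add: word_eval_def)

lemma (in group) word_eval_closed:
  assumes "g \<in> {1..n} \<rightarrow> carrier G" "set w \<subseteq> {1..n} \<times> UNIV"
  shows "word_eval G g w \<in> carrier G"
  using assms(2)
proof (induction w)
  case (Cons a w)
  obtain i b where a: "a = (i, b)" by fastforce
  have "g i \<in> carrier G" using Cons.prems assms(1) a by auto
  with Cons show ?case by (auto simp: a word_eval_Cons)
qed simp

lemma (in group) word_eval_cons_red:
  assumes g: "g \<in> {1..n} \<rightarrow> carrier G" and w: "set ((i, b) # w) \<subseteq> {1..n} \<times> UNIV"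
  shows "word_eval G g (cons_red (i, b) w) = word_eval G g ((i, b) # w)"
proof (cases w)
  case (Cons c v)
  obtain j d where c: "c = (j, d)" by fastforce
  have "g i \<in> carrier G" using g w by auto
  moreover have "word_eval G g v \<in> carrier G"
    using word_eval_closed[OF g] w Cons by simp
  ultimately show ?thesis
    by (auto simp: Cons c cancels_def word_eval_Cons m_assoc[symmetric])
qed simp

lemma (in group) word_eval_mult:
  assumes g: "g \<in> {1..n} \<rightarrow> carrier G"
    and "set u \<subseteq> {1..n} \<times> UNIV" "set v \<subseteq> {1..n} \<times> UNIV"
  shows "word_eval G g (foldr cons_red u v) = word_eval G g u \<otimes> word_eval G g v"
  using assms(2)
proof (induction u)
  case Nil
  then show ?case using word_eval_closed[OF g assms(3)] by simp
next
  case (Cons a u)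
  obtain i b where a: "a = (i, b)" by fastforce
  have gi: "g i \<in> carrier G" using Cons.prems g a by auto
  have cl: "word_eval G g u \<in> carrier G" "word_eval G g v \<in> carrier G"
    using word_eval_closed[OF g] Cons.prems assms(3) by auto
  have "set ((i, b) # foldr cons_red u v) \<subseteq> {1..n} \<times> UNIV"
    using set_foldr_cons_red[of u v] Cons.prems assms(3) a by auto
  from word_eval_cons_red[OF g this] show ?case
    using Cons gi cl by (auto simp: a word_eval_Cons m_assoc)
qed

lemma (in group) word_eval_hom:
  "g \<in> {1..n} \<rightarrow> carrier G \<Longrightarrow> word_eval G g \<in> hom (free_group n) G"
  by (rule homI)
    (simp_all add: free_group_def word_eval_closed[of g n] word_eval_mult[of g n])

lemma (in group) word_eval_generator:
  assumes "g \<in> {1..n} \<rightarrow> carrier G" "i \<in> {1..n}"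
  shows "word_eval G g [(i, True)] = g i"
  using assms funcset_mem[OF assms] by (simp add: word_eval_Cons)

lemma (in group) word_eval_unique:
  assumes phi: "\<phi> \<in> hom (free_group n) G" "\<And>i. i \<in> {1..n} \<Longrightarrow> \<phi> [(i, True)] = g i"
    and w: "w \<in> carrier (free_group n)"
  shows "\<phi> w = word_eval G g w"
proof -
  interpret F: group "free_group n" by (rule group_free_group)
  interpret phi: group_hom "free_group n" G \<phi>
    using phi(1) by (simp add: group_hom_def group_hom_axioms_def F.is_group is_group)
  have letter: "\<phi> [(i, b)] = (if b then g i else inv g i)" if "i \<in> {1..n}" for i b
  proof (cases b)
    case False
    have i: "[(i, c)] \<in> carrier (free_group n)" for c
      using that by (simp add: free_group_def reduced_Cons)
    have "[(i, False)] \<otimes>\<^bsub>free_group n\<^esub> [(i, True)] = \<one>\<^bsub>free_group n\<^esub>"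
      by (simp add: free_group_def cancels_def)
    then have "[(i, False)] = inv\<^bsub>free_group n\<^esub> [(i, True)]"
      using i by (metis F.inv_equality)
    then show ?thesis using i phi(2)[OF that] False by (metis phi.hom_inv)
  qed (use phi(2) that in simp)
  show ?thesis
    using w
  proof (induction w)
    case Nil
    show ?case using phi.hom_one by (simp add: free_group_def)
  next
    case (Cons a w)
    obtain i b where a: "a = (i, b)" by fastforce
    have mem: "[a] \<in> carrier (free_group n)" "w \<in> carrier (free_group n)" "i \<in> {1..n}"
      using Cons.prems by (auto simp: free_group_def reduced_Cons a)
    have "a # w = [a] \<otimes>\<^bsub>free_group n\<^esub> w"
      using Cons.prems by (cases w) (auto simp: free_group_def reduced_Cons)
    then have "\<phi> (a # w) = \<phi> [a] \<otimes> \<phi> w"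
      using mem by simp
    then show ?case using Cons.IH mem letter by (simp add: a word_eval_Cons)
  qed
qed

section \<open>Finiteness and residual properties\<close>

definition finitely_generated_group :: "('a, 'm) monoid_scheme \<Rightarrow> bool"
  where "finitely_generated_group G \<longleftrightarrow>
    (\<exists>A \<subseteq> carrier G. finite A \<and> generate G A = carrier G)"

definition locally_finite :: "('a, 'm) monoid_scheme \<Rightarrow> bool"
  where "locally_finite G \<longleftrightarrow>
    (\<forall>K. subgroup K G \<and> finitely_generated_group (G\<lparr>carrier := K\<rparr>) \<longrightarrow> finite K)"

definition torsion_free_group :: "('a, 'm) monoid_scheme \<Rightarrow> bool"
  where "torsion_free_group G \<longleftrightarrow>
    (\<forall>g\<in>carrier G. \<forall>n>0. g [^]\<^bsub>G\<^esub> (n::nat) = \<one>\<^bsub>G\<^esub> \<longrightarrow> g = \<one>\<^bsub>G\<^esub>)"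

fun lower_central :: "('a, 'm) monoid_scheme \<Rightarrow> nat \<Rightarrow> 'a set"
  where
    "lower_central G 0 = carrier G"
  | "lower_central G (Suc k) =
      generate G {inv\<^bsub>G\<^esub> x \<otimes>\<^bsub>G\<^esub> inv\<^bsub>G\<^esub> y \<otimes>\<^bsub>G\<^esub> x \<otimes>\<^bsub>G\<^esub> y | x y.
        x \<in> lower_central G k \<and> y \<in> carrier G}"

definition nilpotent_group :: "('a, 'm) monoid_scheme \<Rightarrow> bool"
  where "nilpotent_group G \<longleftrightarrow> (\<exists>k. lower_central G k = {\<one>\<^bsub>G\<^esub>})"

definition torsion_free_nilpotent :: "('a, 'm) monoid_scheme \<Rightarrow> bool"
  where "torsion_free_nilpotent Q \<longleftrightarrow> group Q \<and> torsion_free_group Q \<and> nilpotent_group Q"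

definition finite_p_group :: "nat \<Rightarrow> ('a, 'm) monoid_scheme \<Rightarrow> bool"
  where "finite_p_group p Q \<longleftrightarrow> group Q \<and> finite (carrier Q) \<and> (\<exists>k. card (carrier Q) = p ^ k)"

text \<open>The target groups range over groups with carrier in \<open>nat\<close>, because a quantifier inside a
  formula has to stay within one type. For an isomorphism-invariant family of countable groups
  this is no restriction. In general it makes \<open>residually \<F> G\<close> at most stronger than the notion
  with arbitrary targets; for finitely generated \<open>G\<close> and a subgroup-closed family (such as the
  torsion-free nilpotent groups) the two agree, since a target can be replaced by the countable
  image of \<open>G\<close>.\<close>

definition residually :: "(nat monoid \<Rightarrow> bool) \<Rightarrow> ('a, 'm) monoid_scheme \<Rightarrow> bool"
  where "residually \<F> G \<longleftrightarrow>
    (\<forall>g\<in>carrier G. g \<noteq> \<one>\<^bsub>G\<^esub> \<longrightarrow> (\<exists>Q \<phi>. \<F> Q \<and> \<phi> \<in> hom G Q \<and> \<phi> g \<noteq> \<one>\<^bsub>Q\<^esub>))"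

definition separable_in :: "('a, 'm) monoid_scheme \<Rightarrow> 'a set \<Rightarrow> bool"
  where "separable_in G A \<longleftrightarrow>
    (\<forall>g \<in> carrier G - A.
      \<exists>(Q :: nat monoid) \<phi>. group Q \<and> finite (carrier Q) \<and> \<phi> \<in> hom G Q \<and> \<phi> g \<notin> \<phi> ` A)"

text \<open>Finite targets in any other type can be transported to \<open>nat\<close>.\<close>

lemma separable_inI:
  fixes Q :: "'a \<Rightarrow> 'q monoid" and \<phi> :: "'a \<Rightarrow> 'a \<Rightarrow> 'q"
  assumes A: "A \<subseteq> carrier G"
    and Q: "\<And>g. g \<in> carrier G - A \<Longrightarrow> group (Q g) \<and> finite (carrier (Q g)) \<and>
              \<phi> g \<in> hom G (Q g) \<and> \<phi> g g \<notin> \<phi> g ` A"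
  shows "separable_in G A"
  unfolding separable_in_def
proof
  fix g assume g: "g \<in> carrier G - A"
  let ?Q = "Q g" and ?\<phi> = "\<phi> g"
  interpret Q: group ?Q using Q[OF g] by simp
  have hom: "?\<phi> \<in> hom G ?Q" and fin: "finite (carrier ?Q)" using Q[OF g] by auto
  obtain f :: "'q \<Rightarrow> nat" where f: "inj_on f (carrier ?Q)"
    using finite_imp_inj_to_nat_seg[OF fin] by auto
  define f' where "f' = inv_into (carrier ?Q) f"
  define N where "N = \<lparr>carrier = f ` carrier ?Q, monoid.mult = (\<lambda>x y. f (f' x \<otimes>\<^bsub>?Q\<^esub> f' y)), one = f \<one>\<^bsub>?Q\<^esub>\<rparr>"
  have f'f [simp]: "f' (f x) = x" if "x \<in> carrier ?Q" for x
    using f that by (simp add: f'_def)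
  have "group N"
  proof (rule groupI)
    fix x assume "x \<in> carrier N"
    then obtain q where q: "q \<in> carrier ?Q" "x = f q" by (auto simp: N_def)
    then show "\<exists>y\<in>carrier N. y \<otimes>\<^bsub>N\<^esub> x = \<one>\<^bsub>N\<^esub>"
      by (intro bexI[of _ "f (inv\<^bsub>?Q\<^esub> q)"]) (auto simp: N_def)
  qed (auto simp: N_def Q.m_assoc)
  moreover have "f \<circ> ?\<phi> \<in> hom G N"
    using hom by (auto simp: hom_def N_def Pi_iff)
  moreover have "(f \<circ> ?\<phi>) g \<notin> (f \<circ> ?\<phi>) ` A"
  proof
    assume "(f \<circ> ?\<phi>) g \<in> (f \<circ> ?\<phi>) ` A"
    then obtain a where a: "a \<in> A" "f (?\<phi> g) = f (?\<phi> a)" by auto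
    then have "?\<phi> g = ?\<phi> a"
      using f hom A g by (auto simp: hom_def Pi_iff inj_on_def)
    then show False using Q[OF g] a(1) by auto
  qed
  moreover have "finite (carrier N)" using fin by (simp add: N_def)
  ultimately show "\<exists>(Q :: nat monoid) \<phi>. group Q \<and> finite (carrier Q) \<and> \<phi> \<in> hom G Q \<and> \<phi> g \<notin> \<phi> ` A"
    by blast
qed

definition conjugacy_class :: "('a, 'm) monoid_scheme \<Rightarrow> 'a \<Rightarrow> 'a set"
  where "conjugacy_class G g = {x \<otimes>\<^bsub>G\<^esub> g \<otimes>\<^bsub>G\<^esub> inv\<^bsub>G\<^esub> x | x. x \<in> carrier G}"

definition conjugacy_separable :: "('a, 'm) monoid_scheme \<Rightarrow> bool"
  where "conjugacy_separable G \<longleftrightarrow> (\<forall>g\<in>carrier G. separable_in G (conjugacy_class G g))"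

definition cyclic_subgroup_separable :: "('a, 'm) monoid_scheme \<Rightarrow> bool"
  where "cyclic_subgroup_separable G \<longleftrightarrow> (\<forall>g\<in>carrier G. separable_in G (generate G {g}))"

section \<open>Unitriangular groups and wreath products\<close>

definition GL_int :: "nat \<Rightarrow> int mat monoid"
  where "GL_int r = units_of (ring_mat TYPE(int) r ())"

definition UT_int :: "nat \<Rightarrow> int mat monoid"
  where "UT_int r = (GL_int r)\<lparr>carrier :=
    {A \<in> carrier (GL_int r). upper_triangular A \<and> (\<forall>i<r. A $$ (i, i) = 1)}\<rparr>"

definition UT_product :: "(nat \<Rightarrow> int mat) monoid"
  where "UT_product = product_group {1..} UT_int"

definition semidirect_product ::
  "('a, 'm) monoid_scheme \<Rightarrow> ('b, 'k) monoid_scheme \<Rightarrow> ('b \<Rightarrow> 'a \<Rightarrow> 'a) \<Rightarrow> ('a \<times> 'b) monoid"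
  where "semidirect_product N H \<alpha> =
    \<lparr>carrier = carrier N \<times> carrier H,
     monoid.mult = (\<lambda>(m, h) (n, k). (m \<otimes>\<^bsub>N\<^esub> \<alpha> h n, h \<otimes>\<^bsub>H\<^esub> k)),
     one = (\<one>\<^bsub>N\<^esub>, \<one>\<^bsub>H\<^esub>)\<rparr>"

text \<open>\<open>H\<close> acts on the base group by left translation of the coordinates.\<close>

definition wreath_product ::
  "('a, 'm) monoid_scheme \<Rightarrow> ('b, 'k) monoid_scheme \<Rightarrow> (('b \<Rightarrow> 'a) \<times> 'b) monoid"
  where "wreath_product G H =
    semidirect_product (sum_group (carrier H) (\<lambda>_. G)) H
      (\<lambda>h f. \<lambda>x\<in>carrier H. f (inv\<^bsub>H\<^esub> h \<otimes>\<^bsub>H\<^esub> x))"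

lemma group_wreath_product:
  fixes G :: "('a, 'm) monoid_scheme" and H :: "('b, 'k) monoid_scheme"
  assumes "group G" "group H"
  shows "group (wreath_product G H)"
proof -
  interpret G: group G by fact
  interpret H: group H by fact
  let ?B = "sum_group (carrier H) (\<lambda>_. G)"
  define \<alpha> where "\<alpha> = (\<lambda>h (f :: 'b \<Rightarrow> 'a). \<lambda>x\<in>carrier H. f (inv\<^bsub>H\<^esub> h \<otimes>\<^bsub>H\<^esub> x))"
  have B: "carrier ?B = {f \<in> carrier H \<rightarrow>\<^sub>E carrier G. finite {x \<in> carrier H. f x \<noteq> \<one>\<^bsub>G\<^esub>}}"
    by (simp add: carrier_sum_group)
  interpret B: group ?B by simp
  have act: "\<alpha> h f \<in> carrier ?B" if h: "h \<in> carrier H" and f: "f \<in> carrier ?B" for h f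
  proof -
    have "{x \<in> carrier H. \<alpha> h f x \<noteq> \<one>\<^bsub>G\<^esub>} \<subseteq>
        (\<lambda>y. h \<otimes>\<^bsub>H\<^esub> y) ` {x \<in> carrier H. f x \<noteq> \<one>\<^bsub>G\<^esub>}"
    proof
      fix x assume "x \<in> {x \<in> carrier H. \<alpha> h f x \<noteq> \<one>\<^bsub>G\<^esub>}"
      then show "x \<in> (\<lambda>y. h \<otimes>\<^bsub>H\<^esub> y) ` {x \<in> carrier H. f x \<noteq> \<one>\<^bsub>G\<^esub>}"
        using h by (intro image_eqI[of _ _ "inv\<^bsub>H\<^esub> h \<otimes>\<^bsub>H\<^esub> x"]) (auto simp: \<alpha>_def H.m_assoc[symmetric])
    qed
    then have "finite {x \<in> carrier H. \<alpha> h f x \<noteq> \<one>\<^bsub>G\<^esub>}"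
      using f finite_subset unfolding B by blast
    then show ?thesis using f h unfolding B by (auto simp: \<alpha>_def)
  qed
  have act_one: "\<alpha> \<one>\<^bsub>H\<^esub> f = f" if "f \<in> carrier ?B" for f
    using that unfolding B by (auto simp: \<alpha>_def PiE_iff extensional_def fun_eq_iff)
  have act_mult: "\<alpha> h (f \<otimes>\<^bsub>?B\<^esub> f') = \<alpha> h f \<otimes>\<^bsub>?B\<^esub> \<alpha> h f'" if "h \<in> carrier H" for h f f'
    using that by (auto simp: \<alpha>_def fun_eq_iff)
  have act_act: "\<alpha> (h \<otimes>\<^bsub>H\<^esub> k) f = \<alpha> h (\<alpha> k f)"
    if "h \<in> carrier H" "k \<in> carrier H" for h k f
    using that by (auto simp: \<alpha>_def fun_eq_iff H.inv_mult_group H.m_assoc)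
  note acts = act act_one act_mult act_act
  have W: "wreath_product G H = semidirect_product ?B H \<alpha>"
    by (simp add: wreath_product_def \<alpha>_def)
  have act_id: "\<alpha> h \<one>\<^bsub>?B\<^esub> = \<one>\<^bsub>?B\<^esub>" if "h \<in> carrier H" for h
    using that by (auto simp: \<alpha>_def fun_eq_iff)
  show ?thesis
    unfolding W semidirect_product_def
  proof (rule groupI, goal_cases)
    case (5 p)
    then obtain f h where p: "p = (f, h)" "f \<in> carrier ?B" "h \<in> carrier H" by auto
    have "\<alpha> (inv\<^bsub>H\<^esub> h) (inv\<^bsub>?B\<^esub> f) \<otimes>\<^bsub>?B\<^esub> \<alpha> (inv\<^bsub>H\<^esub> h) f = \<one>\<^bsub>?B\<^esub>"
      using p acts(3)[of "inv\<^bsub>H\<^esub> h" "inv\<^bsub>?B\<^esub> f" f] act_id[of "inv\<^bsub>H\<^esub> h"]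
      by (simp only: B.l_inv H.inv_closed)
    moreover have "\<alpha> (inv\<^bsub>H\<^esub> h) (inv\<^bsub>?B\<^esub> f) \<in> carrier ?B"
      using p by (intro acts(1) B.inv_closed H.inv_closed)
    ultimately show ?case
      using p by (intro bexI[of _ "(\<alpha> (inv\<^bsub>H\<^esub> h) (inv\<^bsub>?B\<^esub> f), inv\<^bsub>H\<^esub> h)"])
         (auto simp del: mult_sum_group one_sum_group)
  next
    case 1
    then show ?case by (auto intro!: acts(1) B.m_closed simp del: mult_sum_group)
  next
    case 2
    then show ?case using B.one_closed by (simp del: one_sum_group)
  next
    case 3
    then show ?case
      by (auto simp: acts B.m_assoc H.m_assoc simp del: mult_sum_group)
  next
    case 4
    then show ?case by (auto simp: acts simp del: mult_sum_group one_sum_group)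
  qed
qed

lemma carrier_UT_int:
  "carrier (UT_int r) = {A \<in> carrier_mat r r. upper_triangular A \<and> (\<forall>i<r. A $$ (i, i) = 1)}"
    (is "_ = ?U")
proof
  show "carrier (UT_int r) \<subseteq> ?U"
    by (auto simp: UT_int_def GL_int_def units_of_def Units_def ring_mat_def)
  show "?U \<subseteq> carrier (UT_int r)"
  proof
    fix A assume A: "A \<in> ?U"
    then have "diag_mat A = replicate r 1"
      by (auto simp: diag_mat_def intro!: nth_equalityI)
    then have "det A = 1"
      using A det_upper_triangular[of A r] by simp
    then have "A * adj_mat A = 1\<^sub>m r" "adj_mat A * A = 1\<^sub>m r" "adj_mat A \<in> carrier_mat r r"
      using A adj_mat[of A r] by auto
    then have "A \<in> carrier (GL_int r)"
      using A by (auto simp: GL_int_def units_of_def Units_def ring_mat_def)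
    with A show "A \<in> carrier (UT_int r)" by (auto simp: UT_int_def)
  qed
qed

end

theory Submission
  imports Defs
begin

text \<open>
  Part (i). Put \<open>N = 2r + 3\<close>, let \<open>E(i, j)\<close> be the matrix units of size \<open>N\<close> with indices \<open>0, \<dots>, N - 1\<close>, and take
  \<open>w\<^sub>0 = 1 + E(0, 1)\<close>, \<open>c = 1 + E(1, 2) + \<dots> + E(r, r + 1)\<close>, \<open>a = 1 + E(r + 1, r + 2) + \<dots> + E(2r, 2r + 1)\<close> and
  \<open>x\<^sub>0 = 1 + E(2r + 1, 2r + 2)\<close>. Iterated commutators with \<open>c\<close> and with \<open>a\<close> give \<open>w\<^sub>i = 1 + E(0, i + 1)\<close> for \<open>i \<le> r\<close> and
  \<open>x\<^sub>j = 1 + E(2r + 1 - j, 2r + 2)\<close> for \<open>j \<le> r\<close>, and they give \<open>1\<close> for larger \<open>i\<close> and \<open>j\<close>. So \<open>w\<^sub>i\<close> and \<open>x\<^sub>j\<close> meet, and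
  fail to commute, only if \<open>i = j = r\<close>. In the product over all \<open>r\<close>, \<open>x\<^sub>j\<close> fails exactly one equation of the system
  \<open>[X, w\<^sub>i(Y, Z)] = 1\<close>, the one with index \<open>i = j\<close>.

  Part (ii). If \<open>M\<close> is a finite subgroup of \<open>H\<close>, a non-trivial constant function on \<open>M\<close> commutes with the elements of \<open>M\<close>
  and with no other element of \<open>H\<close>; so no finite subsystem of \<open>[X, l] = 1\<close> (\<open>l \<in> L\<close>) has the same solutions.
  Elements \<open>(f, h)\<close> and \<open>(f', h)\<close> are conjugate iff some \<open>k\<close> in the centraliser of \<open>h\<close> carries the products of \<open>f\<close> over the
  cosets \<open>\<langle>h\<rangle>x\<close> to those of \<open>f'\<close>. Cyclic subgroup separability of \<open>H\<close> gives finite quotients in which finitely many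
  coset products survive, and since the finite supports leave only finitely many candidates for \<open>k\<close> modulo \<open>\<langle>h\<rangle>\<close>,
  one quotient excludes all of them. For cyclic subgroups one reduces to \<open>(f\<^sub>0, 1)\<close> commuting with \<open>(f, h)\<close>; then \<open>h\<close> has finite
  order, and the question is one about finitely generated abelian groups.
\<close>

section \<open>Residual properties of abelian groups and finite quotients\<close>

text \<open>The size 2r + 3 makes the supports in part (i) parts of a path: \<open>c\<close> moves
  the end of w_i from 1 up to r + 1, and \<open>a\<close> moves the start of x_j from 2r + 1 down to
  r + 1. They touch when i + j = 2r; as both indices are cut off at r, this forces i = j = r.

  In part (ii) the coset products of f record its class modulo the functions u - hu (written
  additively), which is all that conjugation by the base can change. Apart from finite targets of H,
  the finite groups used are wreath products of finite targets A of G and K of H. Mapping H to K may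
  merge cosets of <h> and enlarge centralisers, so K has to keep apart finitely many points, their
  cosets and some commutators; all this follows from cyclic subgroup separability. In the cyclic
  case commuting may be assumed, because an image of (f0, 1) inside the image of a cyclic group
  commutes with the generator. A nontrivial finitely supported function fixed by h forces h to have
  finite order. The base may fail to be finitely generated; the abelian argument therefore uses
  Zorn's lemma and a subgroup with torsion quotient.\<close>

lemma subset_chain_Union_subgroup:
  assumes "C \<noteq> {}" "subset.chain {K. subgroup K G \<and> P K} C"
  shows "subgroup (\<Union>C) G"
proof -
  have sub: "subgroup K G" if "K \<in> C" for K
    using assms(2) that by (auto simp: subset_chain_def)
  have chain: "K \<subseteq> L \<or> L \<subseteq> K" if "K \<in> C" "L \<in> C" for K L
    using assms(2) that by (auto simp: subset_chain_def)
  show ?thesis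
  proof (rule subgroup.intro)
    show "\<Union>C \<subseteq> carrier G" using subgroup.subset[OF sub] by blast
    show "\<one>\<^bsub>G\<^esub> \<in> \<Union>C" using subgroup.one_closed[OF sub] assms(1) by blast
    show "x \<otimes>\<^bsub>G\<^esub> y \<in> \<Union>C" if xy: "x \<in> \<Union>C" "y \<in> \<Union>C" for x y
    proof -
      obtain K L where KL: "K \<in> C" "L \<in> C" "x \<in> K" "y \<in> L" using xy by blast
      then obtain M where "M \<in> C" "x \<in> M" "y \<in> M" using chain[of K L] by blast
      then show ?thesis using subgroup.m_closed[OF sub] by blast
    qed
    show "inv\<^bsub>G\<^esub> x \<in> \<Union>C" if "x \<in> \<Union>C" for x
      using that subgroup.m_inv_closed[OF sub] by blast
  qed
qed

lemma (in comm_group) subgroup_cyclic_extension: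
  assumes K: "subgroup K G" and x: "x \<in> carrier G"
  shows "subgroup {k \<otimes> x [^] (i::int) | k i. k \<in> K} G" (is "subgroup ?E G")
proof (rule subgroup.intro)
  interpret K: subgroup K G by fact
  show "?E \<subseteq> carrier G" using x by auto
  show "\<one> \<in> ?E" using x by (auto intro!: exI[of _ \<one>] exI[of _ "0::int"])
  fix y assume "y \<in> ?E"
  then obtain k i where y: "k \<in> K" "y = k \<otimes> x [^] (i::int)" by auto
  have "inv y = inv k \<otimes> x [^] (-i)"
    using x y by (simp add: inv_mult int_pow_neg)
  then show "inv y \<in> ?E" using y(1) by blast
  fix z assume "z \<in> ?E"
  then obtain l j where z: "l \<in> K" "z = l \<otimes> x [^] (j::int)" by auto
  have "y \<otimes> z = (k \<otimes> l) \<otimes> x [^] (i + j)"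
    using x y z by (simp add: int_pow_mult m_ac)
  then show "y \<otimes> z \<in> ?E" using y(1) z(1) by blast
qed

text \<open>By maximality every nontrivial subgroup of the quotient by \<open>K\<close> contains the
  image of \<open>c\<close>. In an infinite cyclic group no nontrivial element is common to all
  nontrivial subgroups, so the quotient is a torsion group.\<close>

lemma (in comm_group) maximal_avoiding_subgroup_power:
  assumes K: "subgroup K G" and c: "c \<notin> K" and x: "x \<in> carrier G"
    and max: "\<And>L. subgroup L G \<Longrightarrow> K \<subseteq> L \<Longrightarrow> c \<notin> L \<Longrightarrow> L = K"
  shows "\<exists>n>0. x [^] (n::nat) \<in> K"
proof -
  interpret K: subgroup K G by fact
  have ext: "\<exists>k\<in>K. \<exists>i::int. c = k \<otimes> y [^] i" if y: "y \<in> carrier G" "y \<notin> K" for y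
  proof (rule ccontr)
    let ?E = "{k \<otimes> y [^] (i::int) | k i. k \<in> K}"
    assume "\<not> ?thesis"
    then have "c \<notin> ?E" by blast
    moreover have "k = k \<otimes> y [^] (0::int)" if "k \<in> K" for k using that y by simp
    then have "K \<subseteq> ?E" by blast
    ultimately have "?E = K" using max subgroup_cyclic_extension[OF K y(1)] by blast
    moreover have "y = \<one> \<otimes> y [^] (1::int)" using y by simp
    then have "y \<in> ?E" using K.one_closed by blast
    ultimately show False using y(2) by simp
  qed
  \<comment> \<open>Modulo \<open>K\<close>, \<open>c\<close> is a power of \<open>x^i\<close> and of \<open>x^(2i)\<close>; comparing them gives \<open>x^(i - 2ij) \<in> K\<close>, and \<open>i - 2ij \<noteq> 0\<close>.\<close>
  have "\<exists>i::int. i \<noteq> 0 \<and> x [^] i \<in> K"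
  proof (cases "x \<in> K")
    case True
    then show ?thesis using x by (intro exI[of _ 1]) auto
  next
    case False
    then obtain k i where i: "k \<in> K" "c = k \<otimes> x [^] (i::int)" using ext x by blast
    have "i \<noteq> 0" using i c by auto
    show ?thesis
    proof (cases "x [^] (2 * i) \<in> K")
      case True
      then show ?thesis using \<open>i \<noteq> 0\<close> by (intro exI[of _ "2 * i"]) auto
    next
      case False
      then obtain l j where j: "l \<in> K" "c = l \<otimes> (x [^] (2 * i)) [^] (j::int)"
        using ext x by (meson int_pow_closed)
      have "x [^] i = inv k \<otimes> c" using i x by (simp add: m_assoc[symmetric])
      also have "c = l \<otimes> x [^] (2 * i * j)"
        using j(2) int_pow_pow[OF x] by simp
      also have "inv k \<otimes> (l \<otimes> x [^] (2 * i * j)) = (inv k \<otimes> l) \<otimes> x [^] (2 * i * j)"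
        using i(1) j(1) x by (intro m_assoc[symmetric]) auto
      finally have "x [^] i \<otimes> inv (x [^] (2 * i * j)) = inv k \<otimes> l"
        using i(1) j(1) x by (subst inv_solve_right') auto
      then have "x [^] (i - 2 * i * j) = inv k \<otimes> l"
        using int_pow_diff[OF x] by simp
      moreover have "i - 2 * i * j = i * (1 - 2 * j)" by (simp add: algebra_simps)
      moreover have "1 - 2 * j \<noteq> 0" by presburger
      ultimately show ?thesis using i(1) j(1) \<open>i \<noteq> 0\<close>
        by (intro exI[of _ "i - 2 * i * j"]) auto
    qed
  qed
  then obtain i :: int where i: "i \<noteq> 0" "x [^] i \<in> K" by blast
  have "x [^] \<bar>i\<bar> \<in> K"
    using i x K.m_inv_closed int_pow_neg[OF x, of i] by (cases "i < 0") auto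
  then show ?thesis using i(1) x
    by (intro exI[of _ "nat \<bar>i\<bar>"]) (simp flip: int_pow_int)
qed

text \<open>A subgroup \<open>K\<close> maximal among those containing \<open>d\<close> and avoiding
  \<open>c\<close> has a torsion quotient, so it contains all \<open>n\<close>-th powers of
  \<open>generate G S\<close> for a suitable \<open>n\<close>. The ambient group may be larger than
  \<open>generate G S\<close>: the lemma is also applied to the base of a wreath product, with
  \<open>S\<close> generating the functions supported in a fixed finite set.\<close>

lemma (in comm_group) cyclic_subgroup_separated_by_powers:
  assumes S: "finite S" "S \<subseteq> carrier G" and d: "d \<in> carrier G"
    and c: "c \<notin> generate G {d}"
  shows "\<exists>n>0. \<forall>t::int. \<forall>x\<in>generate G S. c \<noteq> d [^] t \<otimes> x [^] (n::nat)"
proof -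
  let ?A = "{K. subgroup K G \<and> (d \<in> K \<and> c \<notin> K)}"
  have ne: "generate G {d} \<in> ?A"
    using c d generate_is_subgroup[of "{d}"] generate.incl[of d "{d}" G] by auto
  have un: "\<Union>C \<in> ?A" if "C \<noteq> {}" "subset.chain ?A C" for C
  proof -
    have "C \<subseteq> ?A" using that(2) by (simp add: subset_chain_def)
    then have "d \<in> \<Union>C" "c \<notin> \<Union>C" using that(1) by blast+
    with subset_chain_Union_subgroup[OF that] show ?thesis by blast
  qed
  have "?A \<noteq> {}" using ne by (rule ex_in_conv[THEN iffD1, OF exI])
  then have "\<exists>K\<in>?A. \<forall>L\<in>?A. K \<subseteq> L \<longrightarrow> L = K"
    using un by (rule subset_Zorn_nonempty)
  then obtain K where K: "K \<in> ?A" and max: "\<forall>L\<in>?A. K \<subseteq> L \<longrightarrow> L = K" ..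
  have "\<exists>n>0. x [^] (n::nat) \<in> K" if "x \<in> S" for x
  proof (rule maximal_avoiding_subgroup_power[of K c])
    show "L = K" if "subgroup L G" "K \<subseteq> L" "c \<notin> L" for L
      using max K that by blast
  qed (use K S that in auto)
  then obtain m :: "'a \<Rightarrow> nat" where m: "\<And>x. x \<in> S \<Longrightarrow> m x > 0 \<and> x [^] m x \<in> K" by metis
  interpret K: subgroup K G using K by simp
  \<comment> \<open>One exponent for all generators, a multiple of every \<open>m x\<close>. By
    commutativity the elements whose \<open>?n\<close>-th power lies in \<open>K\<close> form a
    subgroup.\<close>
  let ?n = "\<Prod>x\<in>S. m x"
  have "subgroup {x \<in> carrier G. x [^] ?n \<in> K} G"
    by (rule subgroup.intro) (auto simp: nat_pow_distrib nat_pow_inv)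
  moreover have "S \<subseteq> {x \<in> carrier G. x [^] ?n \<in> K}"
  proof
    fix x assume x: "x \<in> S"
    have "?n = m x * (\<Prod>y\<in>S - {x}. m y)" using x S(1) by (simp add: prod.remove)
    then have "x [^] ?n = (x [^] m x) [^] (\<Prod>y\<in>S - {x}. m y)"
      using x S(2) by (metis nat_pow_pow subsetD)
    moreover have "(x [^] m x) [^] k \<in> K" for k :: nat
      using m[OF x] K.subgroup_axioms subgroup_int_pow_closed int_pow_int by metis
    ultimately show "x \<in> {x \<in> carrier G. x [^] ?n \<in> K}" using x S(2) by auto
  qed
  ultimately have gen: "generate G S \<subseteq> {x \<in> carrier G. x [^] ?n \<in> K}"
    by (rule generate_subgroup_incl[rotated])
  have "d [^] t \<otimes> x [^] ?n \<in> K" if "x \<in> generate G S" for t :: int and x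
    using K gen that subgroup_int_pow_closed[of K d t] by auto
  then have "\<forall>t::int. \<forall>x\<in>generate G S. c \<noteq> d [^] t \<otimes> x [^] ?n"
    using K by blast
  moreover have "?n > 0" using m by (intro prod_pos) auto
  ultimately show ?thesis by blast
qed

lemma (in comm_group) finite_generated_of_exponent:
  assumes "finite S" "S \<subseteq> carrier G" "n > 0" "\<And>x. x \<in> S \<Longrightarrow> x [^] (n::nat) = \<one>"
  shows "finite (generate G S)"
  using assms
proof (induction S rule: finite_induct)
  case empty
  then show ?case by (simp add: generate_empty)
next
  case (insert x S)
  then have x: "x \<in> carrier G" "x [^] n = \<one>" and S: "S \<subseteq> carrier G" by auto
  let ?E = "{k \<otimes> x [^] (i::int) | k i. k \<in> generate G S}"
  have sub: "subgroup (generate G S) G" using S by (rule generate_is_subgroup)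
  have E: "subgroup ?E G" by (rule subgroup_cyclic_extension[OF sub x(1)])
  have "insert x S \<subseteq> ?E"
  proof
    fix y assume "y \<in> insert x S"
    then consider "y = \<one> \<otimes> x [^] (1::int)" | "y \<in> generate G S" "y = y \<otimes> x [^] (0::int)"
      using x S by (cases "y = x") (auto simp: subsetD intro: generate.incl)
    then show "y \<in> ?E" using generate.one[of G S] by cases blast+
  qed
  then have "generate G (insert x S) \<subseteq> ?E" using E by (intro generate_subgroup_incl) auto
  also have "?E \<subseteq> (\<lambda>(k, i). k \<otimes> x [^] i) ` (generate G S \<times> {0..<int n})"
  proof
    fix y assume "y \<in> ?E"
    then obtain k i where y: "y = k \<otimes> x [^] (i::int)" "k \<in> generate G S" by blast
    have "x [^] i = x [^] (i div int n * int n + i mod int n)" by simp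
    also have "\<dots> = (x [^] (int n)) [^] (i div int n) \<otimes> x [^] (i mod int n)"
      using x by (simp only: int_pow_mult int_pow_pow mult.commute)
    also have "\<dots> = x [^] (i mod int n)" using x by (simp add: int_pow_int)
    finally have "y = k \<otimes> x [^] (i mod int n)" using y by simp
    then show "y \<in> (\<lambda>(k, i). k \<otimes> x [^] i) ` (generate G S \<times> {0..<int n})"
      using y(2) insert.prems(2) by (intro image_eqI[of _ _ "(k, i mod int n)"]) auto
  qed
  finally show ?case
    by (rule finite_subset) (use insert.IH insert.prems in auto)
qed

text \<open>Dividing by the subgroup of \<open>n\<close>-th powers leaves an abelian group generated
  by finitely many elements of exponent dividing \<open>n\<close>. The kernel is described by powers
  so that it fits the separation by powers.\<close>

lemma (in comm_group) finite_power_quotient: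
  assumes fg: "finitely_generated_group G" and n: "n > 0"
  shows "\<exists>(A :: 'a set monoid) \<psi>. comm_group A \<and> finite (carrier A) \<and> \<psi> \<in> hom G A \<and>
    (\<forall>g\<in>carrier G. \<psi> g = \<one>\<^bsub>A\<^esub> \<longrightarrow> (\<exists>x\<in>carrier G. g = x [^] (n::nat)))"
proof -
  define N where "N = (\<lambda>x. x [^] n) ` carrier G"
  have subN: "subgroup N G"
  proof (rule subgroup.intro)
    show "x \<otimes> y \<in> N" if "x \<in> N" "y \<in> N" for x y
      using that by (auto simp: N_def nat_pow_distrib[symmetric])
    show "inv x \<in> N" if "x \<in> N" for x
      using that by (auto simp: N_def nat_pow_inv[symmetric])
    show "\<one> \<in> N" by (auto simp: N_def intro!: image_eqI[of _ _ \<one>])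
  qed (auto simp: N_def)
  interpret N: normal N G using subN by (rule subgroup_imp_normal)
  let ?A = "G Mod N" and ?\<psi> = "\<lambda>x. N #> x"
  have hom: "?\<psi> \<in> hom G ?A" by (rule N.r_coset_hom_Mod)
  have A: "comm_group ?A" using abelian_FactGroup[OF subN] .
  interpret A: comm_group ?A by fact
  interpret psi: group_hom G ?A ?\<psi>
    using hom by unfold_locales
  obtain S where S: "S \<subseteq> carrier G" "finite S" "generate G S = carrier G"
    using fg by (auto simp: finitely_generated_group_def)
  have pow: "?\<psi> x [^]\<^bsub>?A\<^esub> n = \<one>\<^bsub>?A\<^esub>" if "x \<in> carrier G" for x
  proof -
    have "?\<psi> x [^]\<^bsub>?A\<^esub> n = ?\<psi> (x [^] n)" using that by (simp add: psi.hom_nat_pow)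
    also have "x [^] n \<in> N" using that by (simp add: N_def)
    then have "?\<psi> (x [^] n) = N" using subN by (simp add: coset_join2 N.subset subsetD[OF N.subset])
    finally show ?thesis by (simp add: FactGroup_def)
  qed
  have "?\<psi> ` carrier G = carrier ?A" by (auto simp: FactGroup_def RCOSETS_def)
  then have "carrier ?A = generate ?A (?\<psi> ` S)"
    using psi.generate_img[OF S(1)] S(3) by simp
  moreover have "finite (generate ?A (?\<psi> ` S))"
  proof (rule A.finite_generated_of_exponent[OF _ _ n])
    show "x [^]\<^bsub>?A\<^esub> n = \<one>\<^bsub>?A\<^esub>" if "x \<in> ?\<psi> ` S" for x
      using pow that S(1) by blast
  qed (use S psi.hom_closed in blast)+
  moreover have "\<exists>x\<in>carrier G. g = x [^] n" if "g \<in> carrier G" "?\<psi> g = \<one>\<^bsub>?A\<^esub>" for g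
  proof -
    have "N #> g = N" using that(2) by (simp add: FactGroup_def)
    then have "g \<in> N" using that(1) subN by (metis coset_join1 N.subset)
    then show ?thesis by (auto simp: N_def)
  qed
  ultimately show ?thesis using A hom by (intro exI[of _ ?A] exI[of _ ?\<psi>]) auto
qed

text \<open>Separability and residual properties demand targets with carrier in \<open>nat\<close>.
  Countable groups cover the finite quotients as well as the infinite groups
  \<open>UT_int r\<close>.\<close>

lemma countable_group_nat_copy:
  fixes Q :: "('q, 'm) monoid_scheme"
  assumes "group Q" "countable (carrier Q)"
  shows "\<exists>(N :: nat monoid) f. group N \<and> f \<in> iso Q N"
proof -
  interpret Q: group Q by fact
  define f where "f = to_nat_on (carrier Q)"
  define f' where "f' = from_nat_into (carrier Q)"
  have f'f [simp]: "f' (f x) = x" if "x \<in> carrier Q" for x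
    using assms(2) that by (simp add: f_def f'_def)
  define N where "N = \<lparr>carrier = f ` carrier Q,
    monoid.mult = (\<lambda>x y. f (f' x \<otimes>\<^bsub>Q\<^esub> f' y)), one = f \<one>\<^bsub>Q\<^esub>\<rparr>"
  have "group N"
  proof (rule groupI)
    fix x assume "x \<in> carrier N"
    then obtain q where q: "q \<in> carrier Q" "x = f q" by (auto simp: N_def)
    then show "\<exists>y\<in>carrier N. y \<otimes>\<^bsub>N\<^esub> x = \<one>\<^bsub>N\<^esub>"
      by (intro bexI[of _ "f (inv\<^bsub>Q\<^esub> q)"]) (auto simp: N_def)
  qed (auto simp: N_def Q.m_assoc)
  moreover have "f \<in> iso Q N"
    by (auto simp: iso_def hom_def N_def bij_betw_def intro!: inj_on_inverseI[of _ f'])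
  ultimately show ?thesis by blast
qed

text \<open>The product of one finite quotient per index separates all the pairs at once.\<close>

lemma separable_in_common_quotient:
  fixes g :: "'i \<Rightarrow> 'a"
  assumes G: "group G" and I: "finite I"
    and sep: "\<And>i. i \<in> I \<Longrightarrow> separable_in G (A i)" "\<And>i. i \<in> I \<Longrightarrow> A i \<subseteq> carrier G"
      "\<And>i. i \<in> I \<Longrightarrow> g i \<in> carrier G - A i"
  shows "\<exists>(Q :: nat monoid) \<phi>. group Q \<and> finite (carrier Q) \<and> \<phi> \<in> hom G Q \<and>
    (\<forall>i\<in>I. \<phi> (g i) \<notin> \<phi> ` A i)"
proof -
  have "\<exists>(Q :: nat monoid) \<phi>. group Q \<and> finite (carrier Q) \<and> \<phi> \<in> hom G Q \<and>
      \<phi> (g i) \<notin> \<phi> ` A i" if "i \<in> I" for i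
    using sep[OF that] unfolding separable_in_def by blast
  then obtain Q :: "'i \<Rightarrow> nat monoid" and \<phi> where Q: "\<And>i. i \<in> I \<Longrightarrow> group (Q i)"
      "\<And>i. i \<in> I \<Longrightarrow> finite (carrier (Q i))" "\<And>i. i \<in> I \<Longrightarrow> \<phi> i \<in> hom G (Q i)"
      "\<And>i. i \<in> I \<Longrightarrow> \<phi> i (g i) \<notin> \<phi> i ` A i"
    by metis
  let ?P = "product_group I Q"
  define \<Phi> where "\<Phi> = (\<lambda>x. \<lambda>i\<in>I. \<phi> i x)"
  have P: "group ?P" "finite (carrier ?P)" using Q I by (auto intro: finite_PiE)
  obtain N :: "nat monoid" and f where N: "group N" "f \<in> iso ?P N"
    using countable_group_nat_copy[OF P(1) countable_finite[OF P(2)]] by blast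
  have f: "f \<in> hom ?P N" "inj_on f (carrier ?P)" "f ` carrier ?P = carrier N"
    using N(2) by (auto simp: iso_def bij_betw_def)
  have \<Phi>: "\<Phi> \<in> hom G ?P"
    by (rule homI) (auto simp: \<Phi>_def fun_eq_iff hom_in_carrier[OF Q(3)] hom_mult[OF Q(3)])
  have "f \<circ> \<Phi> \<in> hom G N" using \<Phi> f(1) by (rule hom_compose)
  moreover have "(f \<circ> \<Phi>) (g i) \<notin> (f \<circ> \<Phi>) ` A i" if i: "i \<in> I" for i
  proof
    assume "(f \<circ> \<Phi>) (g i) \<in> (f \<circ> \<Phi>) ` A i"
    then obtain a where a: "a \<in> A i" "f (\<Phi> (g i)) = f (\<Phi> a)" by auto
    then have "\<Phi> (g i) = \<Phi> a"
      using inj_onD[OF f(2)] hom_in_carrier[OF \<Phi>] sep[OF i] by blast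
    then have "\<phi> i (g i) = \<phi> i a" using i by (auto simp: \<Phi>_def dest!: fun_cong[of _ _ i])
    then show False using Q(4)[OF i] a(1) by blast
  qed
  moreover have "finite (carrier N)" using f(3) P(2) by (metis finite_imageI)
  ultimately show ?thesis using N(1) by blast
qed

section \<open>The base group of a wreath product\<close>

lemma (in comm_monoid) gfinprod_reindex:
  assumes "f \<in> h ` A \<rightarrow> carrier G" "inj_on h A"
  shows "gfinprod G f (h ` A) = gfinprod G (\<lambda>x. f (h x)) A"
proof -
  have "{i \<in> h ` A. f i \<noteq> \<one>} = h ` {x \<in> A. f (h x) \<noteq> \<one>}" by auto
  moreover have "finprod G f (h ` {x \<in> A. f (h x) \<noteq> \<one>}) = finprod G (\<lambda>x. f (h x)) {x \<in> A. f (h x) \<noteq> \<one>}"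
    using assms by (intro finprod_reindex) (auto intro: inj_on_subset)
  ultimately show ?thesis by (simp add: gfinprod_def)
qed

lemma (in comm_monoid) gfinprod_singleton_neutral:
  assumes "f \<in> A \<rightarrow> carrier G" "x \<in> A" "\<And>y. y \<in> A \<Longrightarrow> y \<noteq> x \<Longrightarrow> f y = \<one>"
  shows "gfinprod G f A = f x"
proof -
  have "gfinprod G f A = gfinprod G f {x}"
    by (rule gfinprod_mono_neutral_cong_right) (use assms in auto)
  then show ?thesis using assms by (simp add: Pi_iff)
qed

lemma (in comm_monoid) gfinprod_one_eqI:
  "(\<And>x. x \<in> A \<Longrightarrow> f x = \<one>) \<Longrightarrow> gfinprod G f A = \<one>"
  by (simp add: gfinprod_def cong: conj_cong)

lemma (in group) mem_cyclic_r_coset_iff: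
  assumes h: "h \<in> carrier G" and x: "x \<in> carrier G"
  shows "z \<in> generate G {h} #> x \<longleftrightarrow> z \<in> carrier G \<and> z \<otimes> inv x \<in> generate G {h}"
proof -
  have gen: "generate G {h} \<subseteq> carrier G" using generate_incl[of "{h}"] h by simp
  show ?thesis
  proof
    assume "z \<in> generate G {h} #> x"
    then obtain k where k: "k \<in> generate G {h}" "z = k \<otimes> x" by (auto simp: r_coset_def)
    then have "k \<in> carrier G" using gen by auto
    then show "z \<in> carrier G \<and> z \<otimes> inv x \<in> generate G {h}" using k x by (simp add: m_assoc)
  next
    assume z: "z \<in> carrier G \<and> z \<otimes> inv x \<in> generate G {h}"
    have "z \<in> {(z \<otimes> inv x) \<otimes> x}" using z x by (simp add: m_assoc)
    then show "z \<in> generate G {h} #> x" unfolding r_coset_def using z by (intro UN_I) auto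
  qed
qed

lemma (in group) commute_inv:
  assumes "k \<in> carrier G" "h \<in> carrier G" "k \<otimes> h = h \<otimes> k"
  shows "inv k \<otimes> h = h \<otimes> inv k"
proof (rule inv_solve_left'[THEN iffD2])
  have "k \<otimes> (h \<otimes> inv k) = (h \<otimes> k) \<otimes> inv k"
    using assms by (simp add: m_assoc[symmetric])
  then show "h = k \<otimes> (h \<otimes> inv k)" using assms by (simp add: m_assoc)
qed (use assms in auto)

lemma (in group) commute_generate:
  assumes k: "k \<in> carrier G" and h: "h \<in> carrier G" "k \<otimes> h = h \<otimes> k"
    and g: "g \<in> generate G {h}"
  shows "k \<otimes> g = g \<otimes> k"
proof -
  have "subgroup {g \<in> carrier G. k \<otimes> g = g \<otimes> k} G" (is "subgroup ?C G")
  proof (rule subgroupI)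
    show "inv a \<in> ?C" if "a \<in> ?C" for a
      using that k commute_inv[of a k] by auto
    fix a b assume ab: "a \<in> ?C" "b \<in> ?C"
    then have "k \<otimes> (a \<otimes> b) = (a \<otimes> k) \<otimes> b" using k by (simp add: m_assoc[symmetric])
    also have "\<dots> = a \<otimes> (k \<otimes> b)" using ab k by (intro m_assoc) auto
    also have "\<dots> = a \<otimes> (b \<otimes> k)" using ab by simp
    also have "\<dots> = (a \<otimes> b) \<otimes> k" using ab k by (intro m_assoc[symmetric]) auto
    finally show "a \<otimes> b \<in> ?C" using ab by simp
  qed (use k in auto)
  then have "generate G {h} \<subseteq> ?C" using h by (intro generate_subgroup_incl) auto
  then show ?thesis using g by auto
qed

locale abelian_wreath = G: comm_group G + H: group H
  for G :: "('a, 'm) monoid_scheme" and H :: "('b, 'k) monoid_scheme"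
begin

definition base :: "('b \<Rightarrow> 'a) monoid"
  where "base = sum_group (carrier H) (\<lambda>_. G)"

definition shift :: "'b \<Rightarrow> ('b \<Rightarrow> 'a) \<Rightarrow> 'b \<Rightarrow> 'a"
  where "shift h f = (\<lambda>x\<in>carrier H. f (inv\<^bsub>H\<^esub> h \<otimes>\<^bsub>H\<^esub> x))"

definition single :: "'b \<Rightarrow> 'a \<Rightarrow> 'b \<Rightarrow> 'a"
  where "single x a = (\<lambda>y\<in>carrier H. if y = x then a else \<one>\<^bsub>G\<^esub>)"

abbreviation coset :: "'b \<Rightarrow> 'b \<Rightarrow> 'b set"
  where "coset h x \<equiv> generate H {h} #>\<^bsub>H\<^esub> x"

text \<open>The invariant that conjugation by base elements cannot change. A coset may be infinite,
  but \<open>gfinprod\<close> multiplies only over the support, which is finite for elements of the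
  base.\<close>

definition coset_prod :: "'b \<Rightarrow> ('b \<Rightarrow> 'a) \<Rightarrow> 'b \<Rightarrow> 'a"
  where "coset_prod h f x = gfinprod G f (coset h x)"

lemma base_iff: "f \<in> carrier base \<longleftrightarrow>
    f \<in> carrier H \<rightarrow>\<^sub>E carrier G \<and> finite {x \<in> carrier H. f x \<noteq> \<one>\<^bsub>G\<^esub>}"
  by (simp add: base_def carrier_sum_group)

lemma baseD: "f \<in> carrier base \<Longrightarrow> x \<in> carrier H \<Longrightarrow> f x \<in> carrier G"
  by (auto simp: base_iff)

lemma base_finite: "f \<in> carrier base \<Longrightarrow> finite {x \<in> carrier H. f x \<noteq> \<one>\<^bsub>G\<^esub>}"
  by (simp add: base_iff)

lemma mult_base: "f \<otimes>\<^bsub>base\<^esub> g = (\<lambda>x\<in>carrier H. f x \<otimes>\<^bsub>G\<^esub> g x)"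
  by (simp add: base_def)

lemma one_base: "\<one>\<^bsub>base\<^esub> = (\<lambda>x\<in>carrier H. \<one>\<^bsub>G\<^esub>)"
  by (simp add: base_def)

lemma inv_base: "f \<in> carrier base \<Longrightarrow> inv\<^bsub>base\<^esub> f = (\<lambda>x\<in>carrier H. inv\<^bsub>G\<^esub> f x)"
  by (simp add: base_def)

lemma base_eqI:
  assumes "f \<in> carrier base" "g \<in> carrier base" "\<And>x. x \<in> carrier H \<Longrightarrow> f x = g x"
  shows "f = g"
  using assms by (intro PiE_ext[of f "carrier H" "\<lambda>_. carrier G" g]) (simp_all add: base_iff)

sublocale base: comm_group base
proof -
  interpret group base by (simp add: base_def)
  show "comm_group base"
    by (rule group_comm_groupI)
      (auto simp: mult_base fun_eq_iff G.m_comm baseD restrict_def)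
qed

lemma shift_closed:
  assumes h: "h \<in> carrier H" and f: "f \<in> carrier base"
  shows "shift h f \<in> carrier base"
proof -
  have "{x \<in> carrier H. shift h f x \<noteq> \<one>\<^bsub>G\<^esub>} \<subseteq>
      (\<lambda>y. h \<otimes>\<^bsub>H\<^esub> y) ` {x \<in> carrier H. f x \<noteq> \<one>\<^bsub>G\<^esub>}"
  proof
    fix x assume "x \<in> {x \<in> carrier H. shift h f x \<noteq> \<one>\<^bsub>G\<^esub>}"
    then show "x \<in> (\<lambda>y. h \<otimes>\<^bsub>H\<^esub> y) ` {x \<in> carrier H. f x \<noteq> \<one>\<^bsub>G\<^esub>}"
      using h by (intro image_eqI[of _ _ "inv\<^bsub>H\<^esub> h \<otimes>\<^bsub>H\<^esub> x"])
        (auto simp: shift_def H.m_assoc[symmetric])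
  qed
  then have "finite {x \<in> carrier H. shift h f x \<noteq> \<one>\<^bsub>G\<^esub>}"
    using f finite_subset unfolding base_iff by blast
  then show ?thesis using f h unfolding base_iff by (auto simp: shift_def)
qed

lemma shift_hom: "h \<in> carrier H \<Longrightarrow> shift h \<in> hom base base"
  by (rule homI) (simp_all add: shift_closed, auto simp: mult_base shift_def fun_eq_iff)

lemma shift_apply: "x \<in> carrier H \<Longrightarrow> shift h f x = f (inv\<^bsub>H\<^esub> h \<otimes>\<^bsub>H\<^esub> x)"
  by (simp add: shift_def)

lemma single_closed: "a \<in> carrier G \<Longrightarrow> single x a \<in> carrier base"
  by (auto simp: base_iff single_def intro: finite_subset[of _ "{x}"])

lemma single_hom: "single x \<in> hom G base"
  by (rule homI) (simp_all add: single_closed, auto simp: single_def mult_base fun_eq_iff)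

lemma shift_single:
  assumes "h \<in> carrier H" "x \<in> carrier H"
  shows "shift h (single x a) = single (h \<otimes>\<^bsub>H\<^esub> x) a"
  using assms by (auto simp: shift_def single_def fun_eq_iff H.inv_solve_left')

lemma wreath_carrier: "carrier (wreath_product G H) = carrier base \<times> carrier H"
  by (simp add: wreath_product_def semidirect_product_def base_def)

lemma wreath_mult:
  "(f, h) \<otimes>\<^bsub>wreath_product G H\<^esub> (g, k) = (f \<otimes>\<^bsub>base\<^esub> shift h g, h \<otimes>\<^bsub>H\<^esub> k)"
  by (simp add: wreath_product_def semidirect_product_def base_def shift_def)

lemma wreath_one: "\<one>\<^bsub>wreath_product G H\<^esub> = (\<one>\<^bsub>base\<^esub>, \<one>\<^bsub>H\<^esub>)"
  by (simp add: wreath_product_def semidirect_product_def base_def)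

sublocale wreath: group "wreath_product G H"
  by (rule group_wreath_product) unfold_locales

lemma cyclic_subset: "h \<in> carrier H \<Longrightarrow> generate H {h} \<subseteq> carrier H"
  using H.generate_incl[of "{h}"] by simp

lemma cyclic_subgroup: "h \<in> carrier H \<Longrightarrow> subgroup (generate H {h}) H"
  using H.generate_is_subgroup[of "{h}"] by simp

lemma coset_subset: "\<lbrakk>h \<in> carrier H; x \<in> carrier H\<rbrakk> \<Longrightarrow> coset h x \<subseteq> carrier H"
  using H.r_coset_subset_G[OF cyclic_subset] .

lemma coset_self: "\<lbrakk>h \<in> carrier H; x \<in> carrier H\<rbrakk> \<Longrightarrow> x \<in> coset h x"
  using H.rcos_self[OF _ cyclic_subgroup] .

lemma coset_eq:
  "\<lbrakk>h \<in> carrier H; x \<in> carrier H; z \<in> coset h x\<rbrakk> \<Longrightarrow> coset h z = coset h x"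
  using H.repr_independence[OF _ _ cyclic_subgroup] by metis

lemma coset_prod_hom:
  assumes h: "h \<in> carrier H" and x: "x \<in> carrier H"
  shows "(\<lambda>f. coset_prod h f x) \<in> hom base G"
proof (rule homI)
  have sub: "coset h x \<subseteq> carrier H" using coset_subset assms by blast
  fix f assume f: "f \<in> carrier base"
  then show "coset_prod h f x \<in> carrier G"
    using sub by (auto simp: coset_prod_def baseD intro!: G.gfinprod_closed)
  fix g assume g: "g \<in> carrier base"
  have fin: "finite {y \<in> coset h x. f y \<noteq> \<one>\<^bsub>G\<^esub>}" if "f \<in> carrier base" for f
    using base_finite[OF that] sub by (elim rev_finite_subset) auto
  have "coset_prod h (f \<otimes>\<^bsub>base\<^esub> g) x = gfinprod G (\<lambda>x. f x \<otimes>\<^bsub>G\<^esub> g x) (coset h x)"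
    unfolding coset_prod_def
    by (rule G.gfinprod_cong) (use sub f g in \<open>auto simp: mult_base baseD simp_implies_def subsetD\<close>)
  also have "\<dots> = coset_prod h f x \<otimes>\<^bsub>G\<^esub> coset_prod h g x"
    unfolding coset_prod_def
    by (rule G.gfinprod_distrib) (use sub f g fin[OF f] fin[OF g] in \<open>auto simp: baseD cong: conj_cong\<close>)
  finally show "coset_prod h (f \<otimes>\<^bsub>base\<^esub> g) x = coset_prod h f x \<otimes>\<^bsub>G\<^esub> coset_prod h g x" .
qed

lemma coset_prod_closed:
  "\<lbrakk>h \<in> carrier H; x \<in> carrier H; f \<in> carrier base\<rbrakk> \<Longrightarrow> coset_prod h f x \<in> carrier G"
  using coset_prod_hom by (auto simp: hom_def)

lemma coset_prod_nontrivial: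
  assumes "coset_prod h f x \<noteq> \<one>\<^bsub>G\<^esub>"
  shows "\<exists>y\<in>coset h x. f y \<noteq> \<one>\<^bsub>G\<^esub>"
proof (rule ccontr)
  assume "\<not> ?thesis"
  then have "coset_prod h f x = \<one>\<^bsub>G\<^esub>"
    unfolding coset_prod_def by (intro G.gfinprod_one_eqI) auto
  with assms show False by simp
qed

text \<open>Since \<open>k\<close> centralises \<open>h\<close>, left translation by k^-1 carries
  the right coset of \<open>x\<close> onto the right coset of k^-1 x.\<close>

lemma coset_prod_shift:
  assumes h: "h \<in> carrier H" and x: "x \<in> carrier H" and k: "k \<in> carrier H"
    and comm: "k \<otimes>\<^bsub>H\<^esub> h = h \<otimes>\<^bsub>H\<^esub> k" and f: "f \<in> carrier base"
  shows "coset_prod h (shift k f) x = coset_prod h f (inv\<^bsub>H\<^esub> k \<otimes>\<^bsub>H\<^esub> x)"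
proof -
  let ?l = "\<lambda>y. inv\<^bsub>H\<^esub> k \<otimes>\<^bsub>H\<^esub> y"
  have sub: "coset h y \<subseteq> carrier H" if "y \<in> carrier H" for y using coset_subset that h by blast
  have commg: "inv\<^bsub>H\<^esub> k \<otimes>\<^bsub>H\<^esub> g = g \<otimes>\<^bsub>H\<^esub> inv\<^bsub>H\<^esub> k" if "g \<in> generate H {h}" for g
    using H.commute_generate[of "inv\<^bsub>H\<^esub> k" h g] H.commute_inv[of k h] comm h k that by auto
  have img: "?l ` coset h x = coset h (?l x)"
  proof -
    have "?l ` coset h x = (\<lambda>g. ?l (g \<otimes>\<^bsub>H\<^esub> x)) ` generate H {h}"
      by (auto simp: r_coset_def)
    also have "\<dots> = (\<lambda>g. g \<otimes>\<^bsub>H\<^esub> ?l x) ` generate H {h}"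
    proof (rule image_cong[OF refl])
      fix g assume g: "g \<in> generate H {h}"
      then have "g \<in> carrier H" using cyclic_subset[OF h] by auto
      then show "?l (g \<otimes>\<^bsub>H\<^esub> x) = g \<otimes>\<^bsub>H\<^esub> ?l x"
        using commg[OF g] k x by (simp add: H.m_assoc[symmetric])
    qed
    finally show ?thesis by (auto simp: r_coset_def)
  qed
  have "coset_prod h (shift k f) x = gfinprod G (\<lambda>y. f (?l y)) (coset h x)"
    unfolding coset_prod_def
    by (rule G.gfinprod_cong)
      (use sub[OF x] k f in \<open>auto simp: shift_apply baseD simp_implies_def subsetD\<close>)
  also have "\<dots> = gfinprod G f (?l ` coset h x)"
  proof (rule G.gfinprod_reindex[symmetric])
    show "f \<in> ?l ` coset h x \<rightarrow> carrier G"
      unfolding img using sub[of "?l x"] k x baseD[OF f] by auto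
    show "inj_on ?l (coset h x)"
    proof (rule inj_onI)
      fix y z assume yz: "y \<in> coset h x" "z \<in> coset h x" "?l y = ?l z"
      then have "y \<in> carrier H" "z \<in> carrier H" using sub[OF x] by blast+
      then show "y = z" using yz(3) H.l_cancel[of "inv\<^bsub>H\<^esub> k" y z] k by simp
    qed
  qed
  finally show ?thesis by (simp only: img coset_prod_def)
qed

end

section \<open>Conjugacy in wreath products with abelian base\<close>

lemma hom_gfinprod:
  assumes "comm_group G" "comm_group A" and psi: "\<psi> \<in> hom G A"
    and f: "f \<in> C \<rightarrow> carrier G" and fin: "finite {x \<in> C. f x \<noteq> \<one>\<^bsub>G\<^esub>}"
  shows "\<psi> (gfinprod G f C) = gfinprod A (\<lambda>x. \<psi> (f x)) C"
proof -
  interpret G: comm_group G by fact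
  interpret A: comm_group A by fact
  have one: "\<psi> \<one>\<^bsub>G\<^esub> = \<one>\<^bsub>A\<^esub>" using hom_one[OF psi] G.is_group A.is_group by blast
  have *: "\<psi> (finprod G f F) = finprod A (\<lambda>x. \<psi> (f x)) F" if "finite F" "f \<in> F \<rightarrow> carrier G" for F
    using that
  proof (induction F rule: finite_induct)
    case empty
    then show ?case using one by simp
  next
    case (insert x F)
    then have c: "f x \<in> carrier G" "f \<in> F \<rightarrow> carrier G" by auto
    then have "(\<lambda>x. \<psi> (f x)) \<in> F \<rightarrow> carrier A" "\<psi> (f x) \<in> carrier A"
      using hom_in_carrier[OF psi] by auto
    then show ?case
      using insert.hyps insert.IH c hom_mult[OF psi c(1) G.finprod_closed[OF c(2)]] by simp
  qed
  let ?F = "{x \<in> C. f x \<noteq> \<one>\<^bsub>G\<^esub>}"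
  have "gfinprod G f C = finprod G f ?F" using fin by (simp add: gfinprod_def)
  moreover have "\<psi> (finprod G f ?F) = finprod A (\<lambda>x. \<psi> (f x)) ?F"
    by (rule *[OF fin]) (use f in auto)
  ultimately have "\<psi> (gfinprod G f C) = finprod A (\<lambda>x. \<psi> (f x)) ?F" by simp
  also have "\<dots> = gfinprod A (\<lambda>x. \<psi> (f x)) ?F"
    using fin f hom_in_carrier[OF psi] by (intro A.gfinprod_eq_finprod[symmetric]) auto
  also have "\<dots> = gfinprod A (\<lambda>x. \<psi> (f x)) C"
    by (rule A.gfinprod_mono_neutral_cong_left) (use f hom_in_carrier[OF psi] one in auto)
  finally show ?thesis .
qed

context abelian_wreath
begin

text \<open>In additive notation this is the image of \<open>1 - h\<close> on the base: conjugating
  \<open>(f, h)\<close> by \<open>(u, \<one>)\<close> multiplies \<open>f\<close> by exactly such an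
  element.\<close>

definition coboundaries :: "'b \<Rightarrow> ('b \<Rightarrow> 'a) set"
  where "coboundaries h = (\<lambda>u. u \<otimes>\<^bsub>base\<^esub> inv\<^bsub>base\<^esub> shift h u) ` carrier base"

lemma coboundaries_subgroup:
  assumes h: "h \<in> carrier H"
  shows "subgroup (coboundaries h) base"
proof -
  interpret shift: group_hom base base "shift h"
    using shift_hom[OF h] by unfold_locales
  have "(\<lambda>u. u \<otimes>\<^bsub>base\<^esub> inv\<^bsub>base\<^esub> shift h u) \<in> hom base base"
    by (rule homI) (simp_all add: base.inv_mult base.m_ac)
  then interpret d: group_hom base base "\<lambda>u. u \<otimes>\<^bsub>base\<^esub> inv\<^bsub>base\<^esub> shift h u"
    by unfold_locales
  show ?thesis unfolding coboundaries_def by (rule d.img_is_subgroup)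
qed

lemma coset_inv_mult:
  assumes h: "h \<in> carrier H" and x: "x \<in> carrier H"
  shows "coset h (inv\<^bsub>H\<^esub> h \<otimes>\<^bsub>H\<^esub> x) = coset h x"
proof (rule coset_eq[OF h x])
  have "inv\<^bsub>H\<^esub> h \<in> generate H {h}" by (rule generate.inv) simp
  then show "inv\<^bsub>H\<^esub> h \<otimes>\<^bsub>H\<^esub> x \<in> coset h x" by (auto simp: r_coset_def)
qed

lemma coset_prod_coboundary:
  assumes h: "h \<in> carrier H" and x: "x \<in> carrier H" and g: "g \<in> coboundaries h"
  shows "coset_prod h g x = \<one>\<^bsub>G\<^esub>"
proof -
  obtain u where u: "u \<in> carrier base" "g = u \<otimes>\<^bsub>base\<^esub> inv\<^bsub>base\<^esub> shift h u"
    using g by (auto simp: coboundaries_def)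
  interpret c: group_hom base G "\<lambda>f. coset_prod h f x"
    using coset_prod_hom[OF h x] by unfold_locales
  have "coset_prod h (shift h u) x = coset_prod h u x"
    using coset_prod_shift[OF h x h refl u(1)] coset_inv_mult[OF h x]
    by (simp add: coset_prod_def)
  then show ?thesis
    using u shift_closed[OF h u(1)] by simp
qed

text \<open>Walking along the coset from \<open>x\<close> to \<open>k x\<close> telescopes: the
  admissible \<open>k\<close> form a subgroup, and \<open>h\<close> belongs to it by the definition
  of \<open>coboundaries\<close>.\<close>

lemma single_coboundary:
  assumes h: "h \<in> carrier H" and a: "a \<in> carrier G"
    and x: "x \<in> carrier H" and k: "k \<in> generate H {h}"
  shows "single x a \<otimes>\<^bsub>base\<^esub> inv\<^bsub>base\<^esub> single (k \<otimes>\<^bsub>H\<^esub> x) a \<in> coboundaries h"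
proof -
  let ?d = "\<lambda>x k. single x a \<otimes>\<^bsub>base\<^esub> inv\<^bsub>base\<^esub> single (k \<otimes>\<^bsub>H\<^esub> x) a"
  interpret D: subgroup "coboundaries h" base by (rule coboundaries_subgroup[OF h])
  have s: "single y a \<in> carrier base" for y by (rule single_closed[OF a])
  \<comment> \<open>The point \<open>x\<close> is quantified inside the set because the product of
    \<open>k\<close> and \<open>l\<close> leads from \<open>x\<close> through \<open>l x\<close>, so
    that \<open>k\<close> is needed at another point.\<close>
  have "subgroup {k \<in> carrier H. \<forall>x\<in>carrier H. ?d x k \<in> coboundaries h} H" (is "subgroup ?C H")
  proof (rule H.subgroupI)
    have "?d x \<one>\<^bsub>H\<^esub> = \<one>\<^bsub>base\<^esub>" if "x \<in> carrier H" for x using that s by simp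
    then have "\<one>\<^bsub>H\<^esub> \<in> ?C" by simp
    then show "?C \<noteq> {}" by blast
  next
    fix k assume k: "k \<in> ?C"
    have "?d x (inv\<^bsub>H\<^esub> k) \<in> coboundaries h" if x: "x \<in> carrier H" for x
    proof -
      let ?y = "inv\<^bsub>H\<^esub> k \<otimes>\<^bsub>H\<^esub> x"
      have "?d ?y k \<in> coboundaries h" using k x by simp
      then have "inv\<^bsub>base\<^esub> (?d ?y k) \<in> coboundaries h" by (rule D.m_inv_closed)
      moreover have "k \<otimes>\<^bsub>H\<^esub> ?y = x" using k x by (simp add: H.m_assoc[symmetric])
      ultimately show ?thesis using s by (simp add: base.inv_mult base.m_comm)
    qed
    then show "inv\<^bsub>H\<^esub> k \<in> ?C" using k by simp
  next
    fix k l assume k: "k \<in> ?C" and l: "l \<in> ?C"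
    have "?d x (k \<otimes>\<^bsub>H\<^esub> l) \<in> coboundaries h" if x: "x \<in> carrier H" for x
    proof -
      have "?d x l \<otimes>\<^bsub>base\<^esub> ?d (l \<otimes>\<^bsub>H\<^esub> x) k \<in> coboundaries h" using k l x by simp
      moreover have "?d x l \<otimes>\<^bsub>base\<^esub> ?d (l \<otimes>\<^bsub>H\<^esub> x) k =
          single x a \<otimes>\<^bsub>base\<^esub> (inv\<^bsub>base\<^esub> single (l \<otimes>\<^bsub>H\<^esub> x) a \<otimes>\<^bsub>base\<^esub> single (l \<otimes>\<^bsub>H\<^esub> x) a)
            \<otimes>\<^bsub>base\<^esub> inv\<^bsub>base\<^esub> single (k \<otimes>\<^bsub>H\<^esub> (l \<otimes>\<^bsub>H\<^esub> x)) a"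
        using s by (simp only: base.m_assoc base.m_closed base.inv_closed)
      ultimately show ?thesis using k l x s by (simp add: H.m_assoc)
    qed
    then show "k \<otimes>\<^bsub>H\<^esub> l \<in> ?C" using k l by simp
  qed auto
  moreover have "?d x h \<in> coboundaries h" if "x \<in> carrier H" for x
    unfolding coboundaries_def using shift_single[OF h that, of a] s by (intro image_eqI[of _ _ "single x a"]) auto
  then have "h \<in> ?C" using h by simp
  ultimately have "generate H {h} \<subseteq> ?C" by (intro H.generate_subgroup_incl) auto
  then show ?thesis using k x by auto
qed

text \<open>Modulo coboundaries a value of \<open>g\<close> can be moved to another point of the support in the same
  coset, which makes the support smaller.\<close>

lemma coboundaryI:
  assumes h: "h \<in> carrier H" and g: "g \<in> carrier base"
    and triv: "\<And>x. x \<in> carrier H \<Longrightarrow> coset_prod h g x = \<one>\<^bsub>G\<^esub>"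
  shows "g \<in> coboundaries h"
  using g triv
proof (induction "card {x \<in> carrier H. g x \<noteq> \<one>\<^bsub>G\<^esub>}" arbitrary: g rule: less_induct)
  case less
  interpret D: subgroup "coboundaries h" base by (rule coboundaries_subgroup[OF h])
  let ?supp = "\<lambda>g. {x \<in> carrier H. g x \<noteq> \<one>\<^bsub>G\<^esub>}"
  show ?case
  proof (cases "?supp g = {}")
    case True
    then have "g = \<one>\<^bsub>base\<^esub>"
      using less.prems(1) base.one_closed by (intro base_eqI) (auto simp: one_base)
    then show ?thesis by simp
  next
    case False
    then obtain x where x: "x \<in> carrier H" "g x \<noteq> \<one>\<^bsub>G\<^esub>" by blast
    have sub: "coset h x \<subseteq> carrier H" by (rule coset_subset[OF h x(1)])
    \<comment> \<open>If \<open>x\<close> were the only point of the support in its coset, the coset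
      product there would be \<open>g x\<close>, which is nontrivial.\<close>
    have "\<exists>z\<in>coset h x. z \<noteq> x \<and> g z \<noteq> \<one>\<^bsub>G\<^esub>"
    proof (rule ccontr)
      assume none: "\<not> ?thesis"
      have "coset_prod h g x = g x"
        unfolding coset_prod_def
      proof (rule G.gfinprod_singleton_neutral)
        show "g \<in> coset h x \<rightarrow> carrier G" using sub baseD[OF less.prems(1)] by auto
      qed (use none coset_self[OF h x(1)] in auto)
      then show False using less.prems(2)[OF x(1)] x(2) by simp
    qed
    then obtain z where z: "z \<in> coset h x" "z \<noteq> x" "g z \<noteq> \<one>\<^bsub>G\<^esub>" by blast
    obtain k where k: "k \<in> generate H {h}" "z = k \<otimes>\<^bsub>H\<^esub> x" using z(1) by (auto simp: r_coset_def)
    have zH: "z \<in> carrier H" using z(1) sub by auto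
    have a: "g x \<in> carrier G" using baseD[OF less.prems(1) x(1)] .
    define d where "d = single x (g x) \<otimes>\<^bsub>base\<^esub> inv\<^bsub>base\<^esub> single z (g x)"
    have dD: "d \<in> coboundaries h" unfolding d_def k(2) by (rule single_coboundary[OF h a x(1) k(1)])
    then have dB: "d \<in> carrier base" by simp
    have d: "d y = (if y = x then g x else if y = z then inv\<^bsub>G\<^esub> g x else \<one>\<^bsub>G\<^esub>)"
      if "y \<in> carrier H" for y
      using that a z(2) zH x(1) by (simp add: d_def mult_base inv_base single_closed) (simp add: single_def)
    define g' where "g' = g \<otimes>\<^bsub>base\<^esub> inv\<^bsub>base\<^esub> d"
    have g'B: "g' \<in> carrier base" using less.prems(1) dB by (simp add: g'_def)
    have g': "g' y = g y \<otimes>\<^bsub>G\<^esub> inv\<^bsub>G\<^esub> d y" if "y \<in> carrier H" for y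
      using that dB by (simp add: g'_def mult_base inv_base)
    have "?supp g' \<subseteq> ?supp g - {x}"
    proof
      fix y assume "y \<in> ?supp g'"
      then have y: "y \<in> carrier H" "g' y \<noteq> \<one>\<^bsub>G\<^esub>" by auto
      then have "y \<noteq> x" using g'[OF y(1)] d[OF y(1)] a by auto
      moreover have "g y \<noteq> \<one>\<^bsub>G\<^esub>"
        using y g'[OF y(1)] d[OF y(1)] \<open>y \<noteq> x\<close> z(3) by (cases "y = z") auto
      ultimately show "y \<in> ?supp g - {x}" using y(1) by simp
    qed
    then have "?supp g' \<subset> ?supp g" using x by auto
    then have "card (?supp g') < card (?supp g)"
      by (rule psubset_card_mono[OF base_finite[OF less.prems(1)]])
    moreover have "coset_prod h g' y = \<one>\<^bsub>G\<^esub>" if y: "y \<in> carrier H" for y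
    proof -
      interpret c: group_hom base G "\<lambda>f. coset_prod h f y"
        using coset_prod_hom[OF h y] by unfold_locales
      show ?thesis
        using less.prems(1) dB less.prems(2)[OF y] coset_prod_coboundary[OF h y dD]
        by (simp add: g'_def)
    qed
    ultimately have "g' \<in> coboundaries h" using g'B by (intro less.hyps)
    then have "g' \<otimes>\<^bsub>base\<^esub> d \<in> coboundaries h" using dD by simp
    moreover have "g' \<otimes>\<^bsub>base\<^esub> d = g"
      using less.prems(1) dB by (simp add: g'_def base.m_assoc)
    ultimately show ?thesis by simp
  qed
qed

text \<open>The quotient of \<open>f'\<close> by the translate of \<open>f\<close> has trivial coset
  products, hence is the coboundary of some \<open>u\<close>; then \<open>(u, k)\<close> is a
  conjugating element.\<close>

lemma conj_wreathI:
  assumes h: "h \<in> carrier H" and k: "k \<in> carrier H" "k \<otimes>\<^bsub>H\<^esub> h = h \<otimes>\<^bsub>H\<^esub> k"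
    and f: "f \<in> carrier base" and f': "f' \<in> carrier base"
    and eq: "\<And>x. x \<in> carrier H \<Longrightarrow> coset_prod h f' x = coset_prod h f (inv\<^bsub>H\<^esub> k \<otimes>\<^bsub>H\<^esub> x)"
  shows "(f', h) \<in> conjugacy_class (wreath_product G H) (f, h)"
proof -
  have kf: "shift k f \<in> carrier base" using shift_closed k f by blast
  define g where "g = f' \<otimes>\<^bsub>base\<^esub> inv\<^bsub>base\<^esub> shift k f"
  have g: "g \<in> carrier base" using f' kf by (simp add: g_def)
  have "g \<in> coboundaries h"
  proof (rule coboundaryI[OF h g])
    fix x assume x: "x \<in> carrier H"
    interpret c: group_hom base G "\<lambda>f. coset_prod h f x"
      using coset_prod_hom[OF h x] by unfold_locales
    have "coset_prod h (shift k f) x = coset_prod h f' x"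
      using coset_prod_shift[OF h x k f] eq[OF x] by simp
    then show "coset_prod h g x = \<one>\<^bsub>G\<^esub>" using f' kf by (simp add: g_def)
  qed
  then obtain u where u: "u \<in> carrier base" "g = u \<otimes>\<^bsub>base\<^esub> inv\<^bsub>base\<^esub> shift h u"
    by (auto simp: coboundaries_def)
  have hu: "shift h u \<in> carrier base" using shift_closed h u by blast
  have "f' = g \<otimes>\<^bsub>base\<^esub> shift k f" using f' kf by (simp add: g_def base.m_assoc)
  then have "f' \<otimes>\<^bsub>base\<^esub> shift h u = u \<otimes>\<^bsub>base\<^esub> (inv\<^bsub>base\<^esub> shift h u \<otimes>\<^bsub>base\<^esub> shift h u) \<otimes>\<^bsub>base\<^esub> shift k f"
    using u kf hu by (simp only: base.m_ac base.m_closed base.inv_closed)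
  then have "f' \<otimes>\<^bsub>base\<^esub> shift h u = u \<otimes>\<^bsub>base\<^esub> shift k f" using u kf hu by simp
  then have "(u, k) \<otimes>\<^bsub>wreath_product G H\<^esub> (f, h) = (f', h) \<otimes>\<^bsub>wreath_product G H\<^esub> (u, k)"
    using k(2) by (simp add: wreath_mult)
  moreover have c: "(u, k) \<in> carrier (wreath_product G H)" "(f, h) \<in> carrier (wreath_product G H)"
      "(f', h) \<in> carrier (wreath_product G H)"
    using u k f f' h by (simp_all add: wreath_carrier)
  ultimately have "(f', h) = (u, k) \<otimes>\<^bsub>wreath_product G H\<^esub> (f, h) \<otimes>\<^bsub>wreath_product G H\<^esub>
      inv\<^bsub>wreath_product G H\<^esub> (u, k)"
    using wreath.inv_solve_right by blast
  then show ?thesis using c(1) unfolding conjugacy_class_def by blast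
qed

text \<open>A conjugating element has the form \<open>(u, k)\<close>. Taking coset products of the
  resulting equation in the base removes \<open>u\<close>, since \<open>u\<close> and
  \<open>shift h u\<close> have the same ones.\<close>

lemma conj_wreathD:
  assumes h: "h \<in> carrier H" and f: "f \<in> carrier base" and f': "f' \<in> carrier base"
    and conj: "(f', h) \<in> conjugacy_class (wreath_product G H) (f, h)"
  shows "\<exists>k\<in>carrier H. k \<otimes>\<^bsub>H\<^esub> h = h \<otimes>\<^bsub>H\<^esub> k \<and>
    (\<forall>x\<in>carrier H. coset_prod h f' x = coset_prod h f (inv\<^bsub>H\<^esub> k \<otimes>\<^bsub>H\<^esub> x))"
proof -
  obtain c where c: "c \<in> carrier (wreath_product G H)"
    "(f', h) = c \<otimes>\<^bsub>wreath_product G H\<^esub> (f, h) \<otimes>\<^bsub>wreath_product G H\<^esub> inv\<^bsub>wreath_product G H\<^esub> c"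
    using conj by (auto simp: conjugacy_class_def)
  obtain u k where uk: "c = (u, k)" "u \<in> carrier base" "k \<in> carrier H"
    using c(1) by (auto simp: wreath_carrier)
  have "(f, h) \<in> carrier (wreath_product G H)" "(f', h) \<in> carrier (wreath_product G H)"
    using f f' h by (simp_all add: wreath_carrier)
  then have "c \<otimes>\<^bsub>wreath_product G H\<^esub> (f, h) = (f', h) \<otimes>\<^bsub>wreath_product G H\<^esub> c"
    using c wreath.inv_solve_right by blast
  then have eq: "u \<otimes>\<^bsub>base\<^esub> shift k f = f' \<otimes>\<^bsub>base\<^esub> shift h u" and k: "k \<otimes>\<^bsub>H\<^esub> h = h \<otimes>\<^bsub>H\<^esub> k"
    by (simp_all add: uk(1) wreath_mult)
  have cl: "shift k f \<in> carrier base" "shift h u \<in> carrier base" using shift_closed f uk h by auto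
  have "coset_prod h f' x = coset_prod h f (inv\<^bsub>H\<^esub> k \<otimes>\<^bsub>H\<^esub> x)" if x: "x \<in> carrier H" for x
  proof -
    interpret c: group_hom base G "\<lambda>f. coset_prod h f x"
      using coset_prod_hom[OF h x] by unfold_locales
    have "coset_prod h u x \<otimes>\<^bsub>G\<^esub> coset_prod h (shift k f) x = coset_prod h f' x \<otimes>\<^bsub>G\<^esub> coset_prod h (shift h u) x"
      using arg_cong[OF eq, of "\<lambda>f. coset_prod h f x"] uk f' cl by simp
    moreover have "coset_prod h (shift h u) x = coset_prod h u x"
      using coset_prod_shift[OF h x h refl uk(2)] coset_inv_mult[OF h x] by (simp add: coset_prod_def)
    ultimately have "coset_prod h u x \<otimes>\<^bsub>G\<^esub> coset_prod h (shift k f) x = coset_prod h u x \<otimes>\<^bsub>G\<^esub> coset_prod h f' x"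
      using G.m_comm[OF coset_prod_closed[OF h x f'] coset_prod_closed[OF h x uk(2)]] by simp
    then have "coset_prod h (shift k f) x = coset_prod h f' x"
      by (rule G.l_cancel) (use coset_prod_closed[OF h x] uk(2) cl f' in auto)
    then show ?thesis using coset_prod_shift[OF h x uk(3) k f] by simp
  qed
  then show ?thesis using uk(3) k by blast
qed

end

section \<open>Finite quotients of wreath products\<close>

locale wreath_map = S: abelian_wreath G H + T: abelian_wreath A K
  for G :: "('a, 'm) monoid_scheme" and H :: "('b, 'k) monoid_scheme"
    and A :: "('c, 'n) monoid_scheme" and K :: "('d, 'l) monoid_scheme" +
  fixes \<psi> :: "'a \<Rightarrow> 'c" and \<phi> :: "'b \<Rightarrow> 'd"
  assumes psi: "\<psi> \<in> hom G A" and phi: "\<phi> \<in> hom H K"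
begin

sublocale psi: group_hom G A \<psi>
  using psi by unfold_locales

sublocale phi: group_hom H K \<phi>
  using phi by unfold_locales

text \<open>A push-forward along the fibres of \<open>\<phi>\<close>. A fibre may be infinite, but
  the support of \<open>f\<close> is finite, and commutativity of \<open>A\<close> makes the order
  of the factors immaterial.\<close>

definition push :: "('b \<Rightarrow> 'a) \<Rightarrow> 'd \<Rightarrow> 'c"
  where "push f = (\<lambda>y\<in>carrier K. gfinprod A (\<lambda>x. \<psi> (f x)) {x \<in> carrier H. \<phi> x = y})"

definition wmap :: "('b \<Rightarrow> 'a) \<times> 'b \<Rightarrow> ('d \<Rightarrow> 'c) \<times> 'd"
  where "wmap = (\<lambda>(f, h). (push f, \<phi> h))"

lemma finite_psi_support:
  assumes f: "f \<in> carrier S.base" and C: "C \<subseteq> carrier H"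
  shows "finite {x \<in> C. \<psi> (f x) \<noteq> \<one>\<^bsub>A\<^esub>}"
proof (rule finite_subset[OF _ S.base_finite[OF f]])
  show "{x \<in> C. \<psi> (f x) \<noteq> \<one>\<^bsub>A\<^esub>} \<subseteq> {x \<in> carrier H. f x \<noteq> \<one>\<^bsub>G\<^esub>}" using C by auto
qed

lemma push_closed:
  assumes f: "f \<in> carrier S.base"
  shows "push f \<in> carrier T.base"
proof -
  have "push f y \<in> carrier A" if "y \<in> carrier K" for y
    using that S.baseD[OF f] by (auto simp: push_def intro!: T.G.gfinprod_closed)
  moreover have "{y \<in> carrier K. push f y \<noteq> \<one>\<^bsub>A\<^esub>} \<subseteq> \<phi> ` {x \<in> carrier H. f x \<noteq> \<one>\<^bsub>G\<^esub>}"
  proof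
    fix y assume "y \<in> {y \<in> carrier K. push f y \<noteq> \<one>\<^bsub>A\<^esub>}"
    then have y: "y \<in> carrier K" "gfinprod A (\<lambda>x. \<psi> (f x)) {x \<in> carrier H. \<phi> x = y} \<noteq> \<one>\<^bsub>A\<^esub>"
      by (auto simp: push_def)
    have "\<exists>x\<in>{x \<in> carrier H. \<phi> x = y}. \<psi> (f x) \<noteq> \<one>\<^bsub>A\<^esub>"
    proof (rule ccontr)
      assume "\<not> ?thesis"
      then have "gfinprod A (\<lambda>x. \<psi> (f x)) {x \<in> carrier H. \<phi> x = y} = \<one>\<^bsub>A\<^esub>"
        by (intro T.G.gfinprod_one_eqI) auto
      with y(2) show False by simp
    qed
    then show "y \<in> \<phi> ` {x \<in> carrier H. f x \<noteq> \<one>\<^bsub>G\<^esub>}" by auto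
  qed
  then have "finite {y \<in> carrier K. push f y \<noteq> \<one>\<^bsub>A\<^esub>}"
    by (rule finite_subset) (use S.base_finite[OF f] in simp)
  moreover have "push f \<in> extensional (carrier K)" by (simp add: push_def)
  ultimately show ?thesis by (auto simp: T.base_iff PiE_iff)
qed

lemma push_hom: "push \<in> hom S.base T.base"
proof (rule homI)
  fix f g assume f: "f \<in> carrier S.base" and g: "g \<in> carrier S.base"
  show "push (f \<otimes>\<^bsub>S.base\<^esub> g) = push f \<otimes>\<^bsub>T.base\<^esub> push g"
  proof (rule T.base_eqI)
    fix y assume y: "y \<in> carrier K"
    let ?C = "{x \<in> carrier H. \<phi> x = y}"
    have "push (f \<otimes>\<^bsub>S.base\<^esub> g) y = gfinprod A (\<lambda>x. \<psi> (f x) \<otimes>\<^bsub>A\<^esub> \<psi> (g x)) ?C"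
      unfolding push_def restrict_apply'[OF y]
      by (rule T.G.gfinprod_cong) (use S.baseD f g in \<open>auto simp: S.mult_base simp_implies_def\<close>)
    also have "\<dots> = gfinprod A (\<lambda>x. \<psi> (f x)) ?C \<otimes>\<^bsub>A\<^esub> gfinprod A (\<lambda>x. \<psi> (g x)) ?C"
      using finite_psi_support[OF f, of ?C] finite_psi_support[OF g, of ?C] S.baseD[OF f] S.baseD[OF g]
      by (intro T.G.gfinprod_distrib) auto
    finally show "push (f \<otimes>\<^bsub>S.base\<^esub> g) y = (push f \<otimes>\<^bsub>T.base\<^esub> push g) y"
      using y by (simp add: T.mult_base) (simp add: push_def)
  qed (use f g push_closed in auto)
qed (rule push_closed)

text \<open>Left translation by the inverse of \<open>h\<close> is a bijection from the fibre over
  \<open>y\<close> to the fibre over \<phi>(h)^-1 y.\<close>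

lemma push_shift:
  assumes f: "f \<in> carrier S.base" and h: "h \<in> carrier H"
  shows "push (S.shift h f) = T.shift (\<phi> h) (push f)"
proof (rule T.base_eqI)
  fix y assume y: "y \<in> carrier K"
  let ?C = "{x \<in> carrier H. \<phi> x = y}" and ?D = "{x \<in> carrier H. \<phi> x = inv\<^bsub>K\<^esub> (\<phi> h) \<otimes>\<^bsub>K\<^esub> y}"
  let ?l = "\<lambda>x. inv\<^bsub>H\<^esub> h \<otimes>\<^bsub>H\<^esub> x"
  have img: "?l ` ?C = ?D"
  proof
    show "?l ` ?C \<subseteq> ?D" using h by auto
    show "?D \<subseteq> ?l ` ?C"
    proof
      fix x assume x: "x \<in> ?D"
      then have "\<phi> (h \<otimes>\<^bsub>H\<^esub> x) = y" using h y by (simp add: T.H.m_assoc[symmetric])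
      moreover have "x = ?l (h \<otimes>\<^bsub>H\<^esub> x)" using x h by (simp add: S.H.m_assoc[symmetric])
      ultimately show "x \<in> ?l ` ?C" using x h by (intro image_eqI[of _ _ "h \<otimes>\<^bsub>H\<^esub> x"]) auto
    qed
  qed
  have inj: "inj_on ?l ?C"
  proof (rule inj_onI)
    fix x z assume "x \<in> ?C" "z \<in> ?C" "?l x = ?l z"
    then show "x = z" using S.H.l_cancel[of "inv\<^bsub>H\<^esub> h" x z] h by simp
  qed
  have "push (S.shift h f) y = gfinprod A (\<lambda>x. \<psi> (f (?l x))) ?C"
    unfolding push_def restrict_apply'[OF y]
    by (rule T.G.gfinprod_cong) (use S.baseD[OF f] h in \<open>auto simp: S.shift_apply simp_implies_def\<close>)
  also have "\<dots> = gfinprod A (\<lambda>x. \<psi> (f x)) (?l ` ?C)"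
    by (rule T.G.gfinprod_reindex[symmetric, OF _ inj]) (use S.baseD[OF f] h in auto)
  also have "\<dots> = T.shift (\<phi> h) (push f) y"
    unfolding img using y h by (simp add: T.shift_apply push_def)
  finally show "push (S.shift h f) y = T.shift (\<phi> h) (push f) y" .
qed (use f h push_closed S.shift_closed T.shift_closed in auto)

lemma wmap_hom: "wmap \<in> hom (wreath_product G H) (wreath_product A K)"
proof (rule homI)
  fix p q assume "p \<in> carrier (wreath_product G H)" "q \<in> carrier (wreath_product G H)"
  then obtain f h g k where p: "p = (f, h)" "f \<in> carrier S.base" "h \<in> carrier H"
    and q: "q = (g, k)" "g \<in> carrier S.base" "k \<in> carrier H"
    by (auto simp: S.wreath_carrier)
  show "wmap p \<in> carrier (wreath_product A K)"
    using p push_closed by (simp add: wmap_def T.wreath_carrier)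
  show "wmap (p \<otimes>\<^bsub>wreath_product G H\<^esub> q) = wmap p \<otimes>\<^bsub>wreath_product A K\<^esub> wmap q"
    using p q hom_mult[OF push_hom p(2) S.shift_closed[OF p(3) q(2)]]
    by (simp add: wmap_def S.wreath_mult T.wreath_mult push_shift)
qed

lemma push_eq_one:
  assumes f: "f \<in> carrier S.base" and supp: "{x \<in> carrier H. f x \<noteq> \<one>\<^bsub>G\<^esub>} \<subseteq> E"
    and y: "y \<in> carrier K" "y \<notin> \<phi> ` E"
  shows "push f y = \<one>\<^bsub>A\<^esub>"
  unfolding push_def restrict_apply'[OF y(1)]
proof (rule T.G.gfinprod_one_eqI)
  fix x assume x: "x \<in> {x \<in> carrier H. \<phi> x = y}"
  then have "f x = \<one>\<^bsub>G\<^esub>" using y(2) supp by blast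
  then show "\<psi> (f x) = \<one>\<^bsub>A\<^esub>" by simp
qed

text \<open>The fibre of \<open>\<phi> x\<close> meets \<open>E\<close> only in \<open>x\<close>.
  The set \<open>E\<close> may exceed the support because two functions have to be compared on a
  common set.\<close>

lemma push_apply:
  assumes f: "f \<in> carrier S.base" and supp: "{x \<in> carrier H. f x \<noteq> \<one>\<^bsub>G\<^esub>} \<subseteq> E"
    and E: "E \<subseteq> carrier H" "inj_on \<phi> E" and x: "x \<in> E"
  shows "push f (\<phi> x) = \<psi> (f x)"
proof -
  have y: "\<phi> x \<in> carrier K" using E x by auto
  show ?thesis
    unfolding push_def restrict_apply'[OF y]
  proof (rule T.G.gfinprod_singleton_neutral)
    fix z assume z: "z \<in> {z \<in> carrier H. \<phi> z = \<phi> x}" "z \<noteq> x"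
    have "f z = \<one>\<^bsub>G\<^esub>"
    proof (rule ccontr)
      assume "f z \<noteq> \<one>\<^bsub>G\<^esub>"
      then have "z \<in> E" using z(1) supp by auto
      then show False using z x inj_onD[OF E(2), of z x] by auto
    qed
    then show "\<psi> (f z) = \<one>\<^bsub>A\<^esub>" by simp
  qed (use E x S.baseD[OF f] in auto)
qed

text \<open>By \<open>sep\<close> no point of \<open>E\<close> outside the coset of \<open>x\<close>
  lands in the image coset, so both products reduce to one over \<open>E \<inter> ?C\<close>;
  injectivity on \<open>E\<close> permits the reindexing along \<open>\<phi>\<close>.\<close>

lemma coset_prod_push:
  assumes f: "f \<in> carrier S.base" and supp: "{x \<in> carrier H. f x \<noteq> \<one>\<^bsub>G\<^esub>} \<subseteq> E"
    and E: "E \<subseteq> carrier H" "inj_on \<phi> E" and h: "h \<in> carrier H" and x: "x \<in> carrier H"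
    and sep: "\<And>z. z \<in> E \<Longrightarrow> \<phi> z \<in> T.coset (\<phi> h) (\<phi> x) \<Longrightarrow> z \<in> S.coset h x"
  shows "T.coset_prod (\<phi> h) (push f) (\<phi> x) = \<psi> (S.coset_prod h f x)"
proof -
  let ?C = "S.coset h x" and ?D = "T.coset (\<phi> h) (\<phi> x)"
  have C: "?C \<subseteq> carrier H" by (rule S.coset_subset[OF h x])
  have D: "?D \<subseteq> carrier K" by (rule T.coset_subset) (use h x in auto)
  have CD: "\<phi> z \<in> ?D" if "z \<in> ?C" for z
  proof -
    obtain k where k: "k \<in> generate H {h}" "z = k \<otimes>\<^bsub>H\<^esub> x" using \<open>z \<in> ?C\<close> by (auto simp: r_coset_def)
    have "\<phi> k \<in> generate K {\<phi> h}"
      using k(1) phi.generate_img[of "{h}"] h by auto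
    moreover have "\<phi> z = \<phi> k \<otimes>\<^bsub>K\<^esub> \<phi> x" using k S.cyclic_subset[OF h] x by auto
    ultimately show ?thesis by (auto simp: r_coset_def)
  qed
  have "T.coset_prod (\<phi> h) (push f) (\<phi> x) = gfinprod A (push f) (\<phi> ` (E \<inter> ?C))"
    unfolding T.coset_prod_def
  proof (rule T.G.gfinprod_mono_neutral_cong_right)
    show "\<phi> ` (E \<inter> ?C) \<subseteq> ?D" using CD by auto
    show "push f y = \<one>\<^bsub>A\<^esub>" if "y \<in> ?D - \<phi> ` (E \<inter> ?C)" for y
    proof (rule push_eq_one[OF f supp])
      show "y \<in> carrier K" using that D by auto
      show "y \<notin> \<phi> ` E" using that sep by auto
    qed
    show "push f \<in> ?D \<rightarrow> carrier A" using D T.baseD[OF push_closed[OF f]] by auto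
  qed auto
  also have "\<dots> = gfinprod A (\<lambda>z. push f (\<phi> z)) (E \<inter> ?C)"
  proof (rule T.G.gfinprod_reindex)
    show "push f \<in> \<phi> ` (E \<inter> ?C) \<rightarrow> carrier A" using C T.baseD[OF push_closed[OF f]] by auto
    show "inj_on \<phi> (E \<inter> ?C)" using E(2) by (rule inj_on_subset) auto
  qed
  also have "\<dots> = gfinprod A (\<lambda>z. \<psi> (f z)) (E \<inter> ?C)"
    by (rule T.G.gfinprod_cong)
      (use push_apply[OF f supp E] C S.baseD[OF f] in \<open>auto simp: simp_implies_def\<close>)
  also have "\<dots> = gfinprod A (\<lambda>z. \<psi> (f z)) ?C"
  proof (rule T.G.gfinprod_mono_neutral_cong_left)
    show "\<psi> (f z) = \<one>\<^bsub>A\<^esub>" if "z \<in> ?C - E \<inter> ?C" for z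
    proof -
      have "z \<in> carrier H" "z \<notin> E" using that C by auto
      then have "f z = \<one>\<^bsub>G\<^esub>" using supp by auto
      then show ?thesis by simp
    qed
    show "(\<lambda>z. \<psi> (f z)) \<in> ?C \<rightarrow> carrier A" using C S.baseD[OF f] by auto
  qed auto
  also have "\<dots> = \<psi> (S.coset_prod h f x)"
    unfolding S.coset_prod_def
  proof (rule hom_gfinprod[symmetric, OF _ _ psi])
    show "finite {z \<in> ?C. f z \<noteq> \<one>\<^bsub>G\<^esub>}"
      by (rule finite_subset[OF _ S.base_finite[OF f]]) (use C in auto)
  qed (use C S.baseD[OF f] S.G.comm_group_axioms T.G.comm_group_axioms in auto)
  finally show ?thesis .
qed

end

section \<open>Finite quotients that preserve finitely many elements\<close>

text \<open>This is separation by powers for the trivial cyclic subgroup: each nontrivial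
  \<open>c\<close> fails to be an \<open>m c\<close>-th power. The product of these exponents serves
  all of \<open>C\<close>, since powers with that exponent are \<open>m c\<close>-th powers
  too.\<close>

lemma (in comm_group) finite_quotient_separating:
  assumes fg: "finitely_generated_group G" and C: "finite C" "C \<subseteq> carrier G"
  shows "\<exists>(A :: 'a set monoid) \<psi>. comm_group A \<and> finite (carrier A) \<and> \<psi> \<in> hom G A \<and>
    (\<forall>c\<in>C. c \<noteq> \<one> \<longrightarrow> \<psi> c \<noteq> \<one>\<^bsub>A\<^esub>)"
proof -
  obtain S where S: "S \<subseteq> carrier G" "finite S" "generate G S = carrier G"
    using fg by (auto simp: finitely_generated_group_def)
  have "\<exists>n>0. \<forall>x\<in>carrier G. c \<noteq> x [^] (n::nat)" if "c \<in> C - {\<one>}" for c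
  proof -
    have "subgroup {\<one>} G" by (rule triv_subgroup)
    then have "generate G {\<one>} \<subseteq> {\<one>}" by (rule generate_subgroup_incl[rotated]) simp
    then have "c \<notin> generate G {\<one>}" using that by auto
    from cyclic_subgroup_separated_by_powers[OF S(2,1) one_closed this]
    obtain n :: nat where n: "n > 0" "\<And>t::int. \<And>x. x \<in> carrier G \<Longrightarrow> c \<noteq> \<one> [^] t \<otimes> x [^] n"
      unfolding S(3) by blast
    have "c \<noteq> x [^] n" if "x \<in> carrier G" for x using n(2)[OF that, of 0] that by simp
    then show ?thesis using n(1) by blast
  qed
  then obtain m :: "'a \<Rightarrow> nat" where m: "\<And>c. c \<in> C - {\<one>} \<Longrightarrow> m c > 0"
      "\<And>c x. c \<in> C - {\<one>} \<Longrightarrow> x \<in> carrier G \<Longrightarrow> c \<noteq> x [^] m c"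
    by metis
  let ?n = "\<Prod>c\<in>C - {\<one>}. m c"
  have "?n > 0" using m(1) by (intro prod_pos) auto
  from finite_power_quotient[OF fg this]
  obtain A :: "'a set monoid" and \<psi> where A: "comm_group A" "finite (carrier A)" "\<psi> \<in> hom G A"
    and ker: "\<And>g. g \<in> carrier G \<Longrightarrow> \<psi> g = \<one>\<^bsub>A\<^esub> \<Longrightarrow> \<exists>x\<in>carrier G. g = x [^] ?n"
    by blast
  have "\<psi> c \<noteq> \<one>\<^bsub>A\<^esub>" if c: "c \<in> C" "c \<noteq> \<one>" for c
  proof
    assume "\<psi> c = \<one>\<^bsub>A\<^esub>"
    then obtain x where x: "x \<in> carrier G" "c = x [^] ?n" using ker c C by blast
    have "?n = (\<Prod>d\<in>C - {\<one>} - {c}. m d) * m c"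
      using c C(1) prod.remove[of "C - {\<one>}" c m] by (simp add: mult.commute)
    then have "c = (x [^] (\<Prod>d\<in>C - {\<one>} - {c}. m d)) [^] m c"
      using x by (simp only: nat_pow_pow)
    then show False using m(2)[of c] c x(1) by blast
  qed
  then show ?thesis using A by blast
qed

lemma (in group) finite_quotient_separating_cyclic:
  assumes css: "cyclic_subgroup_separable G" and h: "h \<in> carrier G"
    and Z: "finite Z" "Z \<subseteq> carrier G"
  shows "\<exists>(K :: nat monoid) \<phi>. group K \<and> finite (carrier K) \<and> \<phi> \<in> hom G K \<and>
    (\<forall>z\<in>Z. (z \<noteq> \<one> \<longrightarrow> \<phi> z \<noteq> \<one>\<^bsub>K\<^esub>) \<and>
      (z \<notin> generate G {h} \<longrightarrow> \<phi> z \<notin> generate K {\<phi> h}))"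
proof -
  \<comment> \<open>For \<open>d = \<one>\<close> cyclic subgroup separability is residual
    finiteness, so one common quotient yields both conclusions.\<close>
  define I where "I = {(z, d). z \<in> Z \<and> d \<in> {h, \<one>} \<and> z \<notin> generate G {d}}"
  have d: "d \<in> carrier G" "z \<in> carrier G" "z \<notin> generate G {d}" if "(z, d) \<in> I" for z d
    using that h Z(2) by (auto simp: I_def)
  have "finite I" by (rule finite_subset[of _ "Z \<times> {h, \<one>}"]) (use Z(1) in \<open>auto simp: I_def\<close>)
  then have "\<exists>(K :: nat monoid) \<phi>. group K \<and> finite (carrier K) \<and> \<phi> \<in> hom G K \<and>
      (\<forall>i\<in>I. \<phi> (fst i) \<notin> \<phi> ` generate G {snd i})"
  proof (rule separable_in_common_quotient[OF is_group])
    fix i assume "i \<in> I"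
    then have i: "snd i \<in> carrier G" "fst i \<in> carrier G" "fst i \<notin> generate G {snd i}"
      using d[of "fst i" "snd i"] by auto
    show "separable_in G (generate G {snd i})"
      using css i(1) by (simp add: cyclic_subgroup_separable_def)
    show "generate G {snd i} \<subseteq> carrier G" using generate_incl[of "{snd i}"] i(1) by simp
    show "fst i \<in> carrier G - generate G {snd i}" using i by simp
  qed
  then obtain K :: "nat monoid" and \<phi> where K: "group K" "finite (carrier K)" "\<phi> \<in> hom G K"
    and sep': "\<forall>i\<in>I. \<phi> (fst i) \<notin> \<phi> ` generate G {snd i}"
    by blast
  have sep: "\<phi> z \<notin> \<phi> ` generate G {d}" if "(z, d) \<in> I" for z d
    using bspec[OF sep' that] by simp
  interpret phi: group_hom G K \<phi> using K by (simp add: group_hom_def group_hom_axioms_def is_group)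
  have img: "\<phi> ` generate G {d} = generate K {\<phi> d}" if "d \<in> carrier G" for d
    using phi.generate_img[of "{d}"] that by simp
  have "subgroup {\<one>} G" by (rule triv_subgroup)
  then have triv: "generate G {\<one>} \<subseteq> {\<one>}" by (rule generate_subgroup_incl[rotated]) simp
  have "\<phi> z \<noteq> \<one>\<^bsub>K\<^esub>" if z: "z \<in> Z" "z \<noteq> \<one>" for z
  proof -
    have "\<phi> z \<notin> \<phi> ` generate G {\<one>}" by (rule sep) (use z triv in \<open>auto simp: I_def\<close>)
    then show ?thesis using img[OF one_closed] generate.one[of K "{\<phi> \<one>}"] by auto
  qed
  moreover have "\<phi> z \<notin> generate K {\<phi> h}" if z: "z \<in> Z" "z \<notin> generate G {h}" for z
    using sep[of z h] z img[OF h] by (auto simp: I_def)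
  ultimately show ?thesis using K by blast
qed

lemma nat_quotientI:
  assumes Q: "group Q" "finite (carrier Q)" and phi: "\<phi> \<in> hom G Q" and A: "A \<subseteq> carrier G"
    and g: "g \<in> carrier G" "\<phi> g \<notin> \<phi> ` A"
  shows "\<exists>(N :: nat monoid) \<theta>. group N \<and> finite (carrier N) \<and> \<theta> \<in> hom G N \<and> \<theta> g \<notin> \<theta> ` A"
proof -
  obtain N :: "nat monoid" and f where N: "group N" "f \<in> iso Q N"
    using countable_group_nat_copy[OF Q(1) countable_finite[OF Q(2)]] by blast
  have f: "f \<in> hom Q N" "inj_on f (carrier Q)" "f ` carrier Q = carrier N"
    using N(2) by (auto simp: iso_def bij_betw_def)
  have "(f \<circ> \<phi>) g \<notin> (f \<circ> \<phi>) ` A"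
  proof
    assume "(f \<circ> \<phi>) g \<in> (f \<circ> \<phi>) ` A"
    then obtain a where a: "a \<in> A" "f (\<phi> g) = f (\<phi> a)" by auto
    then have "\<phi> g = \<phi> a" using inj_onD[OF f(2)] hom_in_carrier[OF phi] A g(1) by blast
    then show False using g(2) a(1) by blast
  qed
  moreover have "f \<circ> \<phi> \<in> hom G N" using phi f(1) by (rule hom_compose)
  moreover have "finite (carrier N)" using f(3) Q(2) by (metis finite_imageI)
  ultimately show ?thesis using N(1) by blast
qed

lemma (in group_hom) hom_conjugacy_class:
  assumes "x \<in> carrier G" "y \<in> conjugacy_class G x"
  shows "h y \<in> conjugacy_class H (h x)"
  using assms by (auto simp: conjugacy_class_def)

lemma (in group) conjugacy_class_subset:
  "x \<in> carrier G \<Longrightarrow> conjugacy_class G x \<subseteq> carrier G"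
  by (auto simp: conjugacy_class_def)

lemma (in group) conjugacy_class_conj:
  assumes "x \<in> carrier G" "y \<in> conjugacy_class G x" "c \<in> carrier G"
  shows "c \<otimes> y \<otimes> inv c \<in> conjugacy_class G x"
proof -
  obtain d where d: "d \<in> carrier G" "y = d \<otimes> x \<otimes> inv d"
    using assms(2) by (auto simp: conjugacy_class_def)
  have "c \<otimes> y \<otimes> inv c = (c \<otimes> d) \<otimes> x \<otimes> inv (c \<otimes> d)"
    using assms d by (simp add: m_assoc inv_mult_group)
  then show ?thesis using assms(3) d(1) unfolding conjugacy_class_def by blast
qed

context abelian_wreath
begin

lemma finite_wreath:
  assumes "finite (carrier G)" "finite (carrier H)"
  shows "finite (carrier (wreath_product G H))"
proof -
  have "carrier base \<subseteq> carrier H \<rightarrow>\<^sub>E carrier G" by (auto simp: base_iff)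
  then have "finite (carrier base)"
    by (rule finite_subset) (use assms in \<open>auto intro: finite_PiE\<close>)
  then show ?thesis using assms(2) by (simp add: wreath_carrier)
qed

text \<open>Injectivity on \<open>E\<close> and separation of its cosets are conditions on the
  elements z x^-1 with z and x in \<open>E\<close>: they have to remain nontrivial, or outside the
  subgroup generated by \<open>h\<close>. \<open>Z\<close> holds further elements that must survive,
  such as commutators or powers of \<open>h\<close>.\<close>

lemma exists_quotient_H:
  assumes css: "cyclic_subgroup_separable H" and h: "h \<in> carrier H"
    and E: "finite E" "E \<subseteq> carrier H" and Z: "finite Z" "Z \<subseteq> carrier H"
  shows "\<exists>(K :: nat monoid) \<phi>. group K \<and> finite (carrier K) \<and> \<phi> \<in> hom H K \<and> inj_on \<phi> E \<and>
    (\<forall>x\<in>E. \<forall>z\<in>E. \<phi> z \<in> generate K {\<phi> h} #>\<^bsub>K\<^esub> \<phi> x \<longrightarrow> z \<in> coset h x) \<and>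
    (\<forall>z\<in>Z. z \<noteq> \<one>\<^bsub>H\<^esub> \<longrightarrow> \<phi> z \<noteq> \<one>\<^bsub>K\<^esub>)"
proof -
  let ?Z = "Z \<union> (\<lambda>(z, x). z \<otimes>\<^bsub>H\<^esub> inv\<^bsub>H\<^esub> x) ` (E \<times> E)"
  have "finite ?Z" "?Z \<subseteq> carrier H" using E Z by auto
  from H.finite_quotient_separating_cyclic[OF css h this]
  obtain K :: "nat monoid" and \<phi> where K: "group K" "finite (carrier K)" "\<phi> \<in> hom H K"
    and one: "\<And>z. z \<in> ?Z \<Longrightarrow> z \<noteq> \<one>\<^bsub>H\<^esub> \<Longrightarrow> \<phi> z \<noteq> \<one>\<^bsub>K\<^esub>"
    and cyc: "\<And>z. z \<in> ?Z \<Longrightarrow> z \<notin> generate H {h} \<Longrightarrow> \<phi> z \<notin> generate K {\<phi> h}"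
    by (metis (no_types, lifting))
  interpret phi: group_hom H K \<phi> using K by (simp add: group_hom_def group_hom_axioms_def H.is_group)
  have mem: "z \<otimes>\<^bsub>H\<^esub> inv\<^bsub>H\<^esub> x \<in> ?Z" if "z \<in> E" "x \<in> E" for x z using that by auto
  have "inj_on \<phi> E"
  proof (rule inj_onI)
    fix z x assume zx: "z \<in> E" "x \<in> E" "\<phi> z = \<phi> x"
    have c: "z \<in> carrier H" "x \<in> carrier H" using zx E(2) by auto
    then have "\<phi> (z \<otimes>\<^bsub>H\<^esub> inv\<^bsub>H\<^esub> x) = \<one>\<^bsub>K\<^esub>" using zx(3) by simp
    then have "z \<otimes>\<^bsub>H\<^esub> inv\<^bsub>H\<^esub> x = \<one>\<^bsub>H\<^esub>" using one[OF mem[OF zx(1,2)]] by blast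
    then show "z = x" using c H.inv_solve_right'[of "\<one>\<^bsub>H\<^esub>" z x] by simp
  qed
  moreover have "z \<in> coset h x"
    if zx: "z \<in> E" "x \<in> E" and zK: "\<phi> z \<in> generate K {\<phi> h} #>\<^bsub>K\<^esub> \<phi> x" for z x
  proof -
    have c: "z \<in> carrier H" "x \<in> carrier H" using zx E(2) by auto
    have "\<phi> z \<otimes>\<^bsub>K\<^esub> inv\<^bsub>K\<^esub> \<phi> x \<in> generate K {\<phi> h}"
      using zK phi.H.mem_cyclic_r_coset_iff[of "\<phi> h" "\<phi> x"] c h by simp
    then have "\<phi> (z \<otimes>\<^bsub>H\<^esub> inv\<^bsub>H\<^esub> x) \<in> generate K {\<phi> h}" using c by simp
    then have "z \<otimes>\<^bsub>H\<^esub> inv\<^bsub>H\<^esub> x \<in> generate H {h}" using cyc[OF mem[OF zx]] by blast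
    then show ?thesis using H.mem_cyclic_r_coset_iff[OF h c(2)] c(1) by simp
  qed
  ultimately show ?thesis using K one by (intro exI[of _ K] exI[of _ \<phi>]) auto
qed

end

section \<open>Conjugacy separability\<close>

context abelian_wreath
begin

text \<open>Triviality of all coset products is independent of the conjugating \<open>k\<close>. It
  is therefore enough to preserve one coset on which \<open>f'\<close> has a nontrivial product, and
  no candidates for \<open>k\<close> have to be examined.\<close>

lemma separate_conjugacy_trivial_cosets:
  assumes fg: "finitely_generated_group G" and css: "cyclic_subgroup_separable H"
    and h: "h \<in> carrier H" and f: "f \<in> carrier base" and f': "f' \<in> carrier base"
    and ncon: "(f', h) \<notin> conjugacy_class (wreath_product G H) (f, h)"
    and triv: "\<And>x. x \<in> carrier H \<Longrightarrow> coset_prod h f x = \<one>\<^bsub>G\<^esub>"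
  shows "\<exists>(A :: 'a set monoid) (K :: nat monoid) \<psi> \<phi>. wreath_map G H A K \<psi> \<phi> \<and>
    finite (carrier A) \<and> finite (carrier K) \<and>
    wreath_map.wmap H A K \<psi> \<phi> (f', h) \<notin>
      conjugacy_class (wreath_product A K) (wreath_map.wmap H A K \<psi> \<phi> (f, h))"
proof -
  \<comment> \<open>The choice \<open>k = \<one>\<close> must violate the conjugacy criterion, which
    yields the coset with a nontrivial product of \<open>f'\<close>.\<close>
  obtain y where y: "y \<in> carrier H" "coset_prod h f' y \<noteq> \<one>\<^bsub>G\<^esub>"
    using conj_wreathI[OF h H.one_closed _ f f'] ncon triv h by auto
  define E where "E = {x \<in> carrier H. f x \<noteq> \<one>\<^bsub>G\<^esub>} \<union> {x \<in> carrier H. f' x \<noteq> \<one>\<^bsub>G\<^esub>} \<union> {y}"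
  have E: "finite E" "E \<subseteq> carrier H" "y \<in> E" and
    supp: "{x \<in> carrier H. f x \<noteq> \<one>\<^bsub>G\<^esub>} \<subseteq> E" "{x \<in> carrier H. f' x \<noteq> \<one>\<^bsub>G\<^esub>} \<subseteq> E"
    using base_finite[OF f] base_finite[OF f'] y(1) by (auto simp: E_def)
  obtain K :: "nat monoid" and \<phi> where K: "group K" "finite (carrier K)" "\<phi> \<in> hom H K" "inj_on \<phi> E"
    and sep: "\<And>x z. x \<in> E \<Longrightarrow> z \<in> E \<Longrightarrow> \<phi> z \<in> generate K {\<phi> h} #>\<^bsub>K\<^esub> \<phi> x \<Longrightarrow> z \<in> coset h x"
    using exists_quotient_H[OF css h E(1,2), of "{}"] by auto
  obtain A :: "'a set monoid" and \<psi> where A: "comm_group A" "finite (carrier A)" "\<psi> \<in> hom G A"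
    and psi: "\<psi> (coset_prod h f' y) \<noteq> \<one>\<^bsub>A\<^esub>"
    using G.finite_quotient_separating[OF fg, of "{coset_prod h f' y}"]
      coset_prod_closed[OF h y(1) f'] y(2) by auto
  interpret M: wreath_map G H A K \<psi> \<phi>
    by (intro wreath_map.intro wreath_map_axioms.intro abelian_wreath.intro)
      (use K A G.comm_group_axioms H.is_group in auto)
  have "(M.push f', \<phi> h) \<notin> conjugacy_class (wreath_product A K) (M.push f, \<phi> h)"
  proof
    assume conj: "(M.push f', \<phi> h) \<in> conjugacy_class (wreath_product A K) (M.push f, \<phi> h)"
    have phih: "\<phi> h \<in> carrier K" using h by simp
    obtain \<kappa> where kappa: "\<kappa> \<in> carrier K" "\<And>x. x \<in> carrier K \<Longrightarrow> M.T.coset_prod (\<phi> h) (M.push f') x =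
        M.T.coset_prod (\<phi> h) (M.push f) (inv\<^bsub>K\<^esub> \<kappa> \<otimes>\<^bsub>K\<^esub> x)"
      using M.T.conj_wreathD[OF phih M.push_closed[OF f] M.push_closed[OF f'] conj] by blast
    let ?w = "inv\<^bsub>K\<^esub> \<kappa> \<otimes>\<^bsub>K\<^esub> \<phi> y"
    have w: "?w \<in> carrier K" using kappa(1) y(1) by simp
    have "M.T.coset_prod (\<phi> h) (M.push f') (\<phi> y) = \<psi> (coset_prod h f' y)"
      by (rule M.coset_prod_push[OF f' supp(2) E(2) K(4) h y(1)]) (rule sep[OF E(3)])
    then have ne: "M.T.coset_prod (\<phi> h) (M.push f) ?w \<noteq> \<one>\<^bsub>A\<^esub>"
      using kappa(2)[of "\<phi> y"] y(1) psi by simp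
    \<comment> \<open>A coset of the quotient with a nontrivial product contains the image of some
      \<open>x\<close> in \<open>E\<close>. Its product is then the image of the coset product at
      \<open>x\<close>, which is trivial.\<close>
    then obtain v where v: "v \<in> M.T.coset (\<phi> h) ?w" "M.push f v \<noteq> \<one>\<^bsub>A\<^esub>"
      using M.T.coset_prod_nontrivial by blast
    have "v \<in> carrier K" using v(1) M.T.coset_subset[OF phih w] by blast
    then obtain x where x: "x \<in> E" "v = \<phi> x" using v(2) M.push_eq_one[OF f supp(1)] by blast
    have xH: "x \<in> carrier H" using x(1) E(2) by auto
    have "M.T.coset (\<phi> h) v = M.T.coset (\<phi> h) ?w" by (rule M.T.coset_eq[OF phih w v(1)])
    then have "M.T.coset_prod (\<phi> h) (M.push f) ?w = M.T.coset_prod (\<phi> h) (M.push f) (\<phi> x)"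
      by (simp add: M.T.coset_prod_def x(2))
    also have "\<dots> = \<psi> (coset_prod h f x)"
      by (rule M.coset_prod_push[OF f supp(1) E(2) K(4) h xH]) (rule sep[OF x(1)])
    also have "\<dots> = \<one>\<^bsub>A\<^esub>" using triv[OF xH] by simp
    finally show False using ne by simp
  qed
  then show ?thesis
    using A(2) K(2) M.wreath_map_axioms by (intro exI[of _ A] exI[of _ K] exI[of _ \<psi>] exI[of _ \<phi>]) (simp add: M.wmap_def)
qed

text \<open>A conjugating \<open>\<kappa>\<close> in the quotient must carry the coset of
  \<open>x1\<close> to one that meets the image of the support of \<open>f'\<close>. So up to a
  power of the image of \<open>h\<close> it is the image of one of finitely many \<open>k y\<close>,
  and each of these fails in \<open>H\<close> for a reason that the quotient preserves.\<close>

lemma separate_conjugacy_nontrivial_coset: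
  assumes fg: "finitely_generated_group G" and css: "cyclic_subgroup_separable H"
    and h: "h \<in> carrier H" and f: "f \<in> carrier base" and f': "f' \<in> carrier base"
    and ncon: "(f', h) \<notin> conjugacy_class (wreath_product G H) (f, h)"
    and x1: "x1 \<in> carrier H" "coset_prod h f x1 \<noteq> \<one>\<^bsub>G\<^esub>"
  shows "\<exists>(A :: 'a set monoid) (K :: nat monoid) \<psi> \<phi>. wreath_map G H A K \<psi> \<phi> \<and>
    finite (carrier A) \<and> finite (carrier K) \<and>
    wreath_map.wmap H A K \<psi> \<phi> (f', h) \<notin>
      conjugacy_class (wreath_product A K) (wreath_map.wmap H A K \<psi> \<phi> (f, h))"
proof -
  define F' where "F' = {x \<in> carrier H. f' x \<noteq> \<one>\<^bsub>G\<^esub>}"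
  \<comment> \<open>The element that carries \<open>x1\<close> to \<open>y\<close>.\<close>
  define k where "k = (\<lambda>y. y \<otimes>\<^bsub>H\<^esub> inv\<^bsub>H\<^esub> x1)"
  have F': "finite F'" "F' \<subseteq> carrier H" using base_finite[OF f'] by (auto simp: F'_def)
  have kH: "k y \<in> carrier H" if "y \<in> F'" for y using that F'(2) x1(1) by (auto simp: k_def)
  \<comment> \<open>A candidate fails because it does not commute with \<open>h\<close>, and then
    any point serves as \<open>z\<close>, or because the coset products differ at \<open>z\<close>.
    Both kinds of failure have to survive in the quotient.\<close>
  have "\<exists>z\<in>carrier H. k y \<otimes>\<^bsub>H\<^esub> h = h \<otimes>\<^bsub>H\<^esub> k y \<longrightarrow>
      coset_prod h f' z \<noteq> coset_prod h f (inv\<^bsub>H\<^esub> k y \<otimes>\<^bsub>H\<^esub> z)" if "y \<in> F'" for y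
    using conj_wreathI[OF h kH[OF that] _ f f'] ncon h by blast
  then obtain Z where Z: "\<And>y. y \<in> F' \<Longrightarrow> Z y \<in> carrier H"
    "\<And>y. y \<in> F' \<Longrightarrow> k y \<otimes>\<^bsub>H\<^esub> h = h \<otimes>\<^bsub>H\<^esub> k y \<Longrightarrow>
      coset_prod h f' (Z y) \<noteq> coset_prod h f (inv\<^bsub>H\<^esub> k y \<otimes>\<^bsub>H\<^esub> Z y)"
    by metis
  define Y where "Y = (\<lambda>y. inv\<^bsub>H\<^esub> k y \<otimes>\<^bsub>H\<^esub> Z y)"
  have YH: "Y y \<in> carrier H" if "y \<in> F'" for y using Z(1) kH that by (simp add: Y_def)
  define E where "E = {x \<in> carrier H. f x \<noteq> \<one>\<^bsub>G\<^esub>} \<union> F' \<union> {x1} \<union> Z ` F' \<union> Y ` F'"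
  have E: "finite E" "E \<subseteq> carrier H" "x1 \<in> E" and
    supp: "{x \<in> carrier H. f x \<noteq> \<one>\<^bsub>G\<^esub>} \<subseteq> E" "{x \<in> carrier H. f' x \<noteq> \<one>\<^bsub>G\<^esub>} \<subseteq> E"
    using base_finite[OF f] F' x1(1) Z(1) YH by (auto simp: E_def F'_def)
  \<comment> \<open>A nontrivial commutator must stay nontrivial; otherwise the image of
    \<open>k y\<close> could enter the centraliser of the image of \<open>h\<close>.\<close>
  define comm where "comm = (\<lambda>y. (k y \<otimes>\<^bsub>H\<^esub> h) \<otimes>\<^bsub>H\<^esub> inv\<^bsub>H\<^esub> (h \<otimes>\<^bsub>H\<^esub> k y))"
  have commH: "comm ` F' \<subseteq> carrier H" using kH h by (auto simp: comm_def)
  obtain K :: "nat monoid" and \<phi> where K: "group K" "finite (carrier K)" "\<phi> \<in> hom H K" "inj_on \<phi> E"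
    and sep: "\<And>x z. x \<in> E \<Longrightarrow> z \<in> E \<Longrightarrow> \<phi> z \<in> generate K {\<phi> h} #>\<^bsub>K\<^esub> \<phi> x \<Longrightarrow> z \<in> coset h x"
    and sep_comm: "\<And>y. y \<in> F' \<Longrightarrow> comm y \<noteq> \<one>\<^bsub>H\<^esub> \<Longrightarrow> \<phi> (comm y) \<noteq> \<one>\<^bsub>K\<^esub>"
    using exists_quotient_H[OF css h E(1,2) finite_imageI[OF F'(1), of comm] commH] by auto
  define dif where "dif = (\<lambda>y. coset_prod h f' (Z y) \<otimes>\<^bsub>G\<^esub> inv\<^bsub>G\<^esub> coset_prod h f (Y y))"
  have cpH: "coset_prod h f' (Z y) \<in> carrier G" "coset_prod h f (Y y) \<in> carrier G" if "y \<in> F'" for y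
    using coset_prod_closed[OF h] Z(1) YH f f' that by auto
  have "finite (insert (coset_prod h f x1) (dif ` F'))"
    "insert (coset_prod h f x1) (dif ` F') \<subseteq> carrier G"
    using F'(1) coset_prod_closed[OF h x1(1) f] cpH by (auto simp: dif_def)
  from G.finite_quotient_separating[OF fg this]
  obtain A :: "'a set monoid" and \<psi> where A: "comm_group A" "finite (carrier A)" "\<psi> \<in> hom G A"
    and psi: "\<psi> (coset_prod h f x1) \<noteq> \<one>\<^bsub>A\<^esub>"
    and psi_dif: "\<And>y. y \<in> F' \<Longrightarrow> dif y \<noteq> \<one>\<^bsub>G\<^esub> \<Longrightarrow> \<psi> (dif y) \<noteq> \<one>\<^bsub>A\<^esub>"
    using x1(2) by auto
  interpret M: wreath_map G H A K \<psi> \<phi>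
    by (intro wreath_map.intro wreath_map_axioms.intro abelian_wreath.intro)
      (use K A G.comm_group_axioms H.is_group in auto)
  have "(M.push f', \<phi> h) \<notin> conjugacy_class (wreath_product A K) (M.push f, \<phi> h)"
  proof
    assume conj: "(M.push f', \<phi> h) \<in> conjugacy_class (wreath_product A K) (M.push f, \<phi> h)"
    have phih: "\<phi> h \<in> carrier K" using h by simp
    obtain \<kappa> where kappa: "\<kappa> \<in> carrier K" "\<kappa> \<otimes>\<^bsub>K\<^esub> \<phi> h = \<phi> h \<otimes>\<^bsub>K\<^esub> \<kappa>"
      and kappa_eq: "\<And>x. x \<in> carrier K \<Longrightarrow> M.T.coset_prod (\<phi> h) (M.push f') x =
        M.T.coset_prod (\<phi> h) (M.push f) (inv\<^bsub>K\<^esub> \<kappa> \<otimes>\<^bsub>K\<^esub> x)"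
      using M.T.conj_wreathD[OF phih M.push_closed[OF f] M.push_closed[OF f'] conj] by blast
    have phix1: "\<phi> x1 \<in> carrier K" using x1(1) by simp
    let ?w = "\<kappa> \<otimes>\<^bsub>K\<^esub> \<phi> x1"
    have w: "?w \<in> carrier K" using kappa(1) phix1 by simp
    have "inv\<^bsub>K\<^esub> \<kappa> \<otimes>\<^bsub>K\<^esub> ?w = \<phi> x1"
      using kappa(1) phix1 by (simp add: M.T.H.m_assoc[symmetric])
    then have "M.T.coset_prod (\<phi> h) (M.push f') ?w = M.T.coset_prod (\<phi> h) (M.push f) (\<phi> x1)"
      using kappa_eq[OF w] by simp
    also have "\<dots> = \<psi> (coset_prod h f x1)"
      by (rule M.coset_prod_push[OF f supp(1) E(2) K(4) h x1(1)]) (rule sep[OF E(3)])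
    finally have "M.T.coset_prod (\<phi> h) (M.push f') ?w \<noteq> \<one>\<^bsub>A\<^esub>" using psi by simp
    then obtain v where v: "v \<in> M.T.coset (\<phi> h) ?w" "M.push f' v \<noteq> \<one>\<^bsub>A\<^esub>"
      using M.T.coset_prod_nontrivial by blast
    have "v \<in> carrier K" using v(1) M.T.coset_subset[OF phih w] by blast
    then obtain y where y: "y \<in> F'" "v = \<phi> y"
      using v(2) M.push_eq_one[OF f', of F'] unfolding F'_def by blast
    have yH: "y \<in> carrier H" using y(1) F'(2) by auto
    \<comment> \<open>\<open>\<kappa>\<close> is known only up to the cyclic group of
      \<open>\<phi> h\<close>. The factor \<open>g\<close> measures its difference from the image of
      \<open>k y\<close> and commutes with both \<open>\<kappa>\<close> and
      \<open>\<phi> h\<close>.\<close>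
    obtain g where g: "g \<in> generate K {\<phi> h}" "\<phi> y = g \<otimes>\<^bsub>K\<^esub> ?w"
      using v(1) y(2) by (auto simp: r_coset_def)
    have gK: "g \<in> carrier K" using g(1) M.T.cyclic_subset[OF phih] by auto
    have phik: "\<phi> (k y) = g \<otimes>\<^bsub>K\<^esub> \<kappa>"
      using g(2) gK kappa(1) phix1 yH x1(1) by (simp add: k_def M.T.H.m_assoc)
    have gh: "g \<otimes>\<^bsub>K\<^esub> \<phi> h = \<phi> h \<otimes>\<^bsub>K\<^esub> g"
      using M.T.H.commute_generate[OF phih phih refl g(1)] by simp
    have gkappa: "\<kappa> \<otimes>\<^bsub>K\<^esub> g = g \<otimes>\<^bsub>K\<^esub> \<kappa>"
      by (rule M.T.H.commute_generate[OF kappa(1) phih kappa(2) g(1)])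
    have "\<phi> (k y) \<otimes>\<^bsub>K\<^esub> \<phi> h = g \<otimes>\<^bsub>K\<^esub> (\<kappa> \<otimes>\<^bsub>K\<^esub> \<phi> h)"
      using phik gK kappa(1) phih by (simp add: M.T.H.m_assoc)
    also have "\<dots> = (g \<otimes>\<^bsub>K\<^esub> \<phi> h) \<otimes>\<^bsub>K\<^esub> \<kappa>"
      using gK kappa phih by (simp add: M.T.H.m_assoc)
    also have "\<dots> = \<phi> h \<otimes>\<^bsub>K\<^esub> \<phi> (k y)"
      using phik gh gK kappa(1) phih by (simp add: M.T.H.m_assoc)
    finally have "\<phi> (comm y) = \<one>\<^bsub>K\<^esub>" using kH[OF y(1)] h by (simp add: comm_def)
    then have "comm y = \<one>\<^bsub>H\<^esub>" using sep_comm[OF y(1)] by blast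
    then have comm: "k y \<otimes>\<^bsub>H\<^esub> h = h \<otimes>\<^bsub>H\<^esub> k y"
      using kH[OF y(1)] h H.inv_solve_right'[of "\<one>\<^bsub>H\<^esub>" "k y \<otimes>\<^bsub>H\<^esub> h" "h \<otimes>\<^bsub>H\<^esub> k y"]
      by (simp add: comm_def)
    have ne: "coset_prod h f' (Z y) \<noteq> coset_prod h f (Y y)"
      using Z(2)[OF y(1) comm] by (simp add: Y_def)
    have inE: "Z y \<in> E" "Y y \<in> E" using y(1) by (auto simp: E_def)
    \<comment> \<open>Replacing \<open>\<kappa>\<close> by the image of \<open>k y\<close> moves the
      point only within its coset, because \<open>g\<close> commutes with
      \<open>\<kappa>\<close>.\<close>
    have phiY: "\<phi> (Y y) \<in> M.T.coset (\<phi> h) (inv\<^bsub>K\<^esub> \<kappa> \<otimes>\<^bsub>K\<^esub> \<phi> (Z y))"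
    proof -
      have "\<phi> (Y y) = inv\<^bsub>K\<^esub> (\<kappa> \<otimes>\<^bsub>K\<^esub> g) \<otimes>\<^bsub>K\<^esub> \<phi> (Z y)"
        using kH[OF y(1)] Z(1)[OF y(1)] phik gkappa by (simp add: Y_def)
      also have "\<dots> = inv\<^bsub>K\<^esub> g \<otimes>\<^bsub>K\<^esub> (inv\<^bsub>K\<^esub> \<kappa> \<otimes>\<^bsub>K\<^esub> \<phi> (Z y))"
        using gK kappa(1) Z(1)[OF y(1)] by (simp add: M.T.H.inv_mult_group M.T.H.m_assoc)
      finally show ?thesis
        using subgroup.m_inv_closed[OF M.T.cyclic_subgroup[OF phih] g(1)] by (auto simp: r_coset_def)
    qed
    have "\<psi> (coset_prod h f' (Z y)) = M.T.coset_prod (\<phi> h) (M.push f') (\<phi> (Z y))"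
      by (rule M.coset_prod_push[OF f' supp(2) E(2) K(4) h Z(1)[OF y(1)], symmetric]) (rule sep[OF inE(1)])
    also have "\<dots> = M.T.coset_prod (\<phi> h) (M.push f) (inv\<^bsub>K\<^esub> \<kappa> \<otimes>\<^bsub>K\<^esub> \<phi> (Z y))"
      using kappa_eq Z(1)[OF y(1)] by simp
    also have "\<dots> = M.T.coset_prod (\<phi> h) (M.push f) (\<phi> (Y y))"
      using M.T.coset_eq[OF phih _ phiY] kappa(1) Z(1)[OF y(1)] by (simp add: M.T.coset_prod_def)
    also have "\<dots> = \<psi> (coset_prod h f (Y y))"
      by (rule M.coset_prod_push[OF f supp(1) E(2) K(4) h YH[OF y(1)]]) (rule sep[OF inE(2)])
    finally have "\<psi> (dif y) = \<one>\<^bsub>A\<^esub>" using cpH[OF y(1)] by (simp add: dif_def)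
    then have "dif y = \<one>\<^bsub>G\<^esub>" using psi_dif[OF y(1)] by blast
    then show False
      using ne cpH[OF y(1)] G.inv_solve_right'[of "\<one>\<^bsub>G\<^esub>" "coset_prod h f' (Z y)" "coset_prod h f (Y y)"]
      by (simp add: dif_def)
  qed
  then show ?thesis
    using A(2) K(2) M.wreath_map_axioms by (intro exI[of _ A] exI[of _ K] exI[of _ \<psi>] exI[of _ \<phi>]) (simp add: M.wmap_def)
qed

lemma separate_conjugacy:
  assumes fg: "finitely_generated_group G" and css: "cyclic_subgroup_separable H"
    and h: "h \<in> carrier H" and f: "f \<in> carrier base" and f': "f' \<in> carrier base"
    and ncon: "(f', h) \<notin> conjugacy_class (wreath_product G H) (f, h)"
  shows "\<exists>(N :: nat monoid) \<theta>. group N \<and> finite (carrier N) \<and>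
    \<theta> \<in> hom (wreath_product G H) N \<and> \<theta> (f', h) \<notin> \<theta> ` conjugacy_class (wreath_product G H) (f, h)"
proof -
  have "\<exists>(A :: 'a set monoid) (K :: nat monoid) \<psi> \<phi>. wreath_map G H A K \<psi> \<phi> \<and>
    finite (carrier A) \<and> finite (carrier K) \<and>
    wreath_map.wmap H A K \<psi> \<phi> (f', h) \<notin>
      conjugacy_class (wreath_product A K) (wreath_map.wmap H A K \<psi> \<phi> (f, h))"
  proof (cases "\<forall>x\<in>carrier H. coset_prod h f x = \<one>\<^bsub>G\<^esub>")
    case True
    then show ?thesis using separate_conjugacy_trivial_cosets[OF assms] by blast
  next
    case False
    then show ?thesis using separate_conjugacy_nontrivial_coset[OF assms] by blast
  qed
  then obtain A :: "'a set monoid" and K :: "nat monoid" and \<psi> \<phi> where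
    M: "wreath_map G H A K \<psi> \<phi>" "finite (carrier A)" "finite (carrier K)"
    and sep: "wreath_map.wmap H A K \<psi> \<phi> (f', h) \<notin>
      conjugacy_class (wreath_product A K) (wreath_map.wmap H A K \<psi> \<phi> (f, h))"
    by blast
  interpret M: wreath_map G H A K \<psi> \<phi> by (rule M(1))
  interpret wmap: group_hom "wreath_product G H" "wreath_product A K" M.wmap
    using M.wmap_hom by unfold_locales
  have c: "(f, h) \<in> carrier (wreath_product G H)" "(f', h) \<in> carrier (wreath_product G H)"
    using f f' h by (simp_all add: wreath_carrier)
  show ?thesis
  proof (rule nat_quotientI[OF _ _ M.wmap_hom _ c(2)])
    show "M.wmap (f', h) \<notin> M.wmap ` conjugacy_class (wreath_product G H) (f, h)"
      using sep wmap.hom_conjugacy_class[OF c(1)] by auto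
    show "conjugacy_class (wreath_product G H) (f, h) \<subseteq> carrier (wreath_product G H)"
      by (rule wreath.conjugacy_class_subset[OF c(1)])
  qed (use M.T.finite_wreath M M.T.wreath.is_group in auto)
qed

lemma snd_hom: "snd \<in> hom (wreath_product G H) H"
  by (rule homI) (auto simp: wreath_carrier wreath_mult)

text \<open>If the top components are not conjugate, \<open>H\<close> separates them. Otherwise
  \<open>q\<close> is conjugated so as to share the top component \<open>h\<close> with
  \<open>p\<close>, which affects neither conjugacy to \<open>p\<close> nor its detection in a
  quotient.\<close>

theorem conjugacy_separable_wreath:
  assumes fg: "finitely_generated_group G" and css: "cyclic_subgroup_separable H"
    and cs: "conjugacy_separable H"
  shows "conjugacy_separable (wreath_product G H)"
  unfolding conjugacy_separable_def separable_in_def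
proof (intro ballI)
  let ?W = "wreath_product G H"
  fix p q assume p: "p \<in> carrier ?W" and q: "q \<in> carrier ?W - conjugacy_class ?W p"
  interpret snd: group_hom ?W H snd using snd_hom by unfold_locales
  obtain f h where fh: "p = (f, h)" "f \<in> carrier base" "h \<in> carrier H"
    using p by (auto simp: wreath_carrier)
  have cls: "conjugacy_class ?W p \<subseteq> carrier ?W" by (rule wreath.conjugacy_class_subset[OF p])
  show "\<exists>(Q :: nat monoid) \<phi>. group Q \<and> finite (carrier Q) \<and> \<phi> \<in> hom ?W Q \<and>
      \<phi> q \<notin> \<phi> ` conjugacy_class ?W p"
  proof (cases "snd q \<in> conjugacy_class H h")
    case False
    then have "snd q \<in> carrier H - conjugacy_class H h" using q snd.hom_closed by blast
    moreover have "separable_in H (conjugacy_class H h)"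
      using cs fh(3) by (simp add: conjugacy_separable_def)
    ultimately obtain Q :: "nat monoid" and \<phi> where Q: "group Q" "finite (carrier Q)" "\<phi> \<in> hom H Q"
      "\<phi> (snd q) \<notin> \<phi> ` conjugacy_class H h"
      unfolding separable_in_def by blast
    have "(\<phi> \<circ> snd) q \<notin> (\<phi> \<circ> snd) ` conjugacy_class ?W p"
      using Q(4) snd.hom_conjugacy_class[OF p] fh(1) by auto
    then show ?thesis using Q hom_compose[OF snd_hom Q(3)] by blast
  next
    case True
    then obtain x where x: "x \<in> carrier H" "snd q = x \<otimes>\<^bsub>H\<^esub> h \<otimes>\<^bsub>H\<^esub> inv\<^bsub>H\<^esub> x"
      by (auto simp: conjugacy_class_def)
    define c where "c = (\<one>\<^bsub>base\<^esub>, inv\<^bsub>H\<^esub> x)"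
    have c: "c \<in> carrier ?W" using x(1) by (simp add: c_def wreath_carrier)
    define q' where "q' = c \<otimes>\<^bsub>?W\<^esub> q \<otimes>\<^bsub>?W\<^esub> inv\<^bsub>?W\<^esub> c"
    have q': "q' \<in> carrier ?W" using q c by (simp add: q'_def)
    have "snd q' = snd c \<otimes>\<^bsub>H\<^esub> snd q \<otimes>\<^bsub>H\<^esub> inv\<^bsub>H\<^esub> snd c"
      using q c by (simp add: q'_def)
    also have "\<dots> = h" using x fh(3) by (simp add: c_def H.m_assoc) (simp add: H.m_assoc[symmetric])
    finally obtain f' where f': "q' = (f', h)" "f' \<in> carrier base"
      using q' by (cases q') (auto simp: wreath_carrier)
    have q_eq: "q = inv\<^bsub>?W\<^esub> c \<otimes>\<^bsub>?W\<^esub> q' \<otimes>\<^bsub>?W\<^esub> inv\<^bsub>?W\<^esub> (inv\<^bsub>?W\<^esub> c)"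
      using q c by (simp add: q'_def wreath.m_assoc) (simp add: wreath.m_assoc[symmetric])
    have "q' \<notin> conjugacy_class ?W p"
    proof
      assume "q' \<in> conjugacy_class ?W p"
      from wreath.conjugacy_class_conj[OF p this wreath.inv_closed[OF c]]
      have "q \<in> conjugacy_class ?W p" unfolding q_eq[symmetric] .
      then show False using q by simp
    qed
    then obtain N :: "nat monoid" and \<theta> where N: "group N" "finite (carrier N)" "\<theta> \<in> hom ?W N"
      "\<theta> q' \<notin> \<theta> ` conjugacy_class ?W p"
      using separate_conjugacy[OF fg css fh(3,2) f'(2)] f'(1) fh(1) by blast
    interpret theta: group_hom ?W N \<theta> using N(1,3)
      by (simp add: group_hom_def group_hom_axioms_def wreath.is_group)
    have "\<theta> q \<notin> \<theta> ` conjugacy_class ?W p"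
    proof
      assume "\<theta> q \<in> \<theta> ` conjugacy_class ?W p"
      then obtain r where r: "r \<in> conjugacy_class ?W p" "\<theta> q = \<theta> r" by auto
      have "r \<in> carrier ?W" using r(1) cls by auto
      then have "\<theta> q' = \<theta> (c \<otimes>\<^bsub>?W\<^esub> r \<otimes>\<^bsub>?W\<^esub> inv\<^bsub>?W\<^esub> c)"
        using q c r(2) by (simp add: q'_def)
      then show False using N(4) wreath.conjugacy_class_conj[OF p r(1) c] by blast
    qed
    then show ?thesis using N by blast
  qed
qed

end

section \<open>Cyclic subgroup separability\<close>

context abelian_wreath
begin

lemma shift_one: "f \<in> carrier base \<Longrightarrow> shift \<one>\<^bsub>H\<^esub> f = f"
  by (intro base_eqI shift_closed) (auto simp: shift_apply)

lemma embed_base_hom: "(\<lambda>u. (u, \<one>\<^bsub>H\<^esub>)) \<in> hom base (wreath_product G H)"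
  by (rule homI) (simp_all add: wreath_carrier wreath_mult shift_one)

lemma eval_hom: "y \<in> carrier H \<Longrightarrow> (\<lambda>u. u y) \<in> hom base G"
  by (rule homI) (auto simp: baseD mult_base)

text \<open>The base need not be finitely generated, but the functions supported in a fixed finite
  set lie in a finitely generated subgroup: the values are peeled off point by point.\<close>

lemma finite_support_generate:
  assumes S: "S \<subseteq> carrier G" "generate G S = carrier G"
    and E: "finite E" "E \<subseteq> carrier H"
    and f: "f \<in> carrier base" "{x \<in> carrier H. f x \<noteq> \<one>\<^bsub>G\<^esub>} \<subseteq> E"
  shows "f \<in> generate base (\<Union>y\<in>E. single y ` S)"
  using E f
proof (induction E arbitrary: f rule: finite_induct)
  case empty
  then have "f = \<one>\<^bsub>base\<^esub>"
    using base.one_closed by (intro base_eqI) (auto simp: one_base)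
  then show ?case using generate.one by metis
next
  case (insert y E)
  let ?X = "\<Union>y\<in>insert y E. single y ` S"
  have y: "y \<in> carrier H" using insert.prems(1) by simp
  have fy: "f y \<in> carrier G" using baseD[OF insert.prems(2) y] .
  have X: "?X \<subseteq> carrier base" using S(1) single_closed by auto
  interpret single: group_hom G base "single y" using single_hom by unfold_locales
  have "single y (f y) \<in> generate base (single y ` S)"
    using fy single.generate_img[OF S(1)] S(2) by auto
  then have 1: "single y (f y) \<in> generate base ?X"
    using base.mono_generate[of "single y ` S" ?X] by auto
  define g where "g = f \<otimes>\<^bsub>base\<^esub> inv\<^bsub>base\<^esub> single y (f y)"
  have s: "single y (f y) \<in> carrier base" by (rule single_closed[OF fy])
  have g: "g \<in> carrier base" using insert.prems(2) s by (simp add: g_def)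
  have gx: "g x = (if x = y then \<one>\<^bsub>G\<^esub> else f x)" if "x \<in> carrier H" for x
    using that y fy s baseD[OF insert.prems(2)] by (simp add: g_def mult_base inv_base) (simp add: single_def)
  have "{x \<in> carrier H. g x \<noteq> \<one>\<^bsub>G\<^esub>} \<subseteq> E"
    using insert.prems(3) gx by (auto split: if_splits)
  then have "g \<in> generate base (\<Union>y\<in>E. single y ` S)"
    using insert.prems(1) g by (intro insert.IH) auto
  then have 2: "g \<in> generate base ?X"
    using base.mono_generate[of "\<Union>y\<in>E. single y ` S" ?X] by auto
  have "f = g \<otimes>\<^bsub>base\<^esub> single y (f y)"
    using insert.prems(2) s by (simp add: g_def base.m_assoc)
  then show ?case using generate.eng[OF 2 1] by simp
qed

text \<open>A nontrivial \<open>h\<close> survives in a finite quotient of \<open>H\<close>.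
  Otherwise one nontrivial value \<open>f x\<close> survives in \<open>A\<close>, and injectivity of
  \<open>\<phi>\<close> on the support keeps other values from being multiplied to it.\<close>

lemma wreath_residually_finite:
  assumes fg: "finitely_generated_group G" and css: "cyclic_subgroup_separable H"
    and p: "p \<in> carrier (wreath_product G H)" "p \<noteq> \<one>\<^bsub>wreath_product G H\<^esub>"
  shows "\<exists>(N :: nat monoid) \<theta>. group N \<and> finite (carrier N) \<and>
    \<theta> \<in> hom (wreath_product G H) N \<and> \<theta> p \<noteq> \<one>\<^bsub>N\<^esub>"
proof -
  let ?W = "wreath_product G H"
  obtain f h where fh: "p = (f, h)" "f \<in> carrier base" "h \<in> carrier H"
    using p(1) by (auto simp: wreath_carrier)
  let ?E = "{x \<in> carrier H. f x \<noteq> \<one>\<^bsub>G\<^esub>}"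
  have E: "finite ?E" "?E \<subseteq> carrier H" using base_finite[OF fh(2)] by auto
  obtain K :: "nat monoid" and \<phi> where K: "group K" "finite (carrier K)" "\<phi> \<in> hom H K" "inj_on \<phi> ?E"
    and sep: "h \<noteq> \<one>\<^bsub>H\<^esub> \<Longrightarrow> \<phi> h \<noteq> \<one>\<^bsub>K\<^esub>"
    using exists_quotient_H[OF css H.one_closed E, of "{h}"] fh(3) by auto
  show ?thesis
  proof (cases "h = \<one>\<^bsub>H\<^esub>")
    case False
    then have "(\<phi> \<circ> snd) p \<noteq> \<one>\<^bsub>K\<^esub>" using sep fh(1) by simp
    then show ?thesis using K hom_compose[OF snd_hom K(3)] by blast
  next
    case True
    have "\<exists>x\<in>carrier H. f x \<noteq> \<one>\<^bsub>G\<^esub>"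
    proof (rule ccontr)
      assume "\<not> ?thesis"
      then have "f = \<one>\<^bsub>base\<^esub>" using fh(2) base.one_closed by (intro base_eqI) (auto simp: one_base)
      then show False using p(2) True fh(1) by (simp add: wreath_one)
    qed
    then obtain x where x: "x \<in> carrier H" "f x \<noteq> \<one>\<^bsub>G\<^esub>" by blast
    obtain A :: "'a set monoid" and \<psi> where A: "comm_group A" "finite (carrier A)" "\<psi> \<in> hom G A"
      and psi: "\<psi> (f x) \<noteq> \<one>\<^bsub>A\<^esub>"
      using G.finite_quotient_separating[OF fg, of "{f x}"] baseD[OF fh(2) x(1)] x(2) by auto
    interpret M: wreath_map G H A K \<psi> \<phi>
      by (intro wreath_map.intro wreath_map_axioms.intro abelian_wreath.intro)
        (use K A G.comm_group_axioms H.is_group in auto)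
    have "x \<in> ?E" using x by simp
    from M.push_apply[OF fh(2) order_refl E(2) K(4) this] psi
    have push_x: "M.push f (\<phi> x) \<noteq> \<one>\<^bsub>A\<^esub>" by simp
    have "M.push f \<noteq> \<one>\<^bsub>M.T.base\<^esub>"
    proof
      assume "M.push f = \<one>\<^bsub>M.T.base\<^esub>"
      then have "M.push f (\<phi> x) = \<one>\<^bsub>A\<^esub>" using x(1) by (simp add: M.T.one_base)
      then show False using push_x by contradiction
    qed
    then have ne: "M.wmap p \<noteq> \<one>\<^bsub>wreath_product A K\<^esub>"
      by (simp add: fh(1) M.wmap_def M.T.wreath_one)
    interpret wmap: group_hom ?W "wreath_product A K" M.wmap
      using M.wmap_hom by unfold_locales
    have "\<exists>(N :: nat monoid) \<theta>. group N \<and> finite (carrier N) \<and> \<theta> \<in> hom ?W N \<and> \<theta> p \<notin> \<theta> ` {\<one>\<^bsub>?W\<^esub>}"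
      by (rule nat_quotientI[OF _ _ M.wmap_hom _ p(1)])
        (use ne M.T.finite_wreath K A M.T.wreath.is_group in auto)
    then obtain N :: "nat monoid" and \<theta> where N: "group N" "finite (carrier N)" "\<theta> \<in> hom ?W N"
      "\<theta> p \<notin> \<theta> ` {\<one>\<^bsub>?W\<^esub>}" by blast
    then have "\<theta> p \<noteq> \<one>\<^bsub>N\<^esub>" using hom_one[OF N(3) wreath.is_group N(1)] by simp
    then show ?thesis using N by blast
  qed
qed

text \<open>The support is finite and invariant under \<open>h\<close>, so a point of it has a
  finite orbit under the powers of \<open>h\<close>; left translation acts freely, hence two
  different powers coincide.\<close>

lemma finite_order_of_shift_invariant:
  assumes f: "f \<in> carrier base" "f \<noteq> \<one>\<^bsub>base\<^esub>" and h: "h \<in> carrier H" and inv: "shift h f = f"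
  shows "H.ord h > 0"
proof -
  have "\<exists>x\<in>carrier H. f x \<noteq> \<one>\<^bsub>G\<^esub>"
  proof (rule ccontr)
    assume "\<not> ?thesis"
    then have "f = \<one>\<^bsub>base\<^esub>" using f(1) base.one_closed by (intro base_eqI) (auto simp: one_base)
    then show False using f(2) by simp
  qed
  then obtain x where x: "x \<in> carrier H" "f x \<noteq> \<one>\<^bsub>G\<^esub>" by blast
  let ?g = "inv\<^bsub>H\<^esub> h" and ?E = "{x \<in> carrier H. f x \<noteq> \<one>\<^bsub>G\<^esub>}"
  have step: "f (?g \<otimes>\<^bsub>H\<^esub> y) = f y" if "y \<in> carrier H" for y
    using shift_apply[OF that, of h f] inv by simp
  have "f (?g [^]\<^bsub>H\<^esub> n \<otimes>\<^bsub>H\<^esub> x) = f x" for n :: nat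
  proof (induction n)
    case (Suc n)
    have "?g [^]\<^bsub>H\<^esub> Suc n \<otimes>\<^bsub>H\<^esub> x = ?g \<otimes>\<^bsub>H\<^esub> (?g [^]\<^bsub>H\<^esub> n \<otimes>\<^bsub>H\<^esub> x)"
      using h x(1) by (simp only: H.nat_pow_Suc2 H.m_assoc H.inv_closed H.nat_pow_closed)
    then show ?case using step[of "?g [^]\<^bsub>H\<^esub> n \<otimes>\<^bsub>H\<^esub> x"] Suc.IH h x(1) by simp
  qed (use x in simp)
  then have "range (\<lambda>n::nat. ?g [^]\<^bsub>H\<^esub> n \<otimes>\<^bsub>H\<^esub> x) \<subseteq> ?E" using h x by auto
  then have "finite (range (\<lambda>n::nat. ?g [^]\<^bsub>H\<^esub> n \<otimes>\<^bsub>H\<^esub> x))"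
    using base_finite[OF f(1)] by (rule finite_subset)
  then have "\<not> inj (\<lambda>n::nat. ?g [^]\<^bsub>H\<^esub> n \<otimes>\<^bsub>H\<^esub> x)" using finite_imageD infinite_UNIV_nat by blast
  then obtain m n :: nat where mn: "m \<noteq> n" "?g [^]\<^bsub>H\<^esub> m \<otimes>\<^bsub>H\<^esub> x = ?g [^]\<^bsub>H\<^esub> n \<otimes>\<^bsub>H\<^esub> x"
    by (auto simp: inj_def)
  then have "?g [^]\<^bsub>H\<^esub> m = ?g [^]\<^bsub>H\<^esub> n" using h x(1) H.r_cancel by auto
  then have "h [^]\<^bsub>H\<^esub> m = h [^]\<^bsub>H\<^esub> n"
    using h H.nat_pow_inv[OF h] H.inv_inv H.nat_pow_closed[OF h] by metis
  \<comment> \<open>Subtraction on \<open>nat\<close> truncates: one of the exponents is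
    \<open>0\<close> and the other is positive. Keeping both avoids deciding which of
    \<open>m\<close> and \<open>n\<close> is larger.\<close>
  then have "h [^]\<^bsub>H\<^esub> (m - n) = \<one>\<^bsub>H\<^esub>" "h [^]\<^bsub>H\<^esub> (n - m) = \<one>\<^bsub>H\<^esub>"
    using H.pow_eq_div2[OF h] by auto
  then have "H.ord h dvd m - n" "H.ord h dvd n - m" using H.pow_eq_id[OF h] by auto
  then show ?thesis using mn(1) by (cases "H.ord h = 0") auto
qed

text \<open>With o the order of \<open>h\<close>, the o-th power of \<open>(f, h)\<close> is some
  \<open>(d, \<one>)\<close> in the base. The quotient keeps the order of \<open>h\<close>, so only
  multiples of o can hit the image of \<open>(f0, \<one>)\<close>. What remains is the cyclic group
  of \<open>d\<close>, which separation by powers keeps away from \<open>f0\<close>.\<close>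

lemma separate_cyclic_base:
  assumes fg: "finitely_generated_group G" and css: "cyclic_subgroup_separable H"
    and h: "h \<in> carrier H" "H.ord h > 0" and f: "f \<in> carrier base" and f0: "f0 \<in> carrier base"
    and notin: "(f0, \<one>\<^bsub>H\<^esub>) \<notin> generate (wreath_product G H) {(f, h)}"
  shows "\<exists>(N :: nat monoid) \<theta>. group N \<and> finite (carrier N) \<and> \<theta> \<in> hom (wreath_product G H) N \<and>
    \<theta> (f0, \<one>\<^bsub>H\<^esub>) \<notin> \<theta> ` generate (wreath_product G H) {(f, h)}"
proof -
  let ?W = "wreath_product G H" and ?o = "H.ord h" and ?p = "(f, h)"
  have p: "?p \<in> carrier ?W" using f h by (simp add: wreath_carrier)
  interpret snd: group_hom ?W H snd using snd_hom by unfold_locales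
  interpret emb: group_hom base ?W "\<lambda>u. (u, \<one>\<^bsub>H\<^esub>)" using embed_base_hom by unfold_locales
  have "snd (?p [^]\<^bsub>?W\<^esub> ?o) = \<one>\<^bsub>H\<^esub>"
    using snd.hom_nat_pow[OF p] h(1) by (simp add: H.pow_ord_eq_1)
  moreover have "?p [^]\<^bsub>?W\<^esub> ?o \<in> carrier ?W" using p by simp
  ultimately obtain d where d: "?p [^]\<^bsub>?W\<^esub> ?o = (d, \<one>\<^bsub>H\<^esub>)" "d \<in> carrier base"
    by (cases "?p [^]\<^bsub>?W\<^esub> ?o") (auto simp: wreath_carrier)
  have pow: "?p [^]\<^bsub>?W\<^esub> (int ?o * s) = (d [^]\<^bsub>base\<^esub> s, \<one>\<^bsub>H\<^esub>)" for s :: int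
  proof -
    have "?p [^]\<^bsub>?W\<^esub> (int ?o * s) = (?p [^]\<^bsub>?W\<^esub> ?o) [^]\<^bsub>?W\<^esub> s"
      using wreath.int_pow_pow[OF p, of "int ?o" s] by (simp add: int_pow_int)
    also have "\<dots> = (d [^]\<^bsub>base\<^esub> s, \<one>\<^bsub>H\<^esub>)"
      unfolding d(1) using emb.hom_int_pow[OF d(2)] by simp
    finally show ?thesis .
  qed
  have d_notin: "f0 \<notin> generate base {d}"
  proof
    assume "f0 \<in> generate base {d}"
    then obtain s :: int where "f0 = d [^]\<^bsub>base\<^esub> s" using base.generate_pow[OF d(2)] by auto
    then have "(f0, \<one>\<^bsub>H\<^esub>) = ?p [^]\<^bsub>?W\<^esub> (int ?o * s)" using pow by simp
    then show False using notin wreath.generate_pow[OF p] by auto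
  qed
  define E where "E = {x \<in> carrier H. f0 x \<noteq> \<one>\<^bsub>G\<^esub>} \<union> {x \<in> carrier H. d x \<noteq> \<one>\<^bsub>G\<^esub>}"
  have E: "finite E" "E \<subseteq> carrier H" using base_finite[OF f0] base_finite[OF d(2)] by (auto simp: E_def)
  \<comment> \<open>These powers of \<open>h\<close>, except the one for \<open>j = 0\<close>, must
    stay nontrivial, so that the image of \<open>h\<close> has the same order as
    \<open>h\<close>.\<close>
  define Z where "Z = (\<lambda>j. h [^]\<^bsub>H\<^esub> j) ` {..<?o}"
  have Z: "finite Z" "Z \<subseteq> carrier H" using h(1) by (auto simp: Z_def)
  obtain K :: "nat monoid" and \<phi> where K: "group K" "finite (carrier K)" "\<phi> \<in> hom H K" "inj_on \<phi> E"
    and sepZ: "\<And>z. z \<in> Z \<Longrightarrow> z \<noteq> \<one>\<^bsub>H\<^esub> \<Longrightarrow> \<phi> z \<noteq> \<one>\<^bsub>K\<^esub>"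
    using exists_quotient_H[OF css h(1) E Z] by auto
  obtain S where S: "S \<subseteq> carrier G" "finite S" "generate G S = carrier G"
    using fg by (auto simp: finitely_generated_group_def)
  let ?X = "\<Union>y\<in>E. single y ` S"
  have "finite ?X" "?X \<subseteq> carrier base" using E(1) S single_closed by auto
  from base.cyclic_subgroup_separated_by_powers[OF this d(2) d_notin]
  obtain n :: nat where n: "n > 0" and
    n_sep: "\<And>t::int. \<And>x. x \<in> generate base ?X \<Longrightarrow> f0 \<noteq> d [^]\<^bsub>base\<^esub> t \<otimes>\<^bsub>base\<^esub> x [^]\<^bsub>base\<^esub> n"
    by blast
  obtain A :: "'a set monoid" and \<psi> where A: "comm_group A" "finite (carrier A)" "\<psi> \<in> hom G A"
    and ker: "\<And>g. g \<in> carrier G \<Longrightarrow> \<psi> g = \<one>\<^bsub>A\<^esub> \<Longrightarrow> \<exists>x\<in>carrier G. g = x [^]\<^bsub>G\<^esub> n"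
    using G.finite_power_quotient[OF fg n] by blast
  interpret M: wreath_map G H A K \<psi> \<phi>
    by (intro wreath_map.intro wreath_map_axioms.intro abelian_wreath.intro)
      (use K A G.comm_group_axioms H.is_group in auto)
  have "M.wmap (f0, \<one>\<^bsub>H\<^esub>) \<notin> M.wmap ` generate ?W {?p}"
  proof
    assume "M.wmap (f0, \<one>\<^bsub>H\<^esub>) \<in> M.wmap ` generate ?W {?p}"
    then obtain t :: int where t: "M.wmap (f0, \<one>\<^bsub>H\<^esub>) = M.wmap (?p [^]\<^bsub>?W\<^esub> t)"
      using wreath.generate_pow[OF p] by auto
    have snd_wmap: "snd (M.wmap r) = \<phi> (snd r)" for r by (simp add: M.wmap_def split: prod.split)
    define j where "j = nat (t mod int ?o)"
    have j: "j < ?o" "int j = t mod int ?o" using h(2) by (simp_all add: j_def nat_less_iff)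
    have "h [^]\<^bsub>H\<^esub> (int ?o * (t div int ?o) + int j) = h [^]\<^bsub>H\<^esub> j"
    proof -
      have "h [^]\<^bsub>H\<^esub> (int ?o * (t div int ?o)) = \<one>\<^bsub>H\<^esub>"
        using H.int_pow_pow[OF h(1), of "int ?o" "t div int ?o"] h(1)
        by (simp add: int_pow_int H.pow_ord_eq_1)
      then show ?thesis using h(1) by (simp add: H.int_pow_mult int_pow_int)
    qed
    moreover have "int ?o * (t div int ?o) + int j = t" using j(2) by simp
    moreover have "snd (?p [^]\<^bsub>?W\<^esub> t) = h [^]\<^bsub>H\<^esub> t" using snd.hom_int_pow[OF p] by simp
    ultimately have "snd (?p [^]\<^bsub>?W\<^esub> t) = h [^]\<^bsub>H\<^esub> j" by simp
    then have "\<phi> (h [^]\<^bsub>H\<^esub> j) = \<one>\<^bsub>K\<^esub>"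
      using arg_cong[OF t, of snd] unfolding snd_wmap by simp
    then have "h [^]\<^bsub>H\<^esub> j = \<one>\<^bsub>H\<^esub>" using sepZ[of "h [^]\<^bsub>H\<^esub> j"] j(1) by (auto simp: Z_def)
    then have "j = 0" using H.pow_eq_id[OF h(1)] j(1) by (auto dest: nat_dvd_not_less)
    define s where "s = t div int ?o"
    have "int ?o dvd t" using j(2) \<open>j = 0\<close> by (simp add: dvd_eq_mod_eq_0)
    then have "t = int ?o * s" by (simp add: s_def)
    then have push_eq: "M.push f0 = M.push (d [^]\<^bsub>base\<^esub> s)" using t pow by (simp add: M.wmap_def)
    define e where "e = d [^]\<^bsub>base\<^esub> s"
    have e: "e \<in> carrier base" using d(2) by (simp add: e_def)
    have e_apply: "e y = (d y) [^]\<^bsub>G\<^esub> s" if "y \<in> carrier H" for y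
    proof -
      interpret ev: group_hom base G "\<lambda>u. u y" using eval_hom[OF that] by unfold_locales
      show ?thesis unfolding e_def by (rule ev.hom_int_pow[OF d(2)])
    qed
    have supp: "{x \<in> carrier H. f0 x \<noteq> \<one>\<^bsub>G\<^esub>} \<subseteq> E" "{x \<in> carrier H. e x \<noteq> \<one>\<^bsub>G\<^esub>} \<subseteq> E"
      by (auto simp: E_def e_apply)
    \<comment> \<open>Equal push-forwards have equal values at the images of the points of
      \<open>E\<close>, so there \<open>f0\<close> and \<open>e\<close> differ by an element of the
      kernel of \<open>\<psi>\<close>, an \<open>n\<close>-th power.\<close>
    have "\<exists>x\<in>carrier G. f0 y \<otimes>\<^bsub>G\<^esub> inv\<^bsub>G\<^esub> e y = x [^]\<^bsub>G\<^esub> n" if y: "y \<in> E" for y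
    proof (rule ker)
      have yc: "f0 y \<in> carrier G" "e y \<in> carrier G" using y E(2) f0 e baseD by auto
      then show "f0 y \<otimes>\<^bsub>G\<^esub> inv\<^bsub>G\<^esub> e y \<in> carrier G" by simp
      have "\<psi> (f0 y) = \<psi> (e y)"
        using M.push_apply[OF f0 supp(1) E(2) K(4) y] M.push_apply[OF e supp(2) E(2) K(4) y] push_eq
        by (simp add: e_def)
      then show "\<psi> (f0 y \<otimes>\<^bsub>G\<^esub> inv\<^bsub>G\<^esub> e y) = \<one>\<^bsub>A\<^esub>" using yc by simp
    qed
    then obtain r where r: "\<And>y. y \<in> E \<Longrightarrow> r y \<in> carrier G"
      "\<And>y. y \<in> E \<Longrightarrow> f0 y \<otimes>\<^bsub>G\<^esub> inv\<^bsub>G\<^esub> e y = r y [^]\<^bsub>G\<^esub> n" by metis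
    \<comment> \<open>The pointwise \<open>n\<close>-th roots form one function, with value \<one>
      off \<open>E\<close>, where \<open>f0\<close> and \<open>e\<close> are both trivial.\<close>
    define x where "x = (\<lambda>y\<in>carrier H. if y \<in> E then r y else \<one>\<^bsub>G\<^esub>)"
    have "finite {y \<in> carrier H. x y \<noteq> \<one>\<^bsub>G\<^esub>}"
      by (rule finite_subset[OF _ E(1)]) (auto simp: x_def split: if_splits)
    moreover have "x \<in> carrier H \<rightarrow>\<^sub>E carrier G" using r(1) by (auto simp: x_def)
    ultimately have x: "x \<in> carrier base" by (simp add: base_iff)
    have "x \<in> generate base ?X"
      by (rule finite_support_generate[OF S(1,3) E x]) (auto simp: x_def)
    moreover have "f0 = e \<otimes>\<^bsub>base\<^esub> x [^]\<^bsub>base\<^esub> n"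
    proof (rule base_eqI[OF f0])
      fix y assume y: "y \<in> carrier H"
      interpret ev: group_hom base G "\<lambda>u. u y" using eval_hom[OF y] by unfold_locales
      have xn: "(x [^]\<^bsub>base\<^esub> n) y = x y [^]\<^bsub>G\<^esub> n" by (rule ev.hom_nat_pow[OF x])
      have yc: "f0 y \<in> carrier G" "e y \<in> carrier G" using y f0 e baseD by auto
      show "f0 y = (e \<otimes>\<^bsub>base\<^esub> x [^]\<^bsub>base\<^esub> n) y"
      proof (cases "y \<in> E")
        case True
        then have "x y [^]\<^bsub>G\<^esub> n = f0 y \<otimes>\<^bsub>G\<^esub> inv\<^bsub>G\<^esub> e y" using r(2) y by (simp add: x_def)
        then show ?thesis using y yc xn by (simp add: mult_base G.m_comm[of "e y"] G.m_assoc)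
      next
        case False
        then have "f0 y = \<one>\<^bsub>G\<^esub>" "e y = \<one>\<^bsub>G\<^esub>" "x y = \<one>\<^bsub>G\<^esub>"
          using supp y by (auto simp: x_def)
        then show ?thesis using y xn by (simp add: mult_base)
      qed
    qed (use e x in simp)
    ultimately show False using n_sep[of x s] by (simp add: e_def)
  qed
  then show ?thesis
    by (intro nat_quotientI[OF _ _ M.wmap_hom])
      (use M.T.finite_wreath K A M.T.wreath.is_group f0 wreath.generate_incl[of "{?p}"] p in \<open>auto simp: wreath_carrier\<close>)
qed

theorem cyclic_subgroup_separable_wreath:
  assumes fg: "finitely_generated_group G" and css: "cyclic_subgroup_separable H"
  shows "cyclic_subgroup_separable (wreath_product G H)"
  unfolding cyclic_subgroup_separable_def separable_in_def
proof (intro ballI)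
  let ?W = "wreath_product G H"
  fix p q assume p: "p \<in> carrier ?W" and q: "q \<in> carrier ?W - generate ?W {p}"
  interpret snd: group_hom ?W H snd using snd_hom by unfold_locales
  obtain f h where fh: "p = (f, h)" "f \<in> carrier base" "h \<in> carrier H"
    using p by (auto simp: wreath_carrier)
  have sub: "subgroup (generate ?W {p}) ?W" using wreath.generate_is_subgroup[of "{p}"] p by simp
  have pgen: "p \<in> generate ?W {p}" by (rule generate.incl) simp
  have snd_img: "snd ` generate ?W {p} = generate H {h}"
    using snd.generate_img[of "{p}"] p fh(1) by simp
  show "\<exists>(Q :: nat monoid) \<phi>. group Q \<and> finite (carrier Q) \<and> \<phi> \<in> hom ?W Q \<and>
      \<phi> q \<notin> \<phi> ` generate ?W {p}"
  proof (cases "snd q \<in> generate H {h}")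
    case False
    then have "snd q \<in> carrier H - generate H {h}" using q snd.hom_closed by blast
    moreover have "separable_in H (generate H {h})"
      using css fh(3) by (simp add: cyclic_subgroup_separable_def)
    ultimately obtain Q :: "nat monoid" and \<phi> where Q: "group Q" "finite (carrier Q)" "\<phi> \<in> hom H Q"
      "\<phi> (snd q) \<notin> \<phi> ` generate H {h}"
      unfolding separable_in_def by blast
    have "(\<phi> \<circ> snd) q \<notin> (\<phi> \<circ> snd) ` generate ?W {p}"
      using Q(4) unfolding image_comp[symmetric] snd_img by simp
    then show ?thesis using Q hom_compose[OF snd_hom Q(3)] by blast
  next
    case True
    \<comment> \<open>Dividing by an element of the cyclic subgroup with the same top component
      reduces the problem to an element of the base.\<close>
    then obtain c where c: "c \<in> generate ?W {p}" "snd q = snd c" using snd_img by force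
    have cW: "c \<in> carrier ?W" using c(1) subgroup.subset[OF sub] by blast
    define q0 where "q0 = q \<otimes>\<^bsub>?W\<^esub> inv\<^bsub>?W\<^esub> c"
    have q0: "q0 \<in> carrier ?W" using q cW by (simp add: q0_def)
    have "snd q0 = \<one>\<^bsub>H\<^esub>" using q cW c(2) by (simp add: q0_def)
    then obtain f0 where f0: "q0 = (f0, \<one>\<^bsub>H\<^esub>)" "f0 \<in> carrier base"
      using q0 by (cases q0) (auto simp: wreath_carrier)
    have q0_notin: "q0 \<notin> generate ?W {p}"
    proof
      assume "q0 \<in> generate ?W {p}"
      then have "q0 \<otimes>\<^bsub>?W\<^esub> c \<in> generate ?W {p}" using c(1) sub subgroup.m_closed by metis
      moreover have "q0 \<otimes>\<^bsub>?W\<^esub> c = q" using q cW by (simp add: q0_def wreath.m_assoc)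
      ultimately show False using q by simp
    qed
    have "\<exists>(N :: nat monoid) \<theta>. group N \<and> finite (carrier N) \<and> \<theta> \<in> hom ?W N \<and>
        \<theta> q0 \<notin> \<theta> ` generate ?W {p}"
    proof (cases "p \<otimes>\<^bsub>?W\<^esub> q0 = q0 \<otimes>\<^bsub>?W\<^esub> p")
      case False
      \<comment> \<open>If the image of \<open>q0\<close> lay in the image of the cyclic subgroup,
        it would commute with the image of \<open>p\<close>. So a finite quotient in which this
        commutator survives is enough.\<close>
      define k where "k = (p \<otimes>\<^bsub>?W\<^esub> q0) \<otimes>\<^bsub>?W\<^esub> inv\<^bsub>?W\<^esub> (q0 \<otimes>\<^bsub>?W\<^esub> p)"
      have k: "k \<in> carrier ?W" using p q0 by (simp add: k_def)
      have "k \<noteq> \<one>\<^bsub>?W\<^esub>"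
        using False p q0 wreath.inv_solve_right'[of "\<one>\<^bsub>?W\<^esub>" "p \<otimes>\<^bsub>?W\<^esub> q0" "q0 \<otimes>\<^bsub>?W\<^esub> p"]
        by (simp add: k_def)
      from wreath_residually_finite[OF fg css k this]
      obtain N :: "nat monoid" and \<theta> where N: "group N" "finite (carrier N)" "\<theta> \<in> hom ?W N"
        "\<theta> k \<noteq> \<one>\<^bsub>N\<^esub>" by blast
      interpret theta: group_hom ?W N \<theta> using N(1,3)
        by (simp add: group_hom_def group_hom_axioms_def wreath.is_group)
      have "\<theta> q0 \<notin> \<theta> ` generate ?W {p}"
      proof
        assume "\<theta> q0 \<in> \<theta> ` generate ?W {p}"
        then obtain r where r: "r \<in> generate ?W {p}" "\<theta> q0 = \<theta> r" by auto
        have rW: "r \<in> carrier ?W" using r(1) subgroup.subset[OF sub] by blast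
        have "p \<otimes>\<^bsub>?W\<^esub> r = r \<otimes>\<^bsub>?W\<^esub> p" by (rule wreath.commute_generate[OF p p refl r(1)])
        then have "\<theta> (p \<otimes>\<^bsub>?W\<^esub> r) = \<theta> (r \<otimes>\<^bsub>?W\<^esub> p)" by simp
        then have "\<theta> p \<otimes>\<^bsub>N\<^esub> \<theta> r = \<theta> r \<otimes>\<^bsub>N\<^esub> \<theta> p" using p rW by simp
        then have "\<theta> k = \<one>\<^bsub>N\<^esub>" using p q0 rW r(2) by (simp add: k_def)
        then show False using N(4) by simp
      qed
      then show ?thesis using N by blast
    next
      case True
      \<comment> \<open>The base components of both products are compared: commuting with
        \<open>p\<close> makes \<open>f0\<close> invariant under \<open>h\<close>.\<close>
      then have "f \<otimes>\<^bsub>base\<^esub> shift h f0 = f0 \<otimes>\<^bsub>base\<^esub> f"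
        using f0(1) fh(1,2) by (simp add: wreath_mult shift_one)
      then have "f \<otimes>\<^bsub>base\<^esub> shift h f0 = f \<otimes>\<^bsub>base\<^esub> f0" using base.m_comm f0(2) fh(2) by simp
      then have inv: "shift h f0 = f0"
        by (rule base.l_cancel) (use f0(2) fh(2,3) shift_closed in auto)
      have "q0 \<noteq> \<one>\<^bsub>?W\<^esub>" using q0_notin generate.one[of ?W "{p}"] by metis
      then have "f0 \<noteq> \<one>\<^bsub>base\<^esub>" using f0(1) by (auto simp: wreath_one)
      then have "H.ord h > 0" by (rule finite_order_of_shift_invariant[OF f0(2) _ fh(3) inv])
      from separate_cyclic_base[OF fg css fh(3) this fh(2) f0(2)] q0_notin
      show ?thesis unfolding f0(1) fh(1) by blast
    qed
    then obtain N :: "nat monoid" and \<theta> where N: "group N" "finite (carrier N)" "\<theta> \<in> hom ?W N"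
      "\<theta> q0 \<notin> \<theta> ` generate ?W {p}" by blast
    interpret theta: group_hom ?W N \<theta> using N(1,3)
      by (simp add: group_hom_def group_hom_axioms_def wreath.is_group)
    have "\<theta> q \<notin> \<theta> ` generate ?W {p}"
    proof
      assume "\<theta> q \<in> \<theta> ` generate ?W {p}"
      then obtain r where r: "r \<in> generate ?W {p}" "\<theta> q = \<theta> r" by auto
      have rW: "r \<in> carrier ?W" using r(1) subgroup.subset[OF sub] by blast
      have "\<theta> q0 = \<theta> (r \<otimes>\<^bsub>?W\<^esub> inv\<^bsub>?W\<^esub> c)" using q cW rW r(2) by (simp add: q0_def)
      moreover have "r \<otimes>\<^bsub>?W\<^esub> inv\<^bsub>?W\<^esub> c \<in> generate ?W {p}"
        using r(1) c(1) sub by (meson subgroup.m_closed subgroup.m_inv_closed)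
      ultimately show False using N(4) by blast
    qed
    then show ?thesis using N by blast
  qed
qed

end

section \<open>Equations without finite subsystems\<close>

lemma (in group) word_eval_surj:
  assumes g: "g \<in> {1..m} \<rightarrow> carrier G" and x: "x \<in> generate G (g ` {1..m})"
  shows "\<exists>w\<in>carrier (free_group m). word_eval G g w = x"
proof -
  interpret ev: group_hom "free_group m" G "word_eval G g"
    using word_eval_hom[OF g] group_free_group by (simp add: group_hom_def group_hom_axioms_def is_group)
  have "g ` {1..m} \<subseteq> word_eval G g ` carrier (free_group m)"
  proof (rule image_subsetI)
    fix i assume i: "i \<in> {1..m}"
    have "[(i, True)] \<in> carrier (free_group m)" using i by (simp add: free_group_def reduced_Cons)
    then show "g i \<in> word_eval G g ` carrier (free_group m)"
      using word_eval_generator[OF g i] by (metis imageI)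
  qed
  then have "generate G (g ` {1..m}) \<subseteq> word_eval G g ` carrier (free_group m)"
    using ev.img_is_subgroup by (rule generate_subgroup_incl)
  then show ?thesis using x by auto
qed

lemma word_eval_cong:
  "(\<And>i. i \<in> fst ` set w \<Longrightarrow> g i = g' i) \<Longrightarrow> word_eval G g w = word_eval G g' w"
proof (induction w)
  case (Cons a w)
  then show ?case by (cases a) (simp add: word_eval_Cons)
qed simp

lemma free_group_mono: "m \<le> n \<Longrightarrow> carrier (free_group m) \<subseteq> carrier (free_group n)"
  by (auto simp: free_group_def)

definition commutator_word :: "nat \<Rightarrow> nat \<Rightarrow> letter list \<Rightarrow> letter list"
  where "commutator_word n i w =
    ([(i, True)] \<otimes>\<^bsub>free_group n\<^esub> w) \<otimes>\<^bsub>free_group n\<^esub> inv\<^bsub>free_group n\<^esub> (w \<otimes>\<^bsub>free_group n\<^esub> [(i, True)])"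

lemma commutator_word_closed:
  assumes "i \<in> {1..n}" "w \<in> carrier (free_group n)"
  shows "commutator_word n i w \<in> carrier (free_group n)"
proof -
  interpret F: group "free_group n" by (rule group_free_group)
  have "[(i, True)] \<in> carrier (free_group n)" using assms(1) by (simp add: free_group_def reduced_Cons)
  then show ?thesis using assms(2) by (simp add: commutator_word_def)
qed

lemma (in group) word_eval_commutator_word:
  assumes g: "g \<in> {1..n} \<rightarrow> carrier G" and i: "i \<in> {1..n}" and w: "w \<in> carrier (free_group n)"
  shows "word_eval G g (commutator_word n i w) = \<one> \<longleftrightarrow>
    g i \<otimes> word_eval G g w = word_eval G g w \<otimes> g i"
proof -
  interpret ev: group_hom "free_group n" G "word_eval G g"
    using word_eval_hom[OF g] group_free_group by (simp add: group_hom_def group_hom_axioms_def is_group)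
  have x: "[(i, True)] \<in> carrier (free_group n)" using i by (simp add: free_group_def reduced_Cons)
  have ewc: "word_eval G g w \<in> carrier G" using w by simp
  have gi: "g i \<in> carrier G" using g i by auto
  have "word_eval G g (commutator_word n i w) =
      (g i \<otimes> word_eval G g w) \<otimes> inv (word_eval G g w \<otimes> g i)"
    using x w word_eval_generator[OF g i] by (simp add: commutator_word_def)
  then show ?thesis
    using ewc gi inv_solve_right'[of \<one> "g i \<otimes> word_eval G g w" "word_eval G g w \<otimes> g i"] by simp
qed

text \<open>Equations have no coefficients, so the elements \<open>w t\<close> enter as words in
  \<open>m\<close> auxiliary variables, which are specialised to \<open>b\<close>; one more variable
  has to commute with them. A finite subsystem involves only a finite \<open>F\<close>, and the
  given \<open>x\<close> solves it without solving the whole system.\<close>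

lemma (in group) not_equationally_noetherianI:
  fixes T :: "'i set" and b :: "nat \<Rightarrow> 'a"
  assumes b: "b \<in> {1..m} \<rightarrow> carrier G"
    and w: "\<And>t. t \<in> T \<Longrightarrow> w t \<in> generate G (b ` {1..m})"
    and x: "\<And>F. finite F \<Longrightarrow> F \<subseteq> T \<Longrightarrow> \<exists>x\<in>carrier G. (\<forall>t\<in>F. x \<otimes> w t = w t \<otimes> x) \<and>
      (\<exists>t\<in>T. x \<otimes> w t \<noteq> w t \<otimes> x)"
  shows "\<not> equationally_noetherian G"
proof
  assume noeth: "equationally_noetherian G"
  let ?n = "Suc m"
  have "\<forall>t\<in>T. \<exists>v\<in>carrier (free_group m). word_eval G b v = w t"
    using word_eval_surj[OF b w] by blast
  then obtain v where v: "\<And>t. t \<in> T \<Longrightarrow> v t \<in> carrier (free_group m)"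
      "\<And>t. t \<in> T \<Longrightarrow> word_eval G b (v t) = w t" by metis
  define s where "s = (\<lambda>t. commutator_word ?n ?n (v t))"
  have vn: "v t \<in> carrier (free_group ?n)" if "t \<in> T" for t
    using free_group_mono[of m ?n] v(1)[OF that] by auto
  have "s ` T \<subseteq> carrier (free_group ?n)"
    using commutator_word_closed[of ?n ?n] vn by (auto simp: s_def)
  then obtain S0 where S0: "S0 \<subseteq> s ` T" "finite S0" "solution_set G ?n S0 = solution_set G ?n (s ` T)"
    using noeth unfolding equationally_noetherian_def by (metis le_add1 plus_1_eq_Suc)
  obtain F where F: "F \<subseteq> T" "finite F" "S0 = s ` F" using finite_subset_image[OF S0(2,1)] by blast
  obtain y where y: "y \<in> carrier G" "\<And>t. t \<in> F \<Longrightarrow> y \<otimes> w t = w t \<otimes> y"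
    "\<exists>t\<in>T. y \<otimes> w t \<noteq> w t \<otimes> y" using x[OF F(2,1)] by blast
  \<comment> \<open>The first \<open>m\<close> variables receive the parameters \<open>b\<close> and
    the variable with index \<open>Suc m\<close> receives \<open>y\<close>. The words
    \<open>v t\<close> do not contain the latter, so their values are unchanged.\<close>
  define g where "g = (\<lambda>i\<in>{1..?n}. if i = ?n then y else b i)"
  have g: "g \<in> {1..?n} \<rightarrow>\<^sub>E carrier G" using b y(1) by (auto simp: g_def)
  have sol: "word_eval G g (s t) = \<one> \<longleftrightarrow> y \<otimes> w t = w t \<otimes> y" if t: "t \<in> T" for t
  proof -
    have "word_eval G g (v t) = word_eval G b (v t)"
    proof (rule word_eval_cong)
      fix i assume "i \<in> fst ` set (v t)"
      then have "i \<in> {1..m}" using v(1)[OF t] by (auto simp: free_group_def)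
      then show "g i = b i" by (simp add: g_def)
    qed
    then have "word_eval G g (v t) = w t" using v(2)[OF t] by simp
    moreover have "g \<in> {1..?n} \<rightarrow> carrier G" using g by auto
    ultimately show ?thesis
      unfolding s_def using word_eval_commutator_word[of g ?n ?n "v t"] vn[OF t]
      by (simp add: g_def)
  qed
  have "g \<in> solution_set G ?n S0"
    using g sol y(2) F by (auto simp: solution_set_def)
  then have "g \<in> solution_set G ?n (s ` T)" using S0(3) by simp
  then show False using y(3) sol by (auto simp: solution_set_def)
qed

section \<open>Locally finite subgroups and wreath products\<close>

lemma (in group) locally_finite_generate:
  assumes L: "subgroup L G" "locally_finite (G\<lparr>carrier := L\<rparr>)" and F: "finite F" "F \<subseteq> L"
  shows "finite (generate G F)"
proof -
  interpret L: group "G\<lparr>carrier := L\<rparr>" using L(1) by (rule subgroup.subgroup_is_group) (rule is_group)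
  have gen: "generate (G\<lparr>carrier := L\<rparr>) F = generate G F"
    by (rule generate_consistent[OF F(2) L(1)])
  have FG: "F \<subseteq> carrier G" using F(2) subgroup.subset[OF L(1)] by auto
  have "subgroup (generate G F) (G\<lparr>carrier := L\<rparr>)"
    using L.generate_is_subgroup[of F] F(2) gen by simp
  moreover have "generate (G\<lparr>carrier := generate G F\<rparr>) F = generate G F"
    by (rule generate_consistent[OF _ generate_is_subgroup[OF FG]]) (auto intro: generate.incl)
  then have "finitely_generated_group (G\<lparr>carrier := L, carrier := generate G F\<rparr>)"
    unfolding finitely_generated_group_def using F(1) by (intro exI[of _ F]) (auto intro: generate.incl)
  ultimately show ?thesis using L(2) unfolding locally_finite_def by auto
qed

theorem (in abelian_wreath) wreath_not_equationally_noetherian: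
  assumes nontriv: "carrier G \<noteq> {\<one>\<^bsub>G\<^esub>}" and fg: "finitely_generated_group H"
    and L: "subgroup L H" "infinite L" "locally_finite (H\<lparr>carrier := L\<rparr>)"
  shows "\<not> equationally_noetherian (wreath_product G H)"
proof -
  let ?W = "wreath_product G H"
  obtain a where a: "a \<in> carrier G" "a \<noteq> \<one>\<^bsub>G\<^esub>" using nontriv by auto
  obtain B where B: "B \<subseteq> carrier H" "finite B" "generate H B = carrier H"
    using fg by (auto simp: finitely_generated_group_def)
  obtain b :: "nat \<Rightarrow> 'b" where b: "bij_betw b {1..card B} B"
    using ex_bij_betw_nat_finite_1[OF B(2)] by blast
  define e where "e = (\<lambda>h :: 'b. (\<one>\<^bsub>base\<^esub>, h))"
  have shift_1: "shift h \<one>\<^bsub>base\<^esub> = \<one>\<^bsub>base\<^esub>" if "h \<in> carrier H" for h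
    using that by (auto simp: shift_def one_base fun_eq_iff)
  have e_hom: "e \<in> hom H ?W"
    by (rule homI) (auto simp: e_def wreath_carrier wreath_mult shift_1)
  interpret e: group_hom H ?W e using e_hom by unfold_locales
  have bB: "b ` {1..card B} = B" using b by (simp add: bij_betw_def)
  have "(e \<circ> b) ` {1..card B} = e ` B" using bB by (metis image_comp)
  then have img: "e ` carrier H = generate ?W ((e \<circ> b) ` {1..card B})"
    using e.generate_img[OF B(1)] B(3) by simp
  have LH: "L \<subseteq> carrier H" using L(1) by (rule subgroup.subset)
  show ?thesis
  proof (rule wreath.not_equationally_noetherianI[of "e \<circ> b" "card B" L e])
    show "e \<circ> b \<in> {1..card B} \<rightarrow> carrier ?W"
    proof
      fix i assume "i \<in> {1..card B}"
      then have "b i \<in> carrier H" using bB B(1) by blast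
      then show "(e \<circ> b) i \<in> carrier ?W" by simp
    qed
    show "e t \<in> generate ?W ((e \<circ> b) ` {1..card B})" if "t \<in> L" for t
      using img LH that by auto
  next
    fix F assume F: "finite F" "F \<subseteq> L"
    \<comment> \<open>Finite by local finiteness: the function below has finite support, and some
      element of the infinite \<open>L\<close> stays outside.\<close>
    let ?M = "generate H F"
    have FH: "F \<subseteq> carrier H" using F(2) LH by auto
    have M: "subgroup ?M H" "finite ?M" "?M \<subseteq> carrier H"
      using H.generate_is_subgroup[OF FH] H.locally_finite_generate[OF L(1,3) F] H.generate_incl[OF FH]
      by auto
    define f where "f = (\<lambda>x\<in>carrier H. if x \<in> ?M then a else \<one>\<^bsub>G\<^esub>)"
    have "finite {x \<in> carrier H. f x \<noteq> \<one>\<^bsub>G\<^esub>}"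
      by (rule finite_subset[OF _ M(2)]) (auto simp: f_def split: if_splits)
    moreover have "f \<in> carrier H \<rightarrow>\<^sub>E carrier G" using a(1) by (auto simp: f_def)
    ultimately have f: "f \<in> carrier base" by (simp add: base_iff)
    have comm_iff: "(f, \<one>\<^bsub>H\<^esub>) \<otimes>\<^bsub>?W\<^esub> e h = e h \<otimes>\<^bsub>?W\<^esub> (f, \<one>\<^bsub>H\<^esub>) \<longleftrightarrow> shift h f = f"
      if h: "h \<in> carrier H" for h
      using h f shift_closed[OF h f] by (auto simp: e_def wreath_mult shift_1)
    have "shift h f = f" if h: "h \<in> F" for h
    proof (rule base_eqI[OF shift_closed f])
      have hM: "h \<in> ?M" using h by (rule generate.incl)
      show hH: "h \<in> carrier H" using h FH by auto
      fix x assume x: "x \<in> carrier H"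
      have "inv\<^bsub>H\<^esub> h \<otimes>\<^bsub>H\<^esub> x \<in> ?M \<longleftrightarrow> x \<in> ?M"
      proof
        assume "inv\<^bsub>H\<^esub> h \<otimes>\<^bsub>H\<^esub> x \<in> ?M"
        then have "h \<otimes>\<^bsub>H\<^esub> (inv\<^bsub>H\<^esub> h \<otimes>\<^bsub>H\<^esub> x) \<in> ?M" using hM subgroup.m_closed[OF M(1)] by blast
        then show "x \<in> ?M" using hH x by (simp add: H.m_assoc[symmetric])
      next
        assume "x \<in> ?M"
        then show "inv\<^bsub>H\<^esub> h \<otimes>\<^bsub>H\<^esub> x \<in> ?M"
          using hM subgroup.m_closed[OF M(1)] subgroup.m_inv_closed[OF M(1)] by blast
      qed
      then show "shift h f x = f x" using x hH by (simp add: shift_apply) (simp add: f_def)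
    qed (use h FH f in auto)
    then have "\<forall>h\<in>F. (f, \<one>\<^bsub>H\<^esub>) \<otimes>\<^bsub>?W\<^esub> e h = e h \<otimes>\<^bsub>?W\<^esub> (f, \<one>\<^bsub>H\<^esub>)"
      using comm_iff FH by auto
    moreover have "\<not> L \<subseteq> ?M" using L(2) M(2) finite_subset by blast
    then obtain l where l: "l \<in> L" "l \<notin> ?M" by blast
    then have lH: "l \<in> carrier H" using LH by auto
    \<comment> \<open>At \<open>l\<close> the translate takes the value of \<open>f\<close> at
      \<one>, which is \<open>a\<close>, whereas \<open>f l\<close> is trivial.\<close>
    have "shift l f l \<noteq> f l"
      using lH l(2) a(2) generate.one[of H F] by (simp add: shift_apply) (simp add: f_def)
    then have "(f, \<one>\<^bsub>H\<^esub>) \<otimes>\<^bsub>?W\<^esub> e l \<noteq> e l \<otimes>\<^bsub>?W\<^esub> (f, \<one>\<^bsub>H\<^esub>)"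
      using comm_iff[OF lH] by auto
    ultimately show "\<exists>x\<in>carrier ?W. (\<forall>t\<in>F. x \<otimes>\<^bsub>?W\<^esub> e t = e t \<otimes>\<^bsub>?W\<^esub> x) \<and>
        (\<exists>t\<in>L. x \<otimes>\<^bsub>?W\<^esub> e t \<noteq> e t \<otimes>\<^bsub>?W\<^esub> x)"
      using f l(1) by (intro bexI[of _ "(f, \<one>\<^bsub>H\<^esub>)"]) (auto simp: wreath_carrier)
  qed
qed

section \<open>Unitriangular integer matrices\<close>

lemma carrier_UT_intD:
  assumes "A \<in> carrier (UT_int r)"
  shows "A \<in> carrier_mat r r" "dim_row A = r" "dim_col A = r"
    "\<And>i j. j < i \<Longrightarrow> i < r \<Longrightarrow> A $$ (i, j) = 0" "\<And>i. i < r \<Longrightarrow> A $$ (i, i) = 1"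
  using assms by (auto simp: carrier_UT_int upper_triangular_def)

lemma carrier_UT_intI:
  assumes "A \<in> carrier_mat r r" "\<And>i j. j < i \<Longrightarrow> i < r \<Longrightarrow> A $$ (i, j) = 0"
    "\<And>i. i < r \<Longrightarrow> A $$ (i, i) = 1"
  shows "A \<in> carrier (UT_int r)"
  using assms by (auto simp: carrier_UT_int upper_triangular_def)

lemma mult_UT_int: "A \<otimes>\<^bsub>UT_int r\<^esub> B = A * B"
  by (simp add: UT_int_def GL_int_def units_of_def ring_mat_def)

lemma one_UT_int: "\<one>\<^bsub>UT_int r\<^esub> = 1\<^sub>m r"
  by (simp add: UT_int_def GL_int_def units_of_def ring_mat_def)

text \<open>For growing \<open>k\<close> these conditions cut out the standard central filtration of
  the unitriangular group.\<close>

definition superdiagonals_zero :: "nat \<Rightarrow> nat \<Rightarrow> int mat \<Rightarrow> bool"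
  where "superdiagonals_zero r k A \<longleftrightarrow> (\<forall>i j. i < j \<longrightarrow> j < r \<longrightarrow> j \<le> i + k \<longrightarrow> A $$ (i, j) = 0)"

lemma superdiagonals_zero_0 [simp]: "superdiagonals_zero r 0 A"
  by (simp add: superdiagonals_zero_def)

lemma superdiagonals_zeroD:
  "\<lbrakk>superdiagonals_zero r k A; i < j; j < r; j \<le> i + k\<rbrakk> \<Longrightarrow> A $$ (i, j) = 0"
  by (auto simp: superdiagonals_zero_def)

lemma mult_entry:
  fixes A B :: "int mat"
  assumes "A \<in> carrier_mat r r" "B \<in> carrier_mat r r" "i < r" "j < r"
  shows "(A * B) $$ (i, j) = (\<Sum>m<r. A $$ (i, m) * B $$ (m, j))"
  using assms by (auto simp: scalar_prod_def atLeast0LessThan intro!: sum.cong)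

lemma UT_int_mult_closed:
  assumes A: "A \<in> carrier (UT_int r)" and B: "B \<in> carrier (UT_int r)"
  shows "A * B \<in> carrier (UT_int r)"
proof (rule carrier_UT_intI)
  note a = carrier_UT_intD[OF A] and b = carrier_UT_intD[OF B]
  show "A * B \<in> carrier_mat r r" using a(1) b(1) by simp
  show "(A * B) $$ (i, j) = 0" if "j < i" "i < r" for i j
  proof -
    have "A $$ (i, m) * B $$ (m, j) = 0" if "m < r" for m
      using a(4)[of m i] b(4)[of j m] that \<open>j < i\<close> \<open>i < r\<close> by (cases "m < i") auto
    then have "(\<Sum>m<r. A $$ (i, m) * B $$ (m, j)) = 0" by (intro sum.neutral) blast
    then show ?thesis using mult_entry[OF a(1) b(1)] that by simp
  qed
  show "(A * B) $$ (i, i) = 1" if i: "i < r" for i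
  proof -
    have "A $$ (i, m) * B $$ (m, i) = (if m = i then 1 else 0)" if "m < r" for m
      using a(4)[of m i] b(4)[of i m] a(5)[of i] b(5)[of i] that i
      by (cases m i rule: linorder_cases) auto
    then show ?thesis using mult_entry[OF a(1) b(1) i i] i by (simp add: sum.delta)
  qed
qed

text \<open>A summand with \<open>i < m < j\<close> has a factor from each matrix at distance at
  most \<open>k\<close> from the diagonal, so it vanishes by \<open>zero\<close>. The summands
  \<open>m = i\<close> and \<open>m = j\<close> are the two entries. Thus multiplication is addition
  on the first superdiagonal that is not yet known to vanish.\<close>

lemma mult_superdiagonal:
  assumes A: "A \<in> carrier (UT_int r)" and B: "B \<in> carrier (UT_int r)"
    and zero: "superdiagonals_zero r k A \<or> superdiagonals_zero r k B"
    and ij: "i < j" "j < r" "j \<le> i + Suc k"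
  shows "(A * B) $$ (i, j) = A $$ (i, j) + B $$ (i, j)"
proof -
  note a = carrier_UT_intD[OF A] and b = carrier_UT_intD[OF B]
  have *: "A $$ (i, m) * B $$ (m, j) = (if m = i then B $$ (i, j) else 0) + (if m = j then A $$ (i, j) else 0)"
    if m: "m < r" for m
  proof -
    consider "m < i" | "m = i" | "i < m" "m < j" | "m = j" | "j < m" by linarith
    then show ?thesis
    proof cases
      case 3
      then have "A $$ (i, m) = 0 \<or> B $$ (m, j) = 0"
        using zero superdiagonals_zeroD[of r k A i m] superdiagonals_zeroD[of r k B m j] ij by auto
      then show ?thesis using 3 by auto
    qed (use a(4)[of m i] b(4)[of j m] a(5)[of i] b(5)[of j] ij m in auto)
  qed
  have "(A * B) $$ (i, j) = (\<Sum>m<r. (if m = i then B $$ (i, j) else 0) + (if m = j then A $$ (i, j) else 0))"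
    using mult_entry[OF a(1) b(1)] ij * by simp
  also have "\<dots> = A $$ (i, j) + B $$ (i, j)" using ij by (simp add: sum.distrib)
  finally show ?thesis .
qed

lemma superdiagonals_zero_imp_one:
  assumes "A \<in> carrier (UT_int r)" "superdiagonals_zero r r A"
  shows "A = 1\<^sub>m r"
proof (rule eq_matI)
  fix i j assume ij: "i < dim_row (1\<^sub>m r)" "j < dim_col (1\<^sub>m r)"
  then show "A $$ (i, j) = 1\<^sub>m r $$ (i, j)"
    using carrier_UT_intD[OF assms(1)] superdiagonals_zeroD[OF assms(2), of i j]
    by (cases i j rule: linorder_cases) auto
qed (use carrier_UT_intD[OF assms(1)] in auto)

text \<open>If \<open>C = 1 + M\<close> vanishes on the first \<open>k\<close> superdiagonals, then \<open>(1 - M)C = 1 - M\<^sup>2\<close> vanishes on one more.\<close>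

lemma UT_int_left_inverse:
  assumes A: "A \<in> carrier (UT_int r)"
  shows "\<exists>B\<in>carrier (UT_int r). superdiagonals_zero r k (B * A)"
proof (induction k)
  case 0
  then show ?case using A by auto
next
  case (Suc k)
  then obtain B where B: "B \<in> carrier (UT_int r)" "superdiagonals_zero r k (B * A)" by blast
  let ?C = "B * A"
  have C: "?C \<in> carrier (UT_int r)" using UT_int_mult_closed B(1) A .
  note c = carrier_UT_intD[OF C]
  define D where "D = mat r r (\<lambda>(i, j). if i = j then 1 else - ?C $$ (i, j))"
  have D: "D \<in> carrier (UT_int r)"
    by (rule carrier_UT_intI) (auto simp: D_def c(4))
  have "superdiagonals_zero r (Suc k) (D * ?C)"
    unfolding superdiagonals_zero_def
  proof (intro allI impI)
    fix i j assume ij: "i < j" "j < r" "j \<le> i + Suc k"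
    have "(D * ?C) $$ (i, j) = D $$ (i, j) + ?C $$ (i, j)"
      by (rule mult_superdiagonal[OF D C _ ij]) (use B(2) in simp)
    then show "(D * ?C) $$ (i, j) = 0" using ij by (simp add: D_def)
  qed
  moreover have "D * ?C = (D * B) * A"
    using carrier_UT_intD(1)[OF D] carrier_UT_intD(1)[OF B(1)] carrier_UT_intD(1)[OF A] by simp
  ultimately show ?case using UT_int_mult_closed[OF D B(1)] by metis
qed

lemma one_in_UT_int: "1\<^sub>m r \<in> carrier (UT_int r)"
  by (rule carrier_UT_intI) auto

lemma group_UT_int: "group (UT_int r)"
proof (rule groupI)
  fix A assume A: "A \<in> carrier (UT_int r)"
  then obtain B where B: "B \<in> carrier (UT_int r)" "superdiagonals_zero r r (B * A)"
    using UT_int_left_inverse by blast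
  then have "B * A = 1\<^sub>m r" using superdiagonals_zero_imp_one UT_int_mult_closed A by blast
  then show "\<exists>B\<in>carrier (UT_int r). B \<otimes>\<^bsub>UT_int r\<^esub> A = \<one>\<^bsub>UT_int r\<^esub>"
    using B(1) by (auto simp: mult_UT_int one_UT_int)
next
  fix A B C assume "A \<in> carrier (UT_int r)" "B \<in> carrier (UT_int r)" "C \<in> carrier (UT_int r)"
  then show "A \<otimes>\<^bsub>UT_int r\<^esub> B \<otimes>\<^bsub>UT_int r\<^esub> C = A \<otimes>\<^bsub>UT_int r\<^esub> (B \<otimes>\<^bsub>UT_int r\<^esub> C)"
    using carrier_UT_intD(1) by (metis assoc_mult_mat mult_UT_int)
next
  fix A assume "A \<in> carrier (UT_int r)"
  then show "\<one>\<^bsub>UT_int r\<^esub> \<otimes>\<^bsub>UT_int r\<^esub> A = A"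
    using left_mult_one_mat[OF carrier_UT_intD(1)] by (simp add: mult_UT_int one_UT_int)
qed (simp_all add: UT_int_mult_closed mult_UT_int one_UT_int one_in_UT_int)

text \<open>On the superdiagonal after those already known to vanish, the entries of a power are the
  entries of \<open>A\<close> times the exponent.\<close>

lemma torsion_free_UT_int: "torsion_free_group (UT_int r)"
  unfolding torsion_free_group_def
proof (intro ballI allI impI)
  interpret group "UT_int r" by (rule group_UT_int)
  fix A n assume A: "A \<in> carrier (UT_int r)" and n: "0 < (n::nat)" "A [^]\<^bsub>UT_int r\<^esub> n = \<one>\<^bsub>UT_int r\<^esub>"
  have "superdiagonals_zero r k A" for k
  proof (induction k)
    case (Suc k)
    show ?case
      unfolding superdiagonals_zero_def
    proof (intro allI impI)
      fix i j assume ij: "i < j" "j < r" "j \<le> i + Suc k"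
      have "(A [^]\<^bsub>UT_int r\<^esub> m) $$ (i, j) = int m * A $$ (i, j)" for m :: nat
      proof (induction m)
        case 0
        then show ?case using ij by (simp add: one_UT_int)
      next
        case (Suc m)
        have "(A [^]\<^bsub>UT_int r\<^esub> Suc m) $$ (i, j) = (A [^]\<^bsub>UT_int r\<^esub> m * A) $$ (i, j)"
          by (simp add: mult_UT_int)
        also have "\<dots> = (A [^]\<^bsub>UT_int r\<^esub> m) $$ (i, j) + A $$ (i, j)"
          by (rule mult_superdiagonal[OF nat_pow_closed[OF A] A _ ij]) (use \<open>superdiagonals_zero r k A\<close> in simp)
        finally show ?case using Suc.IH by (simp add: algebra_simps)
      qed
      from this[of n] show "A $$ (i, j) = 0" using n ij by (simp add: one_UT_int)
    qed
  qed simp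
  then show "A = \<one>\<^bsub>UT_int r\<^esub>" using superdiagonals_zero_imp_one[OF A] by (simp add: one_UT_int)
qed

lemma subgroup_superdiagonals_zero:
  "subgroup {A \<in> carrier (UT_int r). superdiagonals_zero r k A} (UT_int r)" (is "subgroup ?S _")
proof -
  interpret group "UT_int r" by (rule group_UT_int)
  have ent: "(A * B) $$ (i, j) = A $$ (i, j) + B $$ (i, j)"
    if "A \<in> ?S" "B \<in> carrier (UT_int r)" "i < j" "j < r" "j \<le> i + k" for A B i j
    using mult_superdiagonal[of A r B k i j] that by simp
  show ?thesis
  proof (rule subgroupI)
    show "?S \<noteq> {}" using one_in_UT_int by (auto simp: superdiagonals_zero_def intro!: exI[of _ "1\<^sub>m r"])
  next
    fix A assume A: "A \<in> ?S"
    let ?B = "inv\<^bsub>UT_int r\<^esub> A"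
    have B: "?B \<in> carrier (UT_int r)" using A by simp
    have "A * ?B = 1\<^sub>m r" using A r_inv[of A] by (simp add: mult_UT_int one_UT_int)
    then have "?B $$ (i, j) = 0" if "i < j" "j < r" "j \<le> i + k" for i j
      using ent[OF A B that] superdiagonals_zeroD[of r k A i j] A that by simp
    then show "?B \<in> ?S" using B by (simp add: superdiagonals_zero_def)
  next
    fix A B assume AB: "A \<in> ?S" "B \<in> ?S"
    then show "A \<otimes>\<^bsub>UT_int r\<^esub> B \<in> ?S"
      using ent[OF AB(1)] UT_int_mult_closed superdiagonals_zeroD[of r k A] superdiagonals_zeroD[of r k B]
      by (auto simp: mult_UT_int superdiagonals_zero_def)
  qed auto
qed

text \<open>From xy = yxc: up to distance \<open>k + 1\<close> the entries of xy and yx are both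
  sums of those of \<open>x\<close> and \<open>y\<close>, so c has to vanish there. It is cleared
  one superdiagonal at a time, because additivity of the product of yx with c relies on the earlier
  superdiagonals of c.\<close>

lemma commutator_superdiagonals_zero:
  assumes x: "x \<in> carrier (UT_int r)" "superdiagonals_zero r k x" and y: "y \<in> carrier (UT_int r)"
  shows "superdiagonals_zero r (Suc k)
    (inv\<^bsub>UT_int r\<^esub> x \<otimes>\<^bsub>UT_int r\<^esub> inv\<^bsub>UT_int r\<^esub> y \<otimes>\<^bsub>UT_int r\<^esub> x \<otimes>\<^bsub>UT_int r\<^esub> y)"
    (is "superdiagonals_zero r _ ?c")
proof -
  interpret group "UT_int r" by (rule group_UT_int)
  have c: "?c \<in> carrier (UT_int r)" using x y by simp
  have "?c = inv\<^bsub>UT_int r\<^esub> (y \<otimes>\<^bsub>UT_int r\<^esub> x) \<otimes>\<^bsub>UT_int r\<^esub> (x \<otimes>\<^bsub>UT_int r\<^esub> y)"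
    using x y by (simp add: inv_mult_group m_assoc)
  then have "x \<otimes>\<^bsub>UT_int r\<^esub> y = (y \<otimes>\<^bsub>UT_int r\<^esub> x) \<otimes>\<^bsub>UT_int r\<^esub> ?c"
    using inv_solve_left[of ?c "y \<otimes>\<^bsub>UT_int r\<^esub> x" "x \<otimes>\<^bsub>UT_int r\<^esub> y"] c x y by simp
  then have eq: "x * y = (y * x) * ?c" by (simp add: mult_UT_int)
  have yx: "y * x \<in> carrier (UT_int r)" using UT_int_mult_closed x y by blast
  have "l \<le> Suc k \<Longrightarrow> superdiagonals_zero r l ?c" for l
  proof (induction l)
    case (Suc l)
    show ?case
      unfolding superdiagonals_zero_def
    proof (intro allI impI)
      fix i j assume ij: "i < j" "j < r" "j \<le> i + Suc l"
      then have ij': "j \<le> i + Suc k" using Suc.prems by simp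
      have "(x * y) $$ (i, j) = (y * x) $$ (i, j) + ?c $$ (i, j)"
        unfolding eq by (rule mult_superdiagonal[OF yx c _ ij]) (use Suc in simp)
      moreover have "(x * y) $$ (i, j) = x $$ (i, j) + y $$ (i, j)"
        by (rule mult_superdiagonal[OF x(1) y _ ij(1,2) ij']) (use x in simp)
      moreover have "(y * x) $$ (i, j) = y $$ (i, j) + x $$ (i, j)"
        by (rule mult_superdiagonal[OF y x(1) _ ij(1,2) ij']) (use x in simp)
      ultimately show "?c $$ (i, j) = 0" by simp
    qed
  qed simp
  then show ?thesis by simp
qed

lemma nilpotent_UT_int: "nilpotent_group (UT_int r)"
proof -
  interpret group "UT_int r" by (rule group_UT_int)
  have sub: "lower_central (UT_int r) k \<subseteq> {A \<in> carrier (UT_int r). superdiagonals_zero r k A}" for k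
  proof (induction k)
    case (Suc k)
    show ?case
      unfolding lower_central.simps
    proof (rule generate_subgroup_incl[OF _ subgroup_superdiagonals_zero], clarify)
      fix x y assume x: "x \<in> lower_central (UT_int r) k" and y: "y \<in> carrier (UT_int r)"
      have "x \<in> carrier (UT_int r)" "superdiagonals_zero r k x" using x Suc.IH by auto
      then show "inv\<^bsub>UT_int r\<^esub> x \<otimes>\<^bsub>UT_int r\<^esub> inv\<^bsub>UT_int r\<^esub> y \<otimes>\<^bsub>UT_int r\<^esub> x \<otimes>\<^bsub>UT_int r\<^esub> y \<in> carrier (UT_int r) \<and>
          superdiagonals_zero r (Suc k) (inv\<^bsub>UT_int r\<^esub> x \<otimes>\<^bsub>UT_int r\<^esub> inv\<^bsub>UT_int r\<^esub> y \<otimes>\<^bsub>UT_int r\<^esub> x \<otimes>\<^bsub>UT_int r\<^esub> y)"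
        using commutator_superdiagonals_zero y by simp
    qed
  qed auto
  have "\<one>\<^bsub>UT_int r\<^esub> \<in> lower_central (UT_int r) k" for k
    by (cases k) (auto intro: generate.one)
  then have "lower_central (UT_int r) r = {\<one>\<^bsub>UT_int r\<^esub>}"
    using sub[of r] superdiagonals_zero_imp_one by (auto simp: one_UT_int)
  then show ?thesis unfolding nilpotent_group_def by blast
qed

section \<open>Residual properties of unitriangular groups and their product\<close>

lemma torsion_free_nilpotent_iso:
  assumes Q: "torsion_free_nilpotent Q" and N: "group N" and f: "f \<in> iso Q N"
  shows "torsion_free_nilpotent N"
proof -
  interpret Q: group Q using Q by (simp add: torsion_free_nilpotent_def)
  interpret N: group N by fact
  interpret f: group_hom Q N f using f by unfold_locales (simp add: iso_def)
  have inj: "inj_on f (carrier Q)" and surj: "f ` carrier Q = carrier N"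
    using f by (auto simp: iso_def bij_betw_def)
  have lc_sub: "lower_central Q k \<subseteq> carrier Q" for k
  proof (induction k)
    case (Suc k)
    show ?case
      unfolding lower_central.simps
      by (rule Q.generate_subgroup_incl[OF _ Q.subgroup_self]) (use Suc in auto)
  qed simp
  have lc: "lower_central N k = f ` lower_central Q k" for k
  proof (induction k)
    case (Suc k)
    let ?C = "{inv\<^bsub>Q\<^esub> x \<otimes>\<^bsub>Q\<^esub> inv\<^bsub>Q\<^esub> y \<otimes>\<^bsub>Q\<^esub> x \<otimes>\<^bsub>Q\<^esub> y | x y. x \<in> lower_central Q k \<and> y \<in> carrier Q}"
    have fc: "f (inv\<^bsub>Q\<^esub> x \<otimes>\<^bsub>Q\<^esub> inv\<^bsub>Q\<^esub> y \<otimes>\<^bsub>Q\<^esub> x \<otimes>\<^bsub>Q\<^esub> y) =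
        inv\<^bsub>N\<^esub> f x \<otimes>\<^bsub>N\<^esub> inv\<^bsub>N\<^esub> f y \<otimes>\<^bsub>N\<^esub> f x \<otimes>\<^bsub>N\<^esub> f y" if "x \<in> lower_central Q k" "y \<in> carrier Q" for x y
      using that lc_sub[of k] by (simp add: subset_iff)
    have "{inv\<^bsub>N\<^esub> x \<otimes>\<^bsub>N\<^esub> inv\<^bsub>N\<^esub> y \<otimes>\<^bsub>N\<^esub> x \<otimes>\<^bsub>N\<^esub> y | x y. x \<in> lower_central N k \<and> y \<in> carrier N} = f ` ?C"
    proof (intro subset_antisym subsetI)
      fix z assume "z \<in> {inv\<^bsub>N\<^esub> x \<otimes>\<^bsub>N\<^esub> inv\<^bsub>N\<^esub> y \<otimes>\<^bsub>N\<^esub> x \<otimes>\<^bsub>N\<^esub> y | x y. x \<in> lower_central N k \<and> y \<in> carrier N}"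
      then obtain x y where xy: "x \<in> lower_central N k" "y \<in> carrier N"
        "z = inv\<^bsub>N\<^esub> x \<otimes>\<^bsub>N\<^esub> inv\<^bsub>N\<^esub> y \<otimes>\<^bsub>N\<^esub> x \<otimes>\<^bsub>N\<^esub> y" by blast
      obtain x' y' where x'y': "x' \<in> lower_central Q k" "x = f x'" "y' \<in> carrier Q" "y = f y'"
        using xy(1,2) Suc.IH surj by blast
      then show "z \<in> f ` ?C" using xy(3) fc[OF x'y'(1,3)] by (auto intro!: image_eqI[OF sym])
    next
      fix z assume "z \<in> f ` ?C"
      then obtain x y where xy: "x \<in> lower_central Q k" "y \<in> carrier Q"
        "z = f (inv\<^bsub>Q\<^esub> x \<otimes>\<^bsub>Q\<^esub> inv\<^bsub>Q\<^esub> y \<otimes>\<^bsub>Q\<^esub> x \<otimes>\<^bsub>Q\<^esub> y)" by blast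
      then show "z \<in> {inv\<^bsub>N\<^esub> x \<otimes>\<^bsub>N\<^esub> inv\<^bsub>N\<^esub> y \<otimes>\<^bsub>N\<^esub> x \<otimes>\<^bsub>N\<^esub> y | x y. x \<in> lower_central N k \<and> y \<in> carrier N}"
        using fc[OF xy(1,2)] Suc.IH f.hom_closed by blast
    qed
    moreover have "?C \<subseteq> carrier Q" using lc_sub[of k] by auto
    ultimately show ?case using f.generate_img[of ?C] by simp
  qed (use surj in simp)
  obtain k where "lower_central Q k = {\<one>\<^bsub>Q\<^esub>}"
    using Q by (auto simp: torsion_free_nilpotent_def nilpotent_group_def)
  then have "lower_central N k = {\<one>\<^bsub>N\<^esub>}" using lc by simp
  then have "nilpotent_group N" unfolding nilpotent_group_def by blast
  moreover have "torsion_free_group N"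
    unfolding torsion_free_group_def
  proof (intro ballI allI impI)
    fix g n assume g: "g \<in> carrier N" and n: "0 < (n::nat)" "g [^]\<^bsub>N\<^esub> n = \<one>\<^bsub>N\<^esub>"
    obtain x where x: "x \<in> carrier Q" "g = f x" using g surj by blast
    have "f (x [^]\<^bsub>Q\<^esub> n) = f \<one>\<^bsub>Q\<^esub>" using n(2) x f.hom_nat_pow[OF x(1)] by simp
    then have "x [^]\<^bsub>Q\<^esub> n = \<one>\<^bsub>Q\<^esub>" using inj_onD[OF inj] x(1) by blast
    then have "x = \<one>\<^bsub>Q\<^esub>" using Q x(1) n(1) by (auto simp: torsion_free_nilpotent_def torsion_free_group_def)
    then show "g = \<one>\<^bsub>N\<^esub>" using x(2) by simp
  qed
  ultimately show ?thesis using N by (simp add: torsion_free_nilpotent_def)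
qed

lemma countable_carrier_UT_int: "countable (carrier (UT_int r))"
proof -
  define g where "g = (\<lambda>A :: int mat. map (\<lambda>ij. A $$ ij) (List.product [0..<r] [0..<r]))"
  have "inj_on g (carrier (UT_int r))"
  proof (rule inj_onI)
    fix A B assume A: "A \<in> carrier (UT_int r)" and B: "B \<in> carrier (UT_int r)" and eq: "g A = g B"
    note a = carrier_UT_intD(2,3)[OF A] and b = carrier_UT_intD(2,3)[OF B]
    show "A = B"
    proof (rule eq_matI)
      fix i j assume "i < dim_row B" "j < dim_col B"
      then have "(i, j) \<in> set (List.product [0..<r] [0..<r])" using b by simp
      then show "A $$ (i, j) = B $$ (i, j)" using eq unfolding g_def map_eq_conv by blast
    qed (use a b in auto)
  qed
  then show ?thesis by (rule countable_image_inj_on[rotated]) simp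
qed

text \<open>\<open>H\<close> is merely a multiplicative structure on all integer matrices. Being a
  homomorphism asks for no more, and the image of a group is then a group; this avoids matrices over
  a residue ring.\<close>

lemma UT_int_mod_hom:
  fixes q :: int and r :: nat
  defines "H \<equiv> \<lparr>carrier = UNIV :: int mat set, monoid.mult = (\<lambda>A B. map_mat (\<lambda>x. x mod q) (A * B)), one = 1\<^sub>m r\<rparr>"
  shows "map_mat (\<lambda>x. x mod q) \<in> hom (UT_int r) H"
proof (rule homI)
  fix A B assume A: "A \<in> carrier (UT_int r)" and B: "B \<in> carrier (UT_int r)"
  note a = carrier_UT_intD(1)[OF A] and b = carrier_UT_intD(1)[OF B]
  let ?m = "map_mat (\<lambda>x. x mod q)"
  have "?m (A * B) = ?m (?m A * ?m B)"
  proof (rule eq_matI)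
    fix i j assume "i < dim_row (?m (?m A * ?m B))" "j < dim_col (?m (?m A * ?m B))"
    then have ij: "i < r" "j < r" using a b by auto
    have c: "?m A \<in> carrier_mat r r" "?m B \<in> carrier_mat r r" using a b by auto
    have "(\<Sum>m<r. A $$ (i, m) * B $$ (m, j)) mod q
        = (\<Sum>m<r. (A $$ (i, m) mod q) * (B $$ (m, j) mod q)) mod q"
      by (subst (1 2) mod_sum_eq[symmetric]) (simp add: mod_mult_eq)
    also have "(\<Sum>m<r. (A $$ (i, m) mod q) * (B $$ (m, j) mod q)) = (?m A * ?m B) $$ (i, j)"
      using mult_entry[OF c ij] a b ij by simp
    finally show "?m (A * B) $$ (i, j) = ?m (?m A * ?m B) $$ (i, j)"
      using mult_entry[OF a b ij] a b ij by simp
  qed (use a b in auto)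
  then show "?m (A \<otimes>\<^bsub>UT_int r\<^esub> B) = ?m A \<otimes>\<^bsub>H\<^esub> ?m B"
    by (simp add: H_def mult_UT_int)
qed (simp add: H_def)

text \<open>An element of the image is a free choice of a residue at each position above the
  diagonal. The bound \<open>q > 1\<close> keeps the diagonal entries equal to \<open>1\<close>
  under reduction.\<close>

lemma card_UT_int_mod:
  fixes q :: int and r :: nat
  assumes q: "q > 1"
  defines "T \<equiv> {(i, j). i < j \<and> j < r}"
  shows "finite (map_mat (\<lambda>x. x mod q) ` carrier (UT_int r))"
    and "card (map_mat (\<lambda>x. x mod q) ` carrier (UT_int r)) = nat q ^ card T"
proof -
  let ?m = "map_mat (\<lambda>x. x mod q)"
  let ?u = "\<lambda>f. mat r r (\<lambda>(i, j). if i < j then f (i, j) else if i = j then 1 else 0) :: int mat"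
  have finT: "finite T" by (rule finite_subset[of _ "{..<r} \<times> {..<r}"]) (auto simp: T_def)
  have bij: "bij_betw ?u (T \<rightarrow>\<^sub>E {0..<q}) (?m ` carrier (UT_int r))"
  proof (rule bij_betwI')
    fix f g assume f: "f \<in> T \<rightarrow>\<^sub>E {0..<q}" and g: "g \<in> T \<rightarrow>\<^sub>E {0..<q}"
    show "?u f = ?u g \<longleftrightarrow> f = g"
    proof
      assume eq: "?u f = ?u g"
      show "f = g"
      proof (rule PiE_ext[OF f g])
        fix x assume "x \<in> T"
        then obtain i j where x: "x = (i, j)" "i < j" "j < r" by (auto simp: T_def)
        then show "f x = g x" using arg_cong[OF eq, of "\<lambda>A. A $$ (i, j)"] by simp
      qed
    next
      assume "f = g"
      then show "?u f = ?u g" by (simp only:)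
    qed
  next
    fix f assume f: "f \<in> T \<rightarrow>\<^sub>E {0..<q}"
    have u: "?u f \<in> carrier (UT_int r)" by (rule carrier_UT_intI) auto
    have fT: "f (i, j) \<in> {0..<q}" if "i < j" "j < r" for i j using f that by (auto simp: T_def)
    have "?u f = ?m (?u f)" using fT q by (intro eq_matI) auto
    then show "?u f \<in> ?m ` carrier (UT_int r)" using u by (rule image_eqI)
  next
    fix B assume "B \<in> ?m ` carrier (UT_int r)"
    then obtain A where A: "A \<in> carrier (UT_int r)" "B = ?m A" by blast
    note a = carrier_UT_intD[OF A(1)]
    let ?f = "\<lambda>ij\<in>T. A $$ ij mod q"
    have "?f \<in> T \<rightarrow>\<^sub>E {0..<q}" using q by auto
    moreover have "B = ?u ?f"
    proof (rule eq_matI)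
      fix i j assume "i < dim_row (?u ?f)" "j < dim_col (?u ?f)"
      then have ij: "i < r" "j < r" by auto
      then show "B $$ (i, j) = ?u ?f $$ (i, j)"
        using a(1) a(4)[of j i] a(5)[of i] q
        by (cases i j rule: linorder_cases) (auto simp: A(2) T_def)
    qed (use a(1) A(2) in auto)
    ultimately show "\<exists>f\<in>T \<rightarrow>\<^sub>E {0..<q}. B = ?u f" by blast
  qed
  have "finite (T \<rightarrow>\<^sub>E {0..<q})" using finT by (intro finite_PiE) auto
  then show "finite (?m ` carrier (UT_int r))" using bij_betw_finite[OF bij] by blast
  show "card (?m ` carrier (UT_int r)) = nat q ^ card T"
    using bij_betw_same_card[OF bij] finT by (simp add: card_PiE)
qed

lemma UT_int_residually_finite_p:
  assumes p: "Factorial_Ring.prime (p :: nat)" and A: "A \<in> carrier (UT_int r)" "A \<noteq> 1\<^sub>m r"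
  shows "\<exists>(N :: nat monoid) \<phi>. finite_p_group p N \<and> \<phi> \<in> hom (UT_int r) N \<and> \<phi> A \<noteq> \<one>\<^bsub>N\<^esub>"
proof -
  interpret UT: group "UT_int r" by (rule group_UT_int)
  note a = carrier_UT_intD[OF A(1)]
  have "\<not> superdiagonals_zero r r A" using superdiagonals_zero_imp_one[OF A(1)] A(2) by blast
  then obtain i j where ij: "i < j" "j < r" "A $$ (i, j) \<noteq> 0" by (auto simp: superdiagonals_zero_def)
  \<comment> \<open>Since e < 2^e \<le> p^e, the modulus exceeds the absolute value of the chosen
    entry, which is nonzero and hence not divisible by it.\<close>
  define e where "e = Suc (nat \<bar>A $$ (i, j)\<bar>)"
  define q where "q = int p ^ e"
  have p2: "p \<ge> 2" using p by (rule prime_ge_2_nat)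
  have "e < 2 ^ e" by (rule less_exp)
  also have "(2::nat) ^ e \<le> p ^ e" using p2 by (rule power_mono) simp
  finally have "int e < int (p ^ e)" by linarith
  then have q: "\<bar>A $$ (i, j)\<bar> < q" "1 < q" by (simp_all add: q_def e_def)
  let ?m = "map_mat (\<lambda>x. x mod q)"
  define H where "H = \<lparr>carrier = UNIV :: int mat set, monoid.mult = (\<lambda>A B. ?m (A * B)), one = 1\<^sub>m r\<rparr>"
  have hom: "?m \<in> hom (UT_int r) H" unfolding H_def by (rule UT_int_mod_hom)
  \<comment> \<open>The unit is replaced by the image of the unit, the form in which the image of a
    group under a homomorphism is a group.\<close>
  let ?I = "H\<lparr>carrier := ?m ` carrier (UT_int r), one := ?m \<one>\<^bsub>UT_int r\<^esub>\<rparr>"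
  have I: "group ?I" by (rule UT.hom_imp_img_group[OF hom])
  have hom': "?m \<in> hom (UT_int r) ?I" using hom by (auto simp: hom_def)
  have fin: "finite (carrier ?I)" and card: "\<exists>k. card (carrier ?I) = p ^ k"
    using card_UT_int_mod[OF q(2), of r] by (auto simp: q_def nat_power_eq power_mult[symmetric] simp del: power_mult)
  have ne: "?m A \<noteq> \<one>\<^bsub>?I\<^esub>"
  proof
    assume "?m A = \<one>\<^bsub>?I\<^esub>"
    then have "?m A $$ (i, j) = ?m (1\<^sub>m r) $$ (i, j)" by (simp add: one_UT_int)
    then have "A $$ (i, j) mod q = 0" using a(1) ij by simp
    then have "q dvd A $$ (i, j)" by auto
    then show False using zdvd_imp_le[of q "\<bar>A $$ (i, j)\<bar>"] q ij(3) by auto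
  qed
  obtain N :: "nat monoid" and f where N: "group N" "f \<in> iso ?I N"
    using countable_group_nat_copy[OF I countable_finite[OF fin]] by blast
  have f: "f \<in> hom ?I N" "bij_betw f (carrier ?I) (carrier N)" using N(2) by (auto simp: iso_def)
  have "finite_p_group p N"
    using N(1) fin card bij_betw_finite[OF f(2)] bij_betw_same_card[OF f(2)] by (simp add: finite_p_group_def)
  moreover have "f \<circ> ?m \<in> hom (UT_int r) N" using hom' f(1) by (rule hom_compose)
  moreover have "f (?m A) \<noteq> \<one>\<^bsub>N\<^esub>"
  proof
    assume "f (?m A) = \<one>\<^bsub>N\<^esub>"
    then have "f (?m A) = f \<one>\<^bsub>?I\<^esub>" using hom_one[OF f(1) I N(1)] by simp
    then have "?m A = \<one>\<^bsub>?I\<^esub>"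
      using f(2) A(1) monoid.one_closed[OF group.is_monoid[OF I]]
      by (auto simp: bij_betw_def dest!: inj_onD)
    then show False using ne by contradiction
  qed
  ultimately show ?thesis by (intro exI[of _ N] exI[of _ "f \<circ> ?m"]) simp
qed

lemma UT_int_residually_torsion_free_nilpotent:
  assumes A: "A \<in> carrier (UT_int r)" "A \<noteq> 1\<^sub>m r"
  shows "\<exists>(N :: nat monoid) \<phi>. torsion_free_nilpotent N \<and> \<phi> \<in> hom (UT_int r) N \<and> \<phi> A \<noteq> \<one>\<^bsub>N\<^esub>"
proof -
  interpret UT: group "UT_int r" by (rule group_UT_int)
  obtain N :: "nat monoid" and f where N: "group N" "f \<in> iso (UT_int r) N"
    using countable_group_nat_copy[OF group_UT_int countable_carrier_UT_int] by blast
  have f: "f \<in> hom (UT_int r) N" "inj_on f (carrier (UT_int r))" using N(2) by (auto simp: iso_def bij_betw_def)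
  have "torsion_free_nilpotent (UT_int r)"
    using group_UT_int torsion_free_UT_int nilpotent_UT_int by (simp add: torsion_free_nilpotent_def)
  then have "torsion_free_nilpotent N" using N by (rule torsion_free_nilpotent_iso)
  moreover have "f A \<noteq> \<one>\<^bsub>N\<^esub>"
    using inj_onD[OF f(2) _ A(1) UT.one_closed] hom_one[OF f(1) group_UT_int N(1)] A(2)
    by (auto simp: one_UT_int)
  ultimately show ?thesis using f(1) by blast
qed

lemma residually_subgroup_UT_product:
  assumes K: "subgroup K UT_product"
    and res: "\<And>r A. A \<in> carrier (UT_int r) \<Longrightarrow> A \<noteq> 1\<^sub>m r \<Longrightarrow>
      \<exists>(N :: nat monoid) \<phi>. \<F> N \<and> \<phi> \<in> hom (UT_int r) N \<and> \<phi> A \<noteq> \<one>\<^bsub>N\<^esub>"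
  shows "residually \<F> (UT_product\<lparr>carrier := K\<rparr>)"
  unfolding residually_def
proof (intro ballI impI)
  let ?U = "UT_product\<lparr>carrier := K\<rparr>"
  fix g assume g: "g \<in> carrier ?U" "g \<noteq> \<one>\<^bsub>?U\<^esub>"
  have KP: "K \<subseteq> (\<Pi>\<^sub>E r\<in>{1..}. carrier (UT_int r))"
    using subgroup.subset[OF K] by (simp add: UT_product_def)
  have gP: "g \<in> (\<Pi>\<^sub>E r\<in>{1..}. carrier (UT_int r))" using g(1) KP by auto
  have "\<exists>r\<in>{1..}. g r \<noteq> 1\<^sub>m r"
  proof (rule ccontr)
    assume "\<not> ?thesis"
    then have "g = (\<lambda>r\<in>{1..}. \<one>\<^bsub>UT_int r\<^esub>)"
      using gP by (auto simp: PiE_iff extensional_def fun_eq_iff one_UT_int)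
    then show False using g(2) by (simp add: UT_product_def)
  qed
  then obtain r where r: "r \<in> {1..}" "g r \<noteq> 1\<^sub>m r" by blast
  have "g r \<in> carrier (UT_int r)" using gP r(1) by blast
  from res[OF this r(2)] obtain N :: "nat monoid" and \<phi> where
    N: "\<F> N" "\<phi> \<in> hom (UT_int r) N" "\<phi> (g r) \<noteq> \<one>\<^bsub>N\<^esub>" by blast
  have "(\<lambda>x. x r) \<in> hom ?U (UT_int r)"
    by (rule homI) (use KP r(1) in \<open>auto simp: UT_product_def\<close>)
  then have "\<phi> \<circ> (\<lambda>x. x r) \<in> hom ?U N" using N(2) by (rule hom_compose)
  then show "\<exists>Q \<phi>. \<F> Q \<and> \<phi> \<in> hom ?U Q \<and> \<phi> g \<noteq> \<one>\<^bsub>Q\<^esub>"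
    using N(1,3) by (intro exI[of _ N] exI[of _ "\<phi> \<circ> (\<lambda>x. x r)"]) simp
qed

section \<open>A finitely generated group of unitriangular sequences\<close>

text \<open>Encoding 0/1 matrices by relations turns products into relational composition, so
  identities between matrices of arbitrary size become computations with sets.\<close>

definition unit_mat :: "nat \<Rightarrow> (nat \<times> nat) set \<Rightarrow> int mat"
  where "unit_mat N S = mat N N (\<lambda>(i, j). if i = j \<or> (i, j) \<in> S then 1 else 0)"

definition strict_rel :: "nat \<Rightarrow> (nat \<times> nat) set \<Rightarrow> bool"
  where "strict_rel N S \<longleftrightarrow> (\<forall>(i, j)\<in>S. i < j \<and> j < N)"

lemma unit_mat_closed: "strict_rel N S \<Longrightarrow> unit_mat N S \<in> carrier (UT_int N)"
  by (rule carrier_UT_intI) (auto simp: unit_mat_def strict_rel_def)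

lemma unit_mat_inject:
  assumes "strict_rel N S" "strict_rel N T" "unit_mat N S = unit_mat N T"
  shows "S = T"
proof -
  have "(i, j) \<in> S \<longleftrightarrow> (i, j) \<in> T" if "i < j" "j < N" for i j
    using arg_cong[OF assms(3), of "\<lambda>A. A $$ (i, j)"] that by (simp add: unit_mat_def split: if_splits)
  then show ?thesis using assms(1,2) by (auto simp: strict_rel_def)
qed

text \<open>Multiplying out (1 + S)(1 + T) gives 1 + S + T + ST. Single-valuedness of
  \<open>S\<close> allows at most one intermediate index in ST, and disjointness keeps the three
  parts apart, so no entry exceeds \<open>1\<close>.\<close>

lemma unit_mat_mult:
  assumes S: "strict_rel N S" "single_valued S" and T: "strict_rel N T"
    and disj: "S \<inter> T = {}" "(S O T) \<inter> (S \<union> T) = {}"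
  shows "unit_mat N S * unit_mat N T = unit_mat N (S \<union> T \<union> S O T)"
proof (rule eq_matI)
  fix i j assume "i < dim_row (unit_mat N (S \<union> T \<union> S O T))" "j < dim_col (unit_mat N (S \<union> T \<union> S O T))"
  then have ij: "i < N" "j < N" by (auto simp: unit_mat_def)
  let ?b = "\<lambda>P. if P then 1 else 0 :: int"
  have irr: "(k, k) \<notin> S" "(k, k) \<notin> T" for k using S(1) T by (auto simp: strict_rel_def)
  have irr2: "(k, k) \<notin> S O T" for k using S(1) T by (fastforce simp: strict_rel_def)
  have "(unit_mat N S * unit_mat N T) $$ (i, j)
      = (\<Sum>m<N. ?b (i = m \<or> (i, m) \<in> S) * ?b (m = j \<or> (m, j) \<in> T))"
    using mult_entry[of "unit_mat N S" N "unit_mat N T" i j] ij by (simp add: unit_mat_def)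
  also have "\<dots> = (\<Sum>m<N. ?b (m = i) * ?b (i = j \<or> (i, j) \<in> T) + ?b (m = j) * ?b ((i, j) \<in> S)
      + ?b ((i, m) \<in> S \<and> (m, j) \<in> T))"
    using irr by (intro sum.cong) auto
  also have "\<dots> = ?b (i = j \<or> (i, j) \<in> T) + ?b ((i, j) \<in> S) + (\<Sum>m<N. ?b ((i, m) \<in> S \<and> (m, j) \<in> T))"
    using ij by (simp add: sum.distrib flip: sum_distrib_right)
  also have "(\<Sum>m<N. ?b ((i, m) \<in> S \<and> (m, j) \<in> T)) = ?b ((i, j) \<in> S O T)"
  proof (cases "(i, j) \<in> S O T")
    case True
    then obtain k where k: "(i, k) \<in> S" "(k, j) \<in> T" by auto
    then have kN: "k < N" using S(1) by (auto simp: strict_rel_def)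
    have "((i, m) \<in> S \<and> (m, j) \<in> T) = (m = k)" for m
      using k S(2) by (auto dest: single_valuedD)
    then show ?thesis using True kN by simp
  next
    case False
    then have "(\<Sum>m<N. ?b ((i, m) \<in> S \<and> (m, j) \<in> T)) = 0" by (intro sum.neutral) auto
    then show ?thesis using False by simp
  qed
  also have "?b (i = j \<or> (i, j) \<in> T) + ?b ((i, j) \<in> S) + ?b ((i, j) \<in> S O T)
      = ?b (i = j \<or> (i, j) \<in> S \<union> T \<union> S O T)"
    using irr irr2 disj by auto
  also have "\<dots> = unit_mat N (S \<union> T \<union> S O T) $$ (i, j)"
    using ij by (simp add: unit_mat_def)
  finally show "(unit_mat N S * unit_mat N T) $$ (i, j) = unit_mat N (S \<union> T \<union> S O T) $$ (i, j)" .
qed (auto simp: unit_mat_def)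

text \<open>The off-diagonal positions of the matrices \<open>w\<^sub>i\<close>, \<open>x\<^sub>j\<close>, \<open>c\<close> and \<open>a\<close> from the introduction.\<close>

definition rel_w :: "nat \<Rightarrow> nat \<Rightarrow> (nat \<times> nat) set"
  where "rel_w r i = (if i \<le> r then {(0, i + 1)} else {})"

definition rel_x :: "nat \<Rightarrow> nat \<Rightarrow> (nat \<times> nat) set"
  where "rel_x r j = (if j \<le> r then {(2 * r + 1 - j, 2 * r + 2)} else {})"

definition rel_c :: "nat \<Rightarrow> (nat \<times> nat) set"
  where "rel_c r = {(k, k + 1) | k. 1 \<le> k \<and> k \<le> r}"

definition rel_a :: "nat \<Rightarrow> (nat \<times> nat) set"
  where "rel_a r = {(k, k + 1) | k. r + 1 \<le> k \<and> k \<le> 2 * r}"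

lemma strict_rels:
  "strict_rel (2 * r + 3) (rel_w r i)" "strict_rel (2 * r + 3) (rel_x r i)"
  "strict_rel (2 * r + 3) (rel_c r)" "strict_rel (2 * r + 3) (rel_a r)"
  by (auto simp: strict_rel_def rel_w_def rel_x_def rel_c_def rel_a_def)

lemma single_valued_rels:
  "single_valued (rel_w r i)" "single_valued (rel_x r i)"
  "single_valued (rel_c r)" "single_valued (rel_a r)"
  by (auto simp: single_valued_def rel_w_def rel_x_def rel_c_def rel_a_def)

abbreviation mat_of :: "nat \<Rightarrow> (nat \<times> nat) set \<Rightarrow> int mat"
  where "mat_of r \<equiv> unit_mat (2 * r + 3)"

text \<open>The recursion w_(i+1) = [w_i, c], cleared of inverses. Composing
  \<open>rel_w r i\<close> with \<open>rel_c r\<close> moves the end of the path up by one; from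
  \<open>i = r\<close> on the result is empty, as is \<open>rel_w r (Suc i)\<close>.\<close>

lemma mat_w_step:
  "mat_of r (rel_c r) * (mat_of r (rel_w r i) * mat_of r (rel_w r (Suc i))) = mat_of r (rel_w r i) * mat_of r (rel_c r)"
proof -
  have 1: "rel_w r i O rel_w r (Suc i) = {}" "rel_w r i \<inter> rel_w r (Suc i) = {}"
    by (auto simp: rel_w_def)
  have "mat_of r (rel_w r i) * mat_of r (rel_w r (Suc i)) = mat_of r (rel_w r i \<union> rel_w r (Suc i))"
    using unit_mat_mult[OF strict_rels(1) single_valued_rels(1) strict_rels(1) 1(2)] 1(1) by simp
  moreover have 2: "rel_c r O (rel_w r i \<union> rel_w r (Suc i)) = {}"
      "rel_c r \<inter> (rel_w r i \<union> rel_w r (Suc i)) = {}"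
    by (auto simp: rel_w_def rel_c_def)
  have "strict_rel (2 * r + 3) (rel_w r i \<union> rel_w r (Suc i))"
    using strict_rels(1)[of r i] strict_rels(1)[of r "Suc i"] by (auto simp: strict_rel_def)
  from unit_mat_mult[OF strict_rels(3) single_valued_rels(3) this 2(2)] 2(1)
  have "mat_of r (rel_c r) * mat_of r (rel_w r i \<union> rel_w r (Suc i)) = mat_of r (rel_c r \<union> (rel_w r i \<union> rel_w r (Suc i)))"
    by simp
  moreover have 3: "rel_w r i O rel_c r = rel_w r (Suc i)"
    by (auto simp: rel_w_def rel_c_def relcomp_unfold)
  have 4: "rel_w r i \<inter> rel_c r = {}" "rel_w r (Suc i) \<inter> (rel_w r i \<union> rel_c r) = {}"
    by (auto simp: rel_w_def rel_c_def)
  have "mat_of r (rel_w r i) * mat_of r (rel_c r) = mat_of r (rel_w r i \<union> rel_c r \<union> rel_w r (Suc i))"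
    using unit_mat_mult[OF strict_rels(1) single_valued_rels(1) strict_rels(3) 4(1)] 4(2) unfolding 3 by simp
  moreover have "rel_c r \<union> (rel_w r i \<union> rel_w r (Suc i)) = rel_w r i \<union> rel_c r \<union> rel_w r (Suc i)" by auto
  ultimately show ?thesis by simp
qed

text \<open>The mirror image of the step for w: composition with \<open>rel_a r\<close> on the left
  moves the start of the path down by one. The new factor stands on the left, so the recursion reads
  x_(j+1) = a x_j a^-1 x_j^-1.\<close>

lemma mat_x_step:
  "mat_of r (rel_x r (Suc j)) * (mat_of r (rel_x r j) * mat_of r (rel_a r)) = mat_of r (rel_a r) * mat_of r (rel_x r j)"
proof -
  have 1: "rel_x r j O rel_a r = {}" "rel_x r j \<inter> rel_a r = {}"
    by (auto simp: rel_x_def rel_a_def)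
  have "mat_of r (rel_x r j) * mat_of r (rel_a r) = mat_of r (rel_x r j \<union> rel_a r)"
    using unit_mat_mult[OF strict_rels(2) single_valued_rels(2) strict_rels(4) 1(2)] 1(1) by simp
  moreover have 2: "rel_x r (Suc j) O (rel_x r j \<union> rel_a r) = {}"
      "rel_x r (Suc j) \<inter> (rel_x r j \<union> rel_a r) = {}"
    by (auto simp: rel_x_def rel_a_def)
  have "strict_rel (2 * r + 3) (rel_x r j \<union> rel_a r)"
    using strict_rels(2)[of r j] strict_rels(4)[of r] by (auto simp: strict_rel_def)
  from unit_mat_mult[OF strict_rels(2) single_valued_rels(2) this 2(2)] 2(1)
  have "mat_of r (rel_x r (Suc j)) * mat_of r (rel_x r j \<union> rel_a r) = mat_of r (rel_x r (Suc j) \<union> (rel_x r j \<union> rel_a r))"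
    by simp
  moreover have 3: "rel_a r O rel_x r j = rel_x r (Suc j)"
    by (auto simp: rel_x_def rel_a_def relcomp_unfold)
  have 4: "rel_a r \<inter> rel_x r j = {}" "rel_x r (Suc j) \<inter> (rel_a r \<union> rel_x r j) = {}"
    by (auto simp: rel_x_def rel_a_def)
  have "mat_of r (rel_a r) * mat_of r (rel_x r j) = mat_of r (rel_a r \<union> rel_x r j \<union> rel_x r (Suc j))"
    using unit_mat_mult[OF strict_rels(4) single_valued_rels(4) strict_rels(2) 4(1)] 4(2) unfolding 3 by simp
  moreover have "rel_x r (Suc j) \<union> (rel_x r j \<union> rel_a r) = rel_a r \<union> rel_x r j \<union> rel_x r (Suc j)" by auto
  ultimately show ?thesis by simp
qed

text \<open>The product xw has no cross term, since w starts in row \<open>0\<close> and x ends in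
  the last column. In wx a cross term arises exactly when the end \<open>i + 1\<close> of the one
  meets the start \<open>2 * r + 1 - j\<close> of the other.\<close>

lemma mat_xw_commute_iff:
  "mat_of r (rel_x r j) * mat_of r (rel_w r i) = mat_of r (rel_w r i) * mat_of r (rel_x r j) \<longleftrightarrow> \<not> (i = r \<and> j = r)"
proof -
  have 1: "rel_x r j O rel_w r i = {}" "rel_x r j \<inter> rel_w r i = {}"
    by (auto simp: rel_x_def rel_w_def)
  have xw: "mat_of r (rel_x r j) * mat_of r (rel_w r i) = mat_of r (rel_x r j \<union> rel_w r i)"
    using unit_mat_mult[OF strict_rels(2) single_valued_rels(2) strict_rels(1) 1(2)] 1(1) by simp
  have 2: "rel_w r i O rel_x r j = (if i = r \<and> j = r then {(0, 2 * r + 2)} else {})"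
    by (auto simp: rel_x_def rel_w_def)
  have 3: "rel_w r i \<inter> rel_x r j = {}" "rel_w r i O rel_x r j \<inter> (rel_w r i \<union> rel_x r j) = {}"
    unfolding 2 by (auto simp: rel_x_def rel_w_def)
  have wx: "mat_of r (rel_w r i) * mat_of r (rel_x r j) = mat_of r (rel_w r i \<union> rel_x r j \<union> rel_w r i O rel_x r j)"
    by (rule unit_mat_mult[OF strict_rels(1) single_valued_rels(1) strict_rels(2) 3])
  have s: "strict_rel (2 * r + 3) (rel_x r j \<union> rel_w r i)"
      "strict_rel (2 * r + 3) (rel_w r i \<union> rel_x r j \<union> rel_w r i O rel_x r j)"
    using strict_rels(1)[of r i] strict_rels(2)[of r j] unfolding 2 by (auto simp: strict_rel_def)
  have "rel_x r j \<union> rel_w r i = rel_w r i \<union> rel_x r j \<union> rel_w r i O rel_x r j \<longleftrightarrow> \<not> (i = r \<and> j = r)"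
    using 3(2) 2 by (cases "i = r \<and> j = r") auto
  then show ?thesis unfolding xw wx using unit_mat_inject[OF s] by metis
qed

text \<open>The product runs over all sizes, while the construction lives on the sizes 2r + 3. In
  the other coordinates everything is the identity, where the required equations hold
  trivially.\<close>

definition odd_family :: "(nat \<Rightarrow> (nat \<times> nat) set) \<Rightarrow> nat \<Rightarrow> int mat"
  where "odd_family R = (\<lambda>N\<in>{1..}. if \<exists>r. N = 2 * r + 3 then unit_mat N (R ((N - 3) div 2)) else 1\<^sub>m N)"

lemma odd_family_closed:
  assumes "\<And>r. strict_rel (2 * r + 3) (R r)"
  shows "odd_family R \<in> carrier UT_product"
  using unit_mat_closed[OF assms] one_in_UT_int by (auto simp: odd_family_def UT_product_def)

lemma group_UT_product: "group UT_product"
  unfolding UT_product_def by (rule product_group) (rule group_UT_int)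

lemma odd_family_apply: "odd_family R (2 * r + 3) = mat_of r (R r)"
  by (auto simp: odd_family_def)

lemma odd_family_other: "N \<ge> 1 \<Longrightarrow> \<nexists>r. N = 2 * r + 3 \<Longrightarrow> odd_family R N = 1\<^sub>m N"
  by (auto simp: odd_family_def)

lemma mult_UT_product: "f \<otimes>\<^bsub>UT_product\<^esub> g = (\<lambda>N\<in>{1..}. f N * g N)"
  by (simp add: UT_product_def mult_UT_int)

lemma UT_product_odd_family_eqI:
  fixes f g :: "nat \<Rightarrow> int mat"
  assumes "f \<in> extensional {1..}" "g \<in> extensional {1..}"
    and "\<And>r. f (2 * r + 3) = g (2 * r + 3)"
    and "\<And>N. N \<ge> 1 \<Longrightarrow> \<nexists>r. N = 2 * r + 3 \<Longrightarrow> f N = g N"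
  shows "f = g"
proof (rule extensionalityI[OF assms(1,2)])
  fix N :: nat assume "N \<in> {1..}"
  then show "f N = g N" using assms(3,4) by (cases "\<exists>r. N = 2 * r + 3") auto
qed

lemma UT_product_fg_subgroup:
  "\<exists>K. subgroup K UT_product \<and> finitely_generated_group (UT_product\<lparr>carrier := K\<rparr>) \<and>
    \<not> equationally_noetherian (UT_product\<lparr>carrier := K\<rparr>)"
proof -
  interpret P: group UT_product by (rule group_UT_product)
  define w where "w = (\<lambda>i. odd_family (\<lambda>r. rel_w r i))"
  define x where "x = (\<lambda>i. odd_family (\<lambda>r. rel_x r i))"
  define c where "c = odd_family rel_c"
  define a where "a = odd_family rel_a"
  have cl: "w i \<in> carrier UT_product" "x i \<in> carrier UT_product" "c \<in> carrier UT_product" "a \<in> carrier UT_product" for i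
    unfolding w_def x_def c_def a_def by (intro odd_family_closed strict_rels)+
  have w_step: "c \<otimes>\<^bsub>UT_product\<^esub> (w i \<otimes>\<^bsub>UT_product\<^esub> w (Suc i)) = w i \<otimes>\<^bsub>UT_product\<^esub> c" for i
    by (rule UT_product_odd_family_eqI)
      (simp_all add: mult_UT_product w_def c_def odd_family_apply mat_w_step odd_family_other)
  have x_step: "x (Suc j) \<otimes>\<^bsub>UT_product\<^esub> (x j \<otimes>\<^bsub>UT_product\<^esub> a) = a \<otimes>\<^bsub>UT_product\<^esub> x j" for j
    by (rule UT_product_odd_family_eqI)
      (simp_all add: mult_UT_product x_def a_def odd_family_apply mat_x_step odd_family_other)
  have commute: "x j \<otimes>\<^bsub>UT_product\<^esub> w i = w i \<otimes>\<^bsub>UT_product\<^esub> x j" if "i \<noteq> j" for i j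
  proof (rule UT_product_odd_family_eqI)
    fix r
    have "\<not> (i = r \<and> j = r)" using that by auto
    then show "(x j \<otimes>\<^bsub>UT_product\<^esub> w i) (2 * r + 3) = (w i \<otimes>\<^bsub>UT_product\<^esub> x j) (2 * r + 3)"
      using mat_xw_commute_iff[of r j i] by (simp add: mult_UT_product w_def x_def odd_family_apply)
  qed (simp_all add: mult_UT_product w_def x_def odd_family_other)
  have noncommute: "x j \<otimes>\<^bsub>UT_product\<^esub> w j \<noteq> w j \<otimes>\<^bsub>UT_product\<^esub> x j" for j
  proof
    assume "x j \<otimes>\<^bsub>UT_product\<^esub> w j = w j \<otimes>\<^bsub>UT_product\<^esub> x j"
    then have "(x j \<otimes>\<^bsub>UT_product\<^esub> w j) (2 * j + 3) = (w j \<otimes>\<^bsub>UT_product\<^esub> x j) (2 * j + 3)" by simp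
    then show False
      using mat_xw_commute_iff[of j j j] by (simp add: mult_UT_product w_def x_def odd_family_apply)
  qed
  define K where "K = generate UT_product {w 0, c, x 0, a}"
  let ?U = "UT_product\<lparr>carrier := K\<rparr>"
  have gens: "{w 0, c, x 0, a} \<subseteq> carrier UT_product" using cl by auto
  have K: "subgroup K UT_product" unfolding K_def by (rule P.generate_is_subgroup[OF gens])
  interpret K: subgroup K UT_product by (rule K)
  interpret U: group ?U using K by (rule subgroup.subgroup_is_group) (rule group_UT_product)
  have gK: "w 0 \<in> K" "c \<in> K" "x 0 \<in> K" "a \<in> K" by (auto simp: K_def intro: generate.incl)
  have "generate ?U {w 0, c, x 0, a} = K"
    using P.generate_consistent[OF _ K, of "{w 0, c, x 0, a}"] gK by (simp add: K_def)
  then have fg: "finitely_generated_group ?U"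
    unfolding finitely_generated_group_def using gK by (intro exI[of _ "{w 0, c, x 0, a}"]) auto
  \<comment> \<open>The test elements have to lie in \<open>K\<close>; this is the purpose of the
    generators \<open>x 0\<close> and \<open>a\<close>.\<close>
  have x_in: "x j \<in> K" for j
  proof (induction j)
    case (Suc j)
    have "x (Suc j) = (a \<otimes>\<^bsub>UT_product\<^esub> x j) \<otimes>\<^bsub>UT_product\<^esub> inv\<^bsub>UT_product\<^esub> (x j \<otimes>\<^bsub>UT_product\<^esub> a)"
      using P.inv_solve_right[of "x (Suc j)" "a \<otimes>\<^bsub>UT_product\<^esub> x j" "x j \<otimes>\<^bsub>UT_product\<^esub> a"] x_step[of j] cl by simp
    then show ?case using Suc gK by simp
  qed (rule gK)
  \<comment> \<open>The two auxiliary variables of the equations stand for \<open>w 0\<close> and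
    \<open>c\<close>, from which all \<open>w i\<close> are obtained.\<close>
  define b where "b = (\<lambda>i :: nat. if i = 1 then w 0 else c)"
  have bU: "b \<in> {1..2} \<rightarrow> carrier ?U" using gK by (simp add: b_def)
  have img: "b ` {1..2} = {w 0, c}"
  proof -
    have "{1..2} = {1, 2 :: nat}" by auto
    then show ?thesis by (auto simp: b_def)
  qed
  have gen_sub: "subgroup (generate UT_product {w 0, c}) UT_product"
    by (rule P.generate_is_subgroup) (use cl in auto)
  have w_in: "w i \<in> generate UT_product {w 0, c}" for i
  proof (induction i)
    case 0
    then show ?case by (auto intro: generate.incl)
  next
    case (Suc i)
    have "(c \<otimes>\<^bsub>UT_product\<^esub> w i) \<otimes>\<^bsub>UT_product\<^esub> w (Suc i) = w i \<otimes>\<^bsub>UT_product\<^esub> c"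
      using w_step[of i] cl by (simp add: P.m_assoc)
    then have "w (Suc i) = inv\<^bsub>UT_product\<^esub> (c \<otimes>\<^bsub>UT_product\<^esub> w i) \<otimes>\<^bsub>UT_product\<^esub> (w i \<otimes>\<^bsub>UT_product\<^esub> c)"
      using P.inv_solve_left[of "w (Suc i)" "c \<otimes>\<^bsub>UT_product\<^esub> w i" "w i \<otimes>\<^bsub>UT_product\<^esub> c"] cl by simp
    moreover have "c \<in> generate UT_product {w 0, c}" by (rule generate.incl) simp
    ultimately show ?case
      using Suc gen_sub by (simp add: subgroup.m_closed subgroup.m_inv_closed)
  qed
  have "generate ?U {w 0, c} = generate UT_product {w 0, c}"
    by (rule P.generate_consistent[OF _ K]) (use gK in auto)
  then have w_gen: "w i \<in> generate ?U (b ` {1..2})" for i using w_in img by simp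
  have "\<not> equationally_noetherian ?U"
  proof (rule U.not_equationally_noetherianI[OF bU, of UNIV w])
    fix F :: "nat set" assume "finite F"
    then obtain j where j: "j \<notin> F" using ex_new_if_finite infinite_UNIV_nat by blast
    show "\<exists>y\<in>carrier ?U. (\<forall>i\<in>F. y \<otimes>\<^bsub>?U\<^esub> w i = w i \<otimes>\<^bsub>?U\<^esub> y) \<and>
        (\<exists>i\<in>UNIV. y \<otimes>\<^bsub>?U\<^esub> w i \<noteq> w i \<otimes>\<^bsub>?U\<^esub> y)"
    proof (intro bexI[of _ "x j"] conjI ballI)
      show "x j \<otimes>\<^bsub>?U\<^esub> w i = w i \<otimes>\<^bsub>?U\<^esub> x j" if "i \<in> F" for i
        using commute[of i j] that j by auto
      show "\<exists>i\<in>UNIV. x j \<otimes>\<^bsub>?U\<^esub> w i \<noteq> w i \<otimes>\<^bsub>?U\<^esub> x j" using noncommute[of j] by auto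
    qed (use x_in in simp)
  qed (use w_gen in simp)
  then show ?thesis using K fg by blast
qed

theorem proposition1p6:
  shows "(\<exists>K. subgroup K UT_product \<and>
            finitely_generated_group (UT_product\<lparr>carrier := K\<rparr>) \<and>
            \<not> equationally_noetherian (UT_product\<lparr>carrier := K\<rparr>) \<and>
            residually torsion_free_nilpotent (UT_product\<lparr>carrier := K\<rparr>) \<and>
            (\<forall>p :: nat. Factorial_Ring.prime p \<longrightarrow> residually (finite_p_group p) (UT_product\<lparr>carrier := K\<rparr>)))
       \<and> (\<forall>(G :: ('a, 'm) monoid_scheme) (H :: ('b, 'k) monoid_scheme).
            comm_group G \<and> carrier G \<noteq> {\<one>\<^bsub>G\<^esub>} \<and> finitely_generated_group G \<and>
            group H \<and> finitely_generated_group H \<and>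
            (\<exists>L. subgroup L H \<and> infinite L \<and> locally_finite (H\<lparr>carrier := L\<rparr>))
            \<longrightarrow> \<not> equationally_noetherian (wreath_product G H) \<and>
                (cyclic_subgroup_separable H \<and> conjugacy_separable H \<longrightarrow>
                   cyclic_subgroup_separable (wreath_product G H) \<and>
                   conjugacy_separable (wreath_product G H)))"
proof (intro conjI allI impI)
  obtain K where K: "subgroup K UT_product" "finitely_generated_group (UT_product\<lparr>carrier := K\<rparr>)"
    "\<not> equationally_noetherian (UT_product\<lparr>carrier := K\<rparr>)"
    using UT_product_fg_subgroup by blast
  have "residually torsion_free_nilpotent (UT_product\<lparr>carrier := K\<rparr>)"
    using K(1) UT_int_residually_torsion_free_nilpotent by (rule residually_subgroup_UT_product)
  moreover have "residually (finite_p_group p) (UT_product\<lparr>carrier := K\<rparr>)"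
    if "Factorial_Ring.prime p" for p :: nat
    using K(1) UT_int_residually_finite_p[OF that] by (rule residually_subgroup_UT_product)
  ultimately show "\<exists>K. subgroup K UT_product \<and>
            finitely_generated_group (UT_product\<lparr>carrier := K\<rparr>) \<and>
            \<not> equationally_noetherian (UT_product\<lparr>carrier := K\<rparr>) \<and>
            residually torsion_free_nilpotent (UT_product\<lparr>carrier := K\<rparr>) \<and>
            (\<forall>p :: nat. Factorial_Ring.prime p \<longrightarrow> residually (finite_p_group p) (UT_product\<lparr>carrier := K\<rparr>))"
    using K by blast
next
  fix G :: "('a, 'm) monoid_scheme" and H :: "('b, 'k) monoid_scheme"
  assume GH: "comm_group G \<and> carrier G \<noteq> {\<one>\<^bsub>G\<^esub>} \<and> finitely_generated_group G \<and>
    group H \<and> finitely_generated_group H \<and>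
    (\<exists>L. subgroup L H \<and> infinite L \<and> locally_finite (H\<lparr>carrier := L\<rparr>))"
  then interpret abelian_wreath G H by (simp add: abelian_wreath_def)
  show "\<not> equationally_noetherian (wreath_product G H)"
    using GH wreath_not_equationally_noetherian by blast
  assume "cyclic_subgroup_separable H \<and> conjugacy_separable H"
  then show "cyclic_subgroup_separable (wreath_product G H)" "conjugacy_separable (wreath_product G H)"
    using GH cyclic_subgroup_separable_wreath conjugacy_separable_wreath by blast+
qed

end
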